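(* Let $G_0$ be a graph with at least one edge, and let $W$ be the standardized number of copies of $G_0$ in the Erdős–Rényi random graph $G(n,p)$, $p\in(0,1)$, $q=1-p$. Assume $n\ge 4v_{G_0}^2$. Then for all $t\ge0$, $$\Big|\frac{\mathbb{P}(W>t)}{1-\Phi(t)}-1\Big|\le 50\,c_{G_0}\exp\big(c_{G_0}\,t^2\,s(t)\big)\,(1+t^2)\,s(t),$$ where $$s(t)=\Big(1+\frac{t}{\min\{\sqrt{\Psi_{\min}},1\}}\Big)\frac{1}{\sqrt{q\Psi_{\min}}}\exp\Big(\frac{5Dt}{\sigma}\Big),\qquad c_{G_0}=\frac{2^{\frac92+\frac{15}{2}e_{G_0}}\,(v_{G_0}!)^4\,e_{G_0}}{\operatorname{aut}(G_0)^{3/2}}.$$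
   Context: In $G(n,p)$ on $n$ vertices each of the $\binom n2$ possible edges is present independently with probability $p$ (which may depend on $n$). A copy of $G_0$ in $G(n,p)$ is a subgraph isomorphic to $G_0$; copies are identified by their edge sets. Let $\mathcal{M}$ be the set of edge sets $\Gamma$ of the complete graph $K_n$ that form a copy of $G_0$ (i.e. the graph spanned by $\Gamma$ is isomorphic to $G_0$ with isolated vertices removed), and let $N=\sum_{\Gamma\in\mathcal{M}}\mathbf 1\{\text{all edges of }\Gamma\text{ present}\}$ be the number of copies; $\sigma^2:=\operatorname{Var}(N)$ and $W=(N-\mathbb{E}N)/\sigma$. $D$ is the number of $\Gamma'\in\mathcal{M}$ with $\Gamma'\cap\Gamma\neq\emptyset$ for a fixed $\Gamma\in\mathcal{M}$ (independent of $\Gamma$ by symmetry). $v_H$, $e_H$, $\operatorname{aut}(H)$ denote the number of vertices, edges and automorphisms of a graph $H$; $\Psi_{\min}:=\min\{n^{v_H}p^{e_H}: H\subset G_0,\ e_H\ge1\}$. $\Phi$ is the standard normal distribution function. *)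

theory Defs
  imports "HOL-Probability.Probability"
begin

definition simple_graph :: "'a set \<Rightarrow> 'a set set \<Rightarrow> bool" where
  "simple_graph V E \<longleftrightarrow> finite V \<and> (\<forall>e\<in>E. e \<subseteq> V \<and> card e = 2)"

definition graph_iso :: "'a set \<Rightarrow> 'a set set \<Rightarrow> 'b set \<Rightarrow> 'b set set \<Rightarrow> bool" where
  "graph_iso V1 E1 V2 E2 \<longleftrightarrow> (\<exists>f. bij_betw f V1 V2 \<and>
     (\<forall>x\<in>V1. \<forall>y\<in>V1. {x, y} \<in> E1 \<longleftrightarrow> {f x, f y} \<in> E2))"

definition aut :: "'a set \<Rightarrow> 'a set set \<Rightarrow> nat" where
  "aut V E = card {f. bij_betw f V V \<and> (\<forall>x. x \<notin> V \<longrightarrow> f x = x) \<and>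
     (\<forall>x\<in>V. \<forall>y\<in>V. {x, y} \<in> E \<longleftrightarrow> {f x, f y} \<in> E)}"

definition Kn_edges :: "nat \<Rightarrow> nat set set" where
  "Kn_edges n = {e. \<exists>i j. i < n \<and> j < n \<and> i \<noteq> j \<and> e = {i, j}}"

text \<open>Set M of copies of G0 = (V0,E0) in K_n, identified by edge sets: the graph
  spanned by Gamma is isomorphic to G0 with isolated vertices removed.\<close>
definition copies :: "nat \<Rightarrow> 'a set \<Rightarrow> 'a set set \<Rightarrow> nat set set set" where
  "copies n V0 E0 = {\<Gamma>. \<Gamma> \<subseteq> Kn_edges n \<and> graph_iso (\<Union>\<Gamma>) \<Gamma> (\<Union>E0) E0}"

definition Gnp :: "nat \<Rightarrow> real \<Rightarrow> (nat set \<Rightarrow> bool) pmf" where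
  "Gnp n p = Pi_pmf (Kn_edges n) False (\<lambda>_. bernoulli_pmf p)"

definition num_copies :: "nat \<Rightarrow> 'a set \<Rightarrow> 'a set set \<Rightarrow> (nat set \<Rightarrow> bool) \<Rightarrow> real" where
  "num_copies n V0 E0 \<omega> = (\<Sum>\<Gamma>\<in>copies n V0 E0. if (\<forall>e\<in>\<Gamma>. \<omega> e) then 1 else 0)"

definition sigma_copies :: "nat \<Rightarrow> real \<Rightarrow> 'a set \<Rightarrow> 'a set set \<Rightarrow> real" where
  "sigma_copies n p V0 E0 = sqrt (measure_pmf.variance (Gnp n p) (num_copies n V0 E0))"

definition W_copies :: "nat \<Rightarrow> real \<Rightarrow> 'a set \<Rightarrow> 'a set set \<Rightarrow> (nat set \<Rightarrow> bool) \<Rightarrow> real" where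
  "W_copies n p V0 E0 \<omega> = (num_copies n V0 E0 \<omega> - measure_pmf.expectation (Gnp n p) (num_copies n V0 E0))
      / sigma_copies n p V0 E0"

text \<open>D: number of copies sharing an edge with a fixed copy (independent of the copy).\<close>
definition D_copies :: "nat \<Rightarrow> 'a set \<Rightarrow> 'a set set \<Rightarrow> nat" where
  "D_copies n V0 E0 = (let \<Gamma> = (SOME \<Gamma>. \<Gamma> \<in> copies n V0 E0) in
      card {\<Gamma>' \<in> copies n V0 E0. \<Gamma>' \<inter> \<Gamma> \<noteq> {}})"

definition Psi_min :: "nat \<Rightarrow> real \<Rightarrow> 'a set \<Rightarrow> 'a set set \<Rightarrow> real" where
  "Psi_min n p V0 E0 = Min {real n ^ card VH * p ^ card EH | VH EH.
      VH \<subseteq> V0 \<and> EH \<subseteq> E0 \<and> (\<forall>e\<in>EH. e \<subseteq> VH) \<and> card EH \<ge> 1}"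

definition Phi :: "real \<Rightarrow> real" where
  "Phi t = measure (density lborel std_normal_density) {..t}"

end

theory Submission
  imports Defs
begin

text \<open>
  Write a random graph as the set of its edges, with indicators \<open>\<xi>\<^sub>k\<close> that are independent with mean
  \<open>p\<close>. Telescoping each product \<open>\<Prod>\<^bsub>k\<in>\<Gamma>\<^esub> \<xi>\<^sub>k - p\<^sup>e\<close> along its edges gives
  \<open>W = \<Sum>\<^sub>a c\<^sub>a (\<xi>\<^sub>k - p) \<xi>\<^sup>B\<close> with \<open>c\<^sub>a \<ge> 0\<close> and \<open>k = k\<^sub>a \<notin> B = B\<^sub>a\<close>, so that
  \<open>E W F(W) = p q \<Sum>\<^sub>a c\<^sub>a E \<xi>\<^sup>B (F(W\<^bsub>k=1\<^esub>) - F(W\<^bsub>k=0\<^esub>))\<close>. Since \<open>W\<close> is increasing in every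
  \<open>\<xi>\<^sub>k\<close>, replacing the increment of \<open>F\<close> by \<open>F'\<close> times that of \<open>W\<close> costs, for monotone \<open>F'\<close>, exactly an
  expectation \<open>E U F'(W)\<close>, and no concentration inequality is needed:
  \<open>E W F(W) - E F'(W)\<close> is controlled by \<open>|V|\<close> and \<open>|U|\<close>, where \<open>1 + V\<close> is the Stein kernel.

  This is applied to \<open>F(w) = e\<^bsup>\<theta>w\<^esup>\<close>, which shows \<open>E e\<^bsup>tW\<^esup> \<approx> e\<^bsup>t\<^sup>2/2\<^esup>\<close>, and to the solution of
  \<open>F' - w F = e\<^bsup>t\<^sup>2\<^esup> 1\<^bsub>w>t\<^esub> - \<kappa> e\<^bsup>tw\<^esup>\<close> with \<open>\<kappa>\<close> the Gaussian value, which compares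
  \<open>e\<^bsup>t\<^sup>2\<^esup> Pr(W > t)\<close> with \<open>\<kappa> E e\<^bsup>tW\<^esup>\<close>. The second moments of \<open>U\<close> and \<open>V\<close> under the weight
  \<open>e\<^bsup>\<theta>W\<^esup>\<close> obey the same integration by parts and reduce to sums of \<open>p\<^bsup>|\<Gamma>\<^sub>1 \<union> \<dots> \<union> \<Gamma>\<^sub>r|\<^esup>\<close> over overlapping
  copies; every further overlapping copy costs a factor of order \<open>E N / \<Psi>\<close>, while
  \<open>\<sigma>\<^sup>2 \<ge> q (E N)\<^sup>2 / \<Psi>\<close>. If \<open>c s(t) \<ge> 1/2\<close>, the bound already exceeds \<open>1 / (1 - \<Phi>(t))\<close>.
\<close>

section \<open>Mills ratio and a Stein equation for the tail\<close>

text \<open>The error must be small relative to a tail of order e^(-t^2/2), so it is measured on the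
  scale of the tail. The weight e^(t^2) makes the weighted indicator at most e^(tw) everywhere, with
  equal heights at w = t; hence F' and its monotone parts stay below 3 e^(tw), and every error is a
  mean tilted by e^(tW), comparable with E e^(tW) itself. F has a kink at t, which is why the Stein
  identity asks for control of increments by a monotone function and not for a second derivative.

  Constants: the presence of r given copies moves W by at most r D / \<sigma>. The second moments
  involve four and six copies; together with the tilting factors and after a square root this fits
  into exp(5 D t / \<sigma>). Powers of 2 count the possible intersections of a copy with a union of
  at most five copies, v! counts placements of a subgraph, and n >= 4 v^2 keeps at least 3/4 of all
  maps injective. The bound obtained has 1 + t in place of 1 + t / min(...) and 16 e^2 (v!)^2 2^(6e)
  in place of c; both are then enlarged to the stated quantities.\<close>

lemma std_normal_density_has_derivative:
  "(std_normal_density has_real_derivative - x * std_normal_density x) (at x)"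
  unfolding std_normal_density_def
  by (auto intro!: derivative_eq_intros simp: field_simps power2_eq_square)

lemma Phi_has_derivative: "(Phi has_real_derivative std_normal_density x) (at x)"
proof -
  let ?N = "density lborel std_normal_density"
  interpret N: prob_space ?N by (rule prob_space_normal_density) simp
  have diff: "Phi y - Phi a = (LBINT u=a..y. std_normal_density u)" if "a \<le> y" for a y :: real
  proof -
    have "Phi y - Phi a = measure ?N ({..y} - {..a})"
      unfolding Phi_def using that by (intro N.finite_measure_Diff[symmetric]) auto
    also have "{..y} - {..a} = {a<..y}" by auto
    also have "measure ?N {a<..y} = (\<integral>u. indicator {a<..y} u * std_normal_density u \<partial>lborel)"
      unfolding measure_def
      by (subst emeasure_density) (auto simp: integral_eq_nn_integral ennreal_mult ennreal_indicator
          mult.commute intro!: arg_cong[where f = enn2real] nn_integral_cong)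
    also have "\<dots> = (LBINT u:{a<..y}. std_normal_density u)"
      unfolding set_lebesgue_integral_def by simp
    also have "\<dots> = (LBINT u=a..y. std_normal_density u)"
      using that by (subst interval_integral_Ioc) auto
    finally show ?thesis .
  qed
  have "((\<lambda>u. LBINT v=ereal (x - 1)..u. std_normal_density v) has_vector_derivative std_normal_density x)
      (at x within {x - 1..x + 1})"
    by (rule interval_integral_FTC2)
       (auto simp: std_normal_density_def intro!: continuous_intros)
  then have "((\<lambda>u. LBINT v=ereal (x - 1)..u. std_normal_density v) has_real_derivative std_normal_density x)
      (at x)"
    by (simp add: has_real_derivative_iff_has_vector_derivative at_within_Icc_at)
  then have "((\<lambda>u. (LBINT v=ereal (x - 1)..u. std_normal_density v) + Phi (x - 1))
      has_real_derivative std_normal_density x) (at x)"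
    by (auto intro!: derivative_eq_intros)
  then show ?thesis
  proof (rule DERIV_cong_ev[THEN iffD1, rotated -1])
    have "eventually (\<lambda>u. u > x - 1) (nhds x)"
      by (rule order_tendstoD[OF filterlim_ident]) simp
    then show "\<forall>\<^sub>F u in nhds x. (LBINT v=ereal (x - 1)..u. std_normal_density v) + Phi (x - 1) = Phi u"
      by eventually_elim (simp add: diff[symmetric])
  qed auto
qed

lemma Phi_tendsto_1: "(Phi \<longlongrightarrow> 1) at_top"
proof -
  interpret N: prob_space "density lborel std_normal_density"
    by (rule prob_space_normal_density) simp
  interpret N: real_distribution "density lborel std_normal_density"
    by unfold_locales auto
  show ?thesis
    using N.cdf_lim_at_top_prob by (simp add: Phi_def[abs_def] cdf_def[abs_def])
qed

text \<open>Common pattern of the Mills bounds: differentiating the difference of the two sides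
  removes the tail integral, and the limit at infinity fixes the sign.\<close>

lemma nonneg_of_decreasing_to_0:
  fixes f f' :: "real \<Rightarrow> real"
  assumes "\<And>x. a \<le> x \<Longrightarrow> (f has_real_derivative f' x) (at x)" "\<And>x. a \<le> x \<Longrightarrow> f' x \<le> 0"
    "(f \<longlongrightarrow> 0) at_top"
  shows "0 \<le> f a"
proof (rule tendsto_upperbound[OF assms(3)])
  show "\<forall>\<^sub>F x in at_top. f x \<le> f a"
    using eventually_ge_at_top[of a]
  proof eventually_elim
    case (elim x)
    show ?case
      by (rule DERIV_nonpos_imp_nonincreasing[OF elim]) (use assms in blast)
  qed
qed simp

section \<open>Mills ratio: bounds and monotonicity\<close>

definition mills :: "real \<Rightarrow> real" where
  "mills x = (1 - Phi x) / std_normal_density x"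

lemma one_minus_Phi_tendsto_0: "((\<lambda>x. 1 - Phi x) \<longlongrightarrow> 0) at_top"
  using tendsto_diff[OF tendsto_const Phi_tendsto_1, of 1] by simp

lemma mills_has_derivative [derivative_intros]:
  "(mills has_real_derivative x * mills x - 1) (at x)"
proof -
  have "std_normal_density x \<noteq> 0" by (simp add: std_normal_density_def)
  then show ?thesis
    unfolding mills_def
    by (auto intro!: derivative_eq_intros Phi_has_derivative std_normal_density_has_derivative
        simp: field_simps)
qed

lemma mills_nonneg: "0 \<le> mills x"
proof -
  interpret N: prob_space "density lborel std_normal_density"
    by (rule prob_space_normal_density) simp
  have "Phi x \<le> 1" by (simp add: Phi_def)
  then show ?thesis by (simp add: mills_def)
qed

text \<open>By \<open>mills_has_derivative\<close> this is the same as \<open>mills\<close> being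
  nonincreasing; it also serves directly as an upper bound.\<close>

lemma mills_mult_le_1: "x * mills x \<le> 1"
proof (cases "x > 0")
  case True
  let ?d = std_normal_density
  have "0 \<le> ?d x / x - (1 - Phi x)"
  proof (rule nonneg_of_decreasing_to_0[where a = x and f = "\<lambda>x. ?d x / x - (1 - Phi x)" and f' = "\<lambda>y. - ?d y / y\<^sup>2"])
    fix y assume "x \<le> y"
    then show "((\<lambda>x. ?d x / x - (1 - Phi x)) has_real_derivative - ?d y / y\<^sup>2) (at y)"
      using True by (auto intro!: derivative_eq_intros Phi_has_derivative
          std_normal_density_has_derivative simp: field_simps power2_eq_square)
    show "- ?d y / y\<^sup>2 \<le> 0" by simp
  next
    have "((\<lambda>x. ?d x / x) \<longlongrightarrow> 0) at_top" unfolding std_normal_density_def by real_asymp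
    from tendsto_diff[OF this one_minus_Phi_tendsto_0]
    show "((\<lambda>x. ?d x / x - (1 - Phi x)) \<longlongrightarrow> 0) at_top" by simp
  qed
  moreover have "?d x > 0" by (simp add: std_normal_density_def)
  ultimately show ?thesis using True by (simp add: mills_def field_simps)
next
  case False
  then show ?thesis using mills_nonneg[of x]
    by (smt (verit) mult_nonneg_nonneg mult_nonpos_nonneg)
qed

text \<open>The derivative of \<open>x * mills x\<close> is
  \<open>(1 + x\<^sup>2) * mills x - x\<close>, so this is the monotonicity of
  \<open>x * mills x\<close> in disguise.\<close>

lemma mills_lower: "x \<le> (1 + x\<^sup>2) * mills x"
proof -
  let ?d = std_normal_density
  have pos: "1 + y\<^sup>2 > 0" for y :: real by (simp add: add_pos_nonneg)
  have "0 \<le> (1 - Phi x) - x / (1 + x\<^sup>2) * ?d x"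
  proof (rule nonneg_of_decreasing_to_0[where a = x and f = "\<lambda>x. (1 - Phi x) - x / (1 + x\<^sup>2) * ?d x" and f' = "\<lambda>y. (0 - ?d y) - ((1 - y\<^sup>2) / (1 + y\<^sup>2)\<^sup>2 * ?d y + (- y * ?d y) * (y / (1 + y\<^sup>2)))"])
    fix y assume "x \<le> y"
    have "((\<lambda>x. x / (1 + x\<^sup>2)) has_real_derivative (1 - y\<^sup>2) / (1 + y\<^sup>2)\<^sup>2) (at y)"
      using pos[of y] by (auto intro!: derivative_eq_intros simp: field_simps power2_eq_square)
    from DERIV_diff[OF DERIV_diff[OF DERIV_const Phi_has_derivative]
        DERIV_mult[OF this std_normal_density_has_derivative], of 1]
    show "((\<lambda>x. (1 - Phi x) - x / (1 + x\<^sup>2) * ?d x) has_real_derivative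
        (0 - ?d y) - ((1 - y\<^sup>2) / (1 + y\<^sup>2)\<^sup>2 * ?d y + (- y * ?d y) * (y / (1 + y\<^sup>2)))) (at y)" .
    have "(0 - ?d y) - ((1 - y\<^sup>2) / (1 + y\<^sup>2)\<^sup>2 * ?d y + (- y * ?d y) * (y / (1 + y\<^sup>2)))
        = - ?d y * (2 / (1 + y\<^sup>2)\<^sup>2)"
      using pos[of y] by (simp add: divide_simps) (simp add: algebra_simps power2_eq_square)
    then show "(0 - ?d y) - ((1 - y\<^sup>2) / (1 + y\<^sup>2)\<^sup>2 * ?d y + (- y * ?d y) * (y / (1 + y\<^sup>2))) \<le> 0"
      by (simp add: mult_nonneg_nonneg)
  next
    have "((\<lambda>x. x / (1 + x\<^sup>2) * ?d x) \<longlongrightarrow> 0) at_top"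
      unfolding std_normal_density_def by real_asymp
    from tendsto_diff[OF one_minus_Phi_tendsto_0 this]
    show "((\<lambda>x. (1 - Phi x) - x / (1 + x\<^sup>2) * ?d x) \<longlongrightarrow> 0) at_top" by simp
  qed
  moreover have "?d x > 0" by (simp add: std_normal_density_def)
  ultimately show ?thesis using pos[of x] by (simp add: mills_def field_simps)
qed

text \<open>Unlike \<open>mills_lower\<close>, this bound does not degenerate at 0; it gives the
  linear growth of \<open>1 / stein_const t\<close>.\<close>

lemma mills_ge: "0 \<le> x \<Longrightarrow> 1 / (1 + x) \<le> mills x"
proof -
  let ?d = std_normal_density
  assume x: "0 \<le> x"
  have "0 \<le> (1 - Phi x) - 1 / (1 + x) * ?d x"
  proof (rule nonneg_of_decreasing_to_0[where a = x and f = "\<lambda>x. (1 - Phi x) - 1 / (1 + x) * ?d x" and f' = "\<lambda>y. (0 - ?d y) - (- 1 / (1 + y)\<^sup>2 * ?d y + (- y * ?d y) * (1 / (1 + y)))"])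
    fix y assume "x \<le> y"
    then have y: "0 \<le> y" using x by simp
    have "((\<lambda>x. 1 / (1 + x)) has_real_derivative - 1 / (1 + y)\<^sup>2) (at y)"
      using y by (auto intro!: derivative_eq_intros simp: field_simps power2_eq_square)
    from DERIV_diff[OF DERIV_diff[OF DERIV_const Phi_has_derivative]
        DERIV_mult[OF this std_normal_density_has_derivative], of 1]
    show "((\<lambda>x. (1 - Phi x) - 1 / (1 + x) * ?d x) has_real_derivative
        (0 - ?d y) - (- 1 / (1 + y)\<^sup>2 * ?d y + (- y * ?d y) * (1 / (1 + y)))) (at y)" .
    have "(0 - ?d y) - (- 1 / (1 + y)\<^sup>2 * ?d y + (- y * ?d y) * (1 / (1 + y)))
        = - ?d y * (y / (1 + y)\<^sup>2)"
      using y by (simp add: divide_simps) (simp add: algebra_simps power2_eq_square)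
    then show "(0 - ?d y) - (- 1 / (1 + y)\<^sup>2 * ?d y + (- y * ?d y) * (1 / (1 + y))) \<le> 0"
      using y by (simp add: mult_nonneg_nonneg)
  next
    have "((\<lambda>x. 1 / (1 + x) * ?d x) \<longlongrightarrow> 0) at_top"
      unfolding std_normal_density_def by real_asymp
    from tendsto_diff[OF one_minus_Phi_tendsto_0 this]
    show "((\<lambda>x. (1 - Phi x) - 1 / (1 + x) * ?d x) \<longlongrightarrow> 0) at_top" by simp
  qed
  moreover have "?d x > 0" by (simp add: std_normal_density_def)
  ultimately show ?thesis using x by (simp add: mills_def field_simps)
qed

lemma mills_antimono: "x \<le> y \<Longrightarrow> mills y \<le> mills x"
  by (rule DERIV_nonpos_imp_nonincreasing)
     (use mills_has_derivative mills_mult_le_1 in \<open>fastforce simp: field_simps\<close>)+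

lemma mult_mills_mono: "x \<le> y \<Longrightarrow> x * mills x \<le> y * mills y"
proof (rule DERIV_nonneg_imp_nondecreasing[of x y "\<lambda>x. x * mills x"])
  fix z
  have "((\<lambda>x. x * mills x) has_real_derivative ((1 + z\<^sup>2) * mills z - z)) (at z)"
    by (auto intro!: derivative_eq_intros simp: algebra_simps power2_eq_square)
  then show "\<exists>y. ((\<lambda>x. x * mills x) has_real_derivative y) (at z) \<and> 0 \<le> y"
    using mills_lower[of z] by auto
qed

text \<open>Symmetry by differentiation: \<open>Phi x + Phi (- x)\<close> has derivative 0, and its
  constant value is read off at infinity.\<close>

lemma Phi_0: "Phi 0 = 1 / 2"
proof -
  have "((\<lambda>x. Phi x + Phi (- x)) has_real_derivative 0) (at x)" for x
  proof -
    have "((\<lambda>x. Phi (- x)) has_real_derivative - std_normal_density (- x)) (at x)"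
      using DERIV_chain'[OF DERIV_minus[OF DERIV_ident] Phi_has_derivative] by simp
    then have "((\<lambda>x. Phi x + Phi (- x)) has_real_derivative
        std_normal_density x + - std_normal_density (- x)) (at x)"
      by (intro DERIV_add Phi_has_derivative)
    then show ?thesis by (simp add: std_normal_density_def)
  qed
  then have const: "Phi x + Phi (- x) = Phi 0 + Phi (- 0)" for x
    using DERIV_isconst_all[of "\<lambda>x. Phi x + Phi (- x)" x 0] by auto
  interpret N: prob_space "density lborel std_normal_density"
    by (rule prob_space_normal_density) simp
  interpret N: real_distribution "density lborel std_normal_density"
    by unfold_locales auto
  have "(Phi \<longlongrightarrow> 0) at_bot"
    using N.cdf_lim_at_bot by (simp add: Phi_def[abs_def] cdf_def[abs_def])
  then have "((\<lambda>x. Phi (- x)) \<longlongrightarrow> 0) at_top"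
    by (rule filterlim_compose) (rule filterlim_uminus_at_bot_at_top)
  from tendsto_add[OF Phi_tendsto_1 this]
  have "((\<lambda>x::real. Phi 0 + Phi (- 0)) \<longlongrightarrow> 1 + 0) at_top" by (simp add: const)
  then have "Phi 0 + Phi (-0) = 1 + 0" by (simp add: tendsto_const_iff)
  then show ?thesis by simp
qed

lemma mills_0: "mills 0 = sqrt (2 * pi) / 2"
  by (simp add: mills_def Phi_0 std_normal_density_def)

lemma one_minus_Phi_eq: "1 - Phi t = mills t / sqrt (2 * pi) * exp (- t\<^sup>2 / 2)"
  by (simp add: mills_def std_normal_density_def)


text \<open>The constant \<kappa>. Since \<open>1 - Phi t\<close> is
  \<open>stein_const t * exp (- t\<^sup>2 / 2)\<close> and the Gaussian mean of e^(tw) is e^(t^2/2),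
  the Gaussian means of the weighted indicator and of \<kappa> e^(tw) are both \<kappa>
  e^(t^2/2).\<close>

definition stein_const :: "real \<Rightarrow> real" where
  "stein_const t = mills t / sqrt (2 * pi)"

text \<open>The bounded solution \<open>F\<close> of \<open>F'(w) - w F(w) = e\<^bsup>t\<^sup>2\<^esup> 1\<^bsub>w>t\<^esub> - \<kappa> e\<^bsup>tw\<^esup>\<close>, where \<open>\<kappa>\<close> makes the
  right-hand side centred under the standard normal law. Its derivative is \<open>stein_g\<close> (at \<open>w = t\<close>
  the left derivative), and \<open>stein_G1 - stein_G2\<close> splits that into two nondecreasing parts.\<close>

definition stein_F :: "real \<Rightarrow> real \<Rightarrow> real" where
  "stein_F t w = (if w \<le> t then - stein_const t * mills (t - w) * exp (t * w)
     else - exp (t\<^sup>2) * mills w + stein_const t * mills (w - t) * exp (t * w))"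

definition stein_g :: "real \<Rightarrow> real \<Rightarrow> real" where
  "stein_g t w = w * stein_F t w + exp (t\<^sup>2) * (if w > t then 1 else 0) - stein_const t * exp (t * w)"

definition stein_G1 :: "real \<Rightarrow> real \<Rightarrow> real" where
  "stein_G1 t w = (if w \<le> t then 0
     else exp (t\<^sup>2) * (1 - t * mills t) + stein_const t * exp (t * w) * ((w - t) * mills (w - t) + 2 * (t * mills 0)))"

definition stein_G2 :: "real \<Rightarrow> real \<Rightarrow> real" where
  "stein_G2 t w = (if w \<le> t
     then stein_const t * exp (t * w) * ((1 - (t - w) * mills (t - w)) + t * mills (t - w))
     else stein_const t * exp (t * w) * (1 + t * mills 0) + exp (t\<^sup>2) * (w * mills w - t * mills t)
        + stein_const t * exp (t * w) * (t * (mills 0 - mills (w - t))))"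

lemma stein_const_nonneg: "0 \<le> stein_const t"
  by (simp add: stein_const_def mills_nonneg)

text \<open>Exactly the condition that the two branches of \<open>stein_F\<close> agree at
  \<open>w = t\<close>. It also converts the growing term \<open>t * mills 0\<close> into
  \<open>t * mills t\<close>, which is at most 1.\<close>

lemma stein_const_mult: "2 * (stein_const t * mills 0) = mills t"
  by (simp add: stein_const_def mills_0)

lemma stein_g_eq: "stein_g t w = stein_G1 t w - stein_G2 t w"
proof (cases "w \<le> t")
  case True
  then show ?thesis by (simp add: stein_g_def stein_F_def stein_G1_def stein_G2_def algebra_simps)
next
  case False
  then show ?thesis by (simp add: stein_g_def stein_F_def stein_G1_def stein_G2_def algebra_simps)
qed

section \<open>Monotonicity of the two parts of the Stein derivative and their exponential
  envelope\<close>

lemma exp_mono_mult: "0 \<le> t \<Longrightarrow> v \<le> w \<Longrightarrow> exp (t * v) \<le> exp (t * w :: real)"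
  by (simp add: mult_left_mono)

lemma stein_G1_nonneg: "0 \<le> t \<Longrightarrow> 0 \<le> stein_G1 t w"
  using mills_mult_le_1[of t] mult_mills_mono[of 0 "w - t"] mills_nonneg stein_const_nonneg
  by (auto simp: stein_G1_def intro!: add_nonneg_nonneg mult_nonneg_nonneg)

lemma stein_G1_mono:
  assumes t: "0 \<le> t" and vw: "v \<le> w"
  shows "stein_G1 t v \<le> stein_G1 t w"
proof (cases "v \<le> t")
  case True
  then show ?thesis using stein_G1_nonneg[OF t, of w] by (simp add: stein_G1_def)
next
  case False
  then have v: "t < v" and w: "t < w" using vw by auto
  have "(v - t) * mills (v - t) \<le> (w - t) * mills (w - t)"
    using vw by (intro mult_mills_mono) simp
  moreover have "0 \<le> (v - t) * mills (v - t)" using v mills_nonneg by simp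
  ultimately have "stein_const t * exp (t * v) * ((v - t) * mills (v - t) + 2 * (t * mills 0))
      \<le> stein_const t * exp (t * w) * ((w - t) * mills (w - t) + 2 * (t * mills 0))"
    using t vw v by (intro mult_mono mult_left_mono exp_mono_mult add_nonneg_nonneg mult_nonneg_nonneg)
        (auto simp: stein_const_nonneg mills_nonneg)
  then show ?thesis using v w by (simp add: stein_G1_def)
qed

lemma stein_G2_mono_left:
  assumes t: "0 \<le> t" and vw: "v \<le> w" and wt: "w \<le> t"
  shows "stein_G2 t v \<le> stein_G2 t w"
proof -
  have "(t - w) * mills (t - w) \<le> (t - v) * mills (t - v)"
    using vw by (intro mult_mills_mono) simp
  moreover have "t * mills (t - v) \<le> t * mills (t - w)"
    using t vw by (intro mult_left_mono mills_antimono) auto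
  moreover have "(t - v) * mills (t - v) \<le> 1" by (rule mills_mult_le_1)
  moreover have "0 \<le> t * mills (t - v)" using t mills_nonneg by simp
  ultimately have "stein_const t * exp (t * v) * ((1 - (t - v) * mills (t - v)) + t * mills (t - v))
     \<le> stein_const t * exp (t * w) * ((1 - (t - w) * mills (t - w)) + t * mills (t - w))"
    using t vw by (intro mult_mono mult_left_mono exp_mono_mult)
        (auto simp: stein_const_nonneg)
  then show ?thesis using vw wt by (simp add: stein_G2_def)
qed

lemma stein_G2_mono_right:
  assumes t: "0 \<le> t" and vw: "v \<le> w" and tv: "t < v"
  shows "stein_G2 t v \<le> stein_G2 t w" 
proof -
  have "stein_const t * exp (t * v) * (1 + t * mills 0) \<le> stein_const t * exp (t * w) * (1 + t * mills 0)"
    using t vw by (intro mult_right_mono mult_left_mono exp_mono_mult)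
        (auto simp: stein_const_nonneg mills_nonneg)
  moreover have "exp (t\<^sup>2) * (v * mills v - t * mills t) \<le> exp (t\<^sup>2) * (w * mills w - t * mills t)"
    using mult_mills_mono[OF vw] by simp
  moreover have "stein_const t * exp (t * v) * (t * (mills 0 - mills (v - t)))
      \<le> stein_const t * exp (t * w) * (t * (mills 0 - mills (w - t)))"
    using t vw tv mills_antimono[of 0 "v - t"] mills_antimono[of "v - t" "w - t"]
    by (intro mult_mono mult_left_mono exp_mono_mult mult_nonneg_nonneg)
        (auto simp: stein_const_nonneg mills_nonneg)
  moreover have G2: "stein_G2 t x = stein_const t * exp (t * x) * (1 + t * mills 0)
      + exp (t\<^sup>2) * (x * mills x - t * mills t)
      + stein_const t * exp (t * x) * (t * (mills 0 - mills (x - t)))" if "t < x" for x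
    using that by (simp add: stein_G2_def)
  ultimately show ?thesis
    unfolding G2[OF tv] G2[OF less_le_trans[OF tv vw]] by (intro add_mono)
qed

lemma stein_G2_mono:
  assumes t: "0 \<le> t" and vw: "v \<le> w"
  shows "stein_G2 t v \<le> stein_G2 t w"
proof (cases "w \<le> t \<or> t < v")
  case True
  then show ?thesis using stein_G2_mono_left[OF t vw] stein_G2_mono_right[OF t vw] by auto
next
  case False
  then have v: "v \<le> t" and w: "t < w" by auto
  have "stein_G2 t v \<le> stein_G2 t t" by (rule stein_G2_mono_left[OF t v]) simp
  \<comment> \<open>The left branch ends at the value from which the right branch starts. The
    decreasing factor \<open>t * mills (w - t)\<close> in \<open>stein_g\<close> is split with this
    in view: \<open>stein_G1\<close> receives \<open>2 * (t * mills 0)\<close>, and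
    \<open>stein_G2\<close> takes it back as \<open>t * mills 0\<close> plus
    \<open>t * (mills 0 - mills (w - t))\<close>.\<close>
  also have "\<dots> = stein_const t * exp (t * t) * (1 + t * mills 0)" by (simp add: stein_G2_def)
  also have "\<dots> \<le> stein_const t * exp (t * w) * (1 + t * mills 0)"
    using t w by (intro mult_right_mono mult_left_mono exp_mono_mult)
        (auto simp: stein_const_nonneg mills_nonneg)
  also have "\<dots> \<le> stein_G2 t w"
    using w t mult_mills_mono[of t w] mills_antimono[of 0 "w - t"] stein_const_nonneg
    by (simp add: stein_G2_def)
  finally show ?thesis .
qed

lemma stein_G2_nonneg: "0 \<le> t \<Longrightarrow> 0 \<le> stein_G2 t w"
proof -
  assume t: "0 \<le> t"
  have "0 \<le> stein_G2 t (min w t)"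
    using t mills_mult_le_1[of "t - min w t"] mills_nonneg stein_const_nonneg
    by (auto simp: stein_G2_def intro!: add_nonneg_nonneg mult_nonneg_nonneg)
  also have "\<dots> \<le> stein_G2 t w" by (rule stein_G2_mono[OF t]) simp
  finally show ?thesis .
qed

definition stein_H :: "real \<Rightarrow> real \<Rightarrow> real" where
  "stein_H t w = stein_G1 t w + stein_G2 t w"

lemma stein_H_mono: "0 \<le> t \<Longrightarrow> v \<le> w \<Longrightarrow> stein_H t v \<le> stein_H t w"
  unfolding stein_H_def by (intro add_mono stein_G1_mono stein_G2_mono)

lemma stein_g_diff:
  assumes "0 \<le> t" "v \<le> w"
  shows "\<bar>stein_g t v - stein_g t w\<bar> \<le> stein_H t w - stein_H t v"
  using stein_G1_mono[OF assms] stein_G2_mono[OF assms]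
  by (simp add: stein_H_def stein_g_eq abs_le_iff)

lemma stein_g_le_H: "0 \<le> t \<Longrightarrow> \<bar>stein_g t w\<bar> \<le> stein_H t w"
  using stein_G1_nonneg[of t w] stein_G2_nonneg[of t w]
  by (simp add: stein_H_def stein_g_eq abs_le_iff)

lemma stein_const_le: "0 \<le> t \<Longrightarrow> stein_const t \<le> 1 / 2"
proof -
  assume "0 \<le> t"
  then have "2 * (stein_const t * mills 0) \<le> mills 0"
    unfolding stein_const_mult by (rule mills_antimono)
  moreover have "0 < mills 0" by (simp add: mills_0)
  ultimately show ?thesis by simp
qed

text \<open>Terms growing with \<open>t\<close> occur as \<open>t * mills 0\<close> with the factor
  \<open>stein_const t\<close>, and \<open>stein_const_mult\<close> makes them multiples of
  \<open>t * mills t\<close>. For \<open>w > t\<close> one has e^(t^2) <= e^(tw), the products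
  \<open>t * mills t\<close> cancel, and what is left is \<open>2 + 2 * stein_const t\<close>, at
  most 3.\<close>

lemma stein_H_le:
  assumes t: "0 \<le> t"
  shows "stein_H t w \<le> 3 * exp (t * w)"
proof (cases "w \<le> t")
  case True
  let ?k = "stein_const t"
  have k: "0 \<le> ?k" "?k \<le> 1 / 2" using stein_const_nonneg stein_const_le[OF t] by auto
  have "(1 - (t - w) * mills (t - w)) + t * mills (t - w) \<le> 1 + t * mills 0"
    using True t mills_antimono[of 0 "t - w"] mills_nonneg[of "t - w"]
    by (intro add_mono mult_left_mono) auto
  then have "stein_H t w \<le> ?k * exp (t * w) * (1 + t * mills 0)"
    using True k by (simp add: stein_H_def stein_G1_def stein_G2_def mult_left_mono)
  also have "\<dots> = exp (t * w) * (?k + t * mills t / 2)"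
    using stein_const_mult[of t] by (simp add: algebra_simps)
  also have "\<dots> \<le> exp (t * w) * 3"
    using mills_mult_le_1[of t] k by (intro mult_left_mono) auto
  finally show ?thesis by simp
next
  case False
  let ?k = "stein_const t" and ?e = "exp (t * w)"
  have k: "0 \<le> ?k" "?k \<le> 1 / 2" using stein_const_nonneg stein_const_le[OF t] by auto
  have e: "exp (t\<^sup>2) \<le> ?e" using False t by (simp add: power2_eq_square mult_left_mono)
  have e2: "?k * ?e * (t * (mills 0 - mills (w - t))) \<le> ?k * ?e * (t * mills 0)"
    using k t mills_nonneg[of "w - t"] by (intro mult_left_mono) auto
  have e1: "?k * ?e * ((w - t) * mills (w - t) + 2 * (t * mills 0)) \<le> ?k * ?e * (1 + 2 * (t * mills 0))"
    using k mills_mult_le_1[of "w - t"] by (intro mult_left_mono) auto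
  have e3: "exp (t\<^sup>2) * (1 - t * mills t) \<le> ?e * (1 - t * mills t)"
    using e mills_mult_le_1[of t] by (intro mult_right_mono) auto
  have "exp (t\<^sup>2) * (w * mills w - t * mills t) \<le> exp (t\<^sup>2) * (1 - t * mills t)"
    using mills_mult_le_1[of w] by (intro mult_left_mono) auto
  with e1 e2 e3 have "stein_H t w \<le> ?e * (1 - t * mills t) + ?k * ?e * (1 + 2 * (t * mills 0))
      + (?k * ?e * (1 + t * mills 0) + ?e * (1 - t * mills t) + ?k * ?e * (t * mills 0))"
    using False unfolding stein_H_def stein_G1_def stein_G2_def by (simp only: if_False)
  also have "\<dots> = ?e * (2 * (1 - t * mills t) + 2 * ?k + 2 * (t * (2 * (?k * mills 0))))"
    by (simp add: algebra_simps)
  also have "\<dots> = ?e * (2 + 2 * ?k)"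
    unfolding stein_const_mult by (simp add: algebra_simps)
  also have "\<dots> \<le> ?e * 3" using k by (intro mult_left_mono) auto
  finally show ?thesis by simp
qed

section \<open>Increments of the Stein solution across its kink\<close>

lemma DERIV_mills_compose:
  assumes "(f has_real_derivative D) (at w)"
  shows "((\<lambda>w. mills (f w)) has_real_derivative (f w * mills (f w) - 1) * D) (at w)"
  using DERIV_chain2[OF mills_has_derivative assms] .

lemma stein_F_left_deriv:
  "((\<lambda>w. - stein_const t * mills (t - w) * exp (t * w)) has_real_derivative
     w * (- stein_const t * mills (t - w) * exp (t * w)) - stein_const t * exp (t * w)) (at w)"
proof -
  have "((\<lambda>w. mills (t - w)) has_real_derivative ((t - w) * mills (t - w) - 1) * (- 1)) (at w)"
    by (rule DERIV_mills_compose) (auto intro!: derivative_eq_intros)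
  then show ?thesis
    by (auto intro!: derivative_eq_intros simp: algebra_simps)
qed

lemma stein_F_right_deriv:
  "((\<lambda>w. - exp (t\<^sup>2) * mills w + stein_const t * mills (w - t) * exp (t * w)) has_real_derivative
     w * (- exp (t\<^sup>2) * mills w + stein_const t * mills (w - t) * exp (t * w)) + exp (t\<^sup>2)
       - stein_const t * exp (t * w)) (at w)"
proof -
  have "((\<lambda>w. mills (w - t)) has_real_derivative ((w - t) * mills (w - t) - 1) * 1) (at w)"
    by (rule DERIV_mills_compose) (auto intro!: derivative_eq_intros)
  then show ?thesis
    by (auto intro!: derivative_eq_intros simp: algebra_simps)
qed

lemma stein_F_mvt_left:
  assumes "v < w" "w \<le> t"
  shows "\<exists>z. v < z \<and> z < w \<and> stein_F t w - stein_F t v = (w - v) * stein_g t z"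
proof -
  from MVT2[OF assms(1) stein_F_left_deriv[of t]] obtain z where z: "v < z" "z < w"
    "- stein_const t * mills (t - w) * exp (t * w) - - stein_const t * mills (t - v) * exp (t * v) =
      (w - v) * (z * (- stein_const t * mills (t - z) * exp (t * z)) - stein_const t * exp (t * z))"
    by blast
  with assms show ?thesis by (intro exI[of _ z]) (simp add: stein_F_def stein_g_def)
qed

lemma stein_F_mvt_right:
  assumes "v < w" "t \<le> v"
  shows "\<exists>z. v < z \<and> z < w \<and> stein_F t w - stein_F t v = (w - v) * stein_g t z"
proof -
  let ?R = "\<lambda>w. - exp (t\<^sup>2) * mills w + stein_const t * mills (w - t) * exp (t * w)"
  have R: "stein_F t w = ?R w" if "t \<le> w" for w
  proof (cases "w = t")
    case True
    have "exp (t\<^sup>2) * mills t = 2 * (stein_const t * mills 0 * exp (t * t))"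
      using stein_const_mult[of t] by (simp add: power2_eq_square algebra_simps)
    with True show ?thesis by (simp add: stein_F_def)
  qed (use that in \<open>simp add: stein_F_def\<close>)
  from MVT2[OF assms(1) stein_F_right_deriv[of t]] obtain z where z: "v < z" "z < w"
    "?R w - ?R v = (w - v) * (z * ?R z + exp (t\<^sup>2) - stein_const t * exp (t * z))"
    by blast
  with assms R[of v] R[of w] R[of z] show ?thesis by (intro exI[of _ z]) (simp add: stein_g_def)
qed

text \<open>The mean value theorem applies on each side of \<open>t\<close>, so an interval
  containing \<open>t\<close> is cut there and the pieces are added. On each piece the slope is
  \<open>stein_g\<close> at an interior point, which differs from \<open>stein_g t u\<close> by at
  most the growth of \<open>stein_H\<close> over the whole interval.\<close>

lemma stein_F_increment:
  assumes t: "0 \<le> t" and vw: "v \<le> w" and u: "u = v \<or> u = w"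
  shows "\<bar>stein_F t w - stein_F t v - (w - v) * stein_g t u\<bar> \<le> (w - v) * (stein_H t w - stein_H t v)"
proof -
  have g: "\<bar>stein_g t z - stein_g t u\<bar> \<le> stein_H t w - stein_H t v" if "v \<le> z" "z \<le> w" for z
    using u stein_g_diff[OF t that(1)] stein_g_diff[OF t that(2)]
      stein_H_mono[OF t that(1)] stein_H_mono[OF t that(2)] by auto
  have piece: "\<bar>stein_F t b - stein_F t a - (b - a) * stein_g t u\<bar> \<le> (b - a) * (stein_H t w - stein_H t v)"
    if ab: "v \<le> a" "a \<le> b" "b \<le> w" and side: "b \<le> t \<or> t \<le> a" for a b
  proof (cases "a = b")
    case False
    then have "a < b" using ab by simp
    with side stein_F_mvt_left[of a b t] stein_F_mvt_right[of a b t] obtain z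
      where z: "a < z" "z < b" "stein_F t b - stein_F t a = (b - a) * stein_g t z" by blast
    have "\<bar>stein_F t b - stein_F t a - (b - a) * stein_g t u\<bar> = (b - a) * \<bar>stein_g t z - stein_g t u\<bar>"
      unfolding z(3) using ab by (simp add: right_diff_distrib[symmetric] abs_mult)
    also have "\<dots> \<le> (b - a) * (stein_H t w - stein_H t v)"
      using g[of z] z ab by (intro mult_left_mono) auto
    finally show ?thesis .
  qed simp
  show ?thesis
  proof (cases "v \<le> t \<and> t \<le> w")
    case True
    have "\<bar>stein_F t w - stein_F t v - (w - v) * stein_g t u\<bar>
      = \<bar>(stein_F t w - stein_F t t - (w - t) * stein_g t u) + (stein_F t t - stein_F t v - (t - v) * stein_g t u)\<bar>"
      by (simp add: algebra_simps)
    also have "\<dots> \<le> (w - t) * (stein_H t w - stein_H t v) + (t - v) * (stein_H t w - stein_H t v)"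
      using piece[of v t] piece[of t w] True by (intro order.trans[OF abs_triangle_ineq] add_mono) auto
    finally show ?thesis by (simp add: algebra_simps)
  next
    case False
    then show ?thesis using piece[of v w] vw by auto
  qed
qed

lemma
  assumes t: "0 \<le> t"
  shows stein_const_pos: "0 < stein_const t"
    and inverse_stein_const_le: "1 / stein_const t \<le> 2.6 * (1 + t)"
proof -
  have s2pi: "sqrt (2 * pi) \<le> 2.6"
  proof (rule real_le_lsqrt)
    have "pi < 3.2" using pi_approx by simp
    then show "2 * pi \<le> 2.6\<^sup>2" by (simp add: power2_eq_square)
  qed simp_all
  have m: "1 / (1 + t) \<le> mills t" by (rule mills_ge[OF t])
  moreover have "0 < 1 / (1 + t)" using t by simp
  ultimately have "0 < mills t" by linarith
  then show "0 < stein_const t" by (simp add: stein_const_def)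
  have "1 / stein_const t = sqrt (2 * pi) / mills t" by (simp add: stein_const_def)
  also have "\<dots> \<le> 2.6 / (1 / (1 + t))" using s2pi m t by (intro frac_le) auto
  finally show "1 / stein_const t \<le> 2.6 * (1 + t)" by simp
qed

lemma one_minus_Phi_stein_const: "1 - Phi t = stein_const t * exp (- t\<^sup>2 / 2)"
  by (simp add: one_minus_Phi_eq stein_const_def)

lemma
  assumes t: "0 \<le> t"
  shows one_minus_Phi_pos: "0 < 1 - Phi t"
    and inverse_tail_le: "1 / (1 - Phi t) \<le> 2.6 * (1 + t) * exp (t\<^sup>2 / 2)"
proof -
  show "0 < 1 - Phi t" unfolding one_minus_Phi_stein_const using stein_const_pos[OF t] by simp
  have "1 / (1 - Phi t) = 1 / stein_const t * exp (t\<^sup>2 / 2)"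
    unfolding one_minus_Phi_stein_const by (simp add: exp_minus field_simps)
  also have "\<dots> \<le> 2.6 * (1 + t) * exp (t\<^sup>2 / 2)"
    using inverse_stein_const_le[OF t] by (intro mult_right_mono) auto
  finally show "1 / (1 - Phi t) \<le> 2.6 * (1 + t) * exp (t\<^sup>2 / 2)" .
qed

section \<open>Random subsets and a discrete Stein identity\<close>

lemma sum_Sigma_pair:
  assumes "finite A" "\<And>x. x \<in> A \<Longrightarrow> finite (B x)"
  shows "(\<Sum>a\<in>Sigma A B. f a) = (\<Sum>x\<in>A. \<Sum>y\<in>B x. f (x, y))"
  using assms by (simp add: sum.Sigma case_prod_unfold)

section \<open>Inclusion indicators and their telescoping\<close>

definition incl :: "'e set \<Rightarrow> 'e set \<Rightarrow> real" where
  "incl A S = of_bool (A \<subseteq> S)"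

lemma incl_nonneg [simp]: "0 \<le> incl A S"
  by (simp add: incl_def)

lemma incl_empty [simp]: "incl {} S = 1"
  by (simp add: incl_def)

lemma incl_Un: "incl (A \<union> B) S = incl A S * incl B S"
  by (simp add: incl_def)

lemma incl_insert_ignore [simp]: "k \<notin> A \<Longrightarrow> incl A (insert k S) = incl A S"
  by (auto simp: incl_def)

lemma incl_diff_ignore [simp]: "k \<notin> A \<Longrightarrow> incl A (S - {k}) = incl A S"
  by (auto simp: incl_def)

lemma incl_sing_insert [simp]: "incl {k} (insert k S) = 1" "incl {k} (S - {k}) = 0"
  by (simp_all add: incl_def)

lemma incl_insert_mem: "k \<in> A \<Longrightarrow> incl A (insert k S) = incl (A - {k}) S"
  by (auto simp: incl_def)

lemma incl_diff_mem [simp]: "k \<in> A \<Longrightarrow> incl A (S - {k}) = 0"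
  by (auto simp: incl_def)

lemma incl_telescope:
  assumes "finite i"
  shows "\<exists>B. (\<forall>k\<in>i. B k \<subseteq> i - {k}) \<and>
    (\<forall>S. incl i S - p ^ card i = (\<Sum>k\<in>i. (incl {k} S - p) * p ^ (card i - 1 - card (B k)) * incl (B k) S))"
  using assms
proof (induction i)
  case empty
  then show ?case by simp
next
  case (insert l i)
  then obtain B where B: "\<And>k. k \<in> i \<Longrightarrow> B k \<subseteq> i - {k}"
    "\<And>S. incl i S - p ^ card i = (\<Sum>k\<in>i. (incl {k} S - p) * p ^ (card i - 1 - card (B k)) * incl (B k) S)"
    by blast
  \<comment> \<open>The new element comes last: its summand is \<open>incl {l} S - p\<close> times
    \<open>incl i S\<close>, while every old summand gains a factor \<open>p\<close>.\<close>
  define B' where "B' = B(l := i)"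
  have "incl (insert l i) S - p ^ card (insert l i)
    = (\<Sum>k\<in>insert l i. (incl {k} S - p) * p ^ (card (insert l i) - 1 - card (B' k)) * incl (B' k) S)" for S
  proof -
    have "card (insert l i) - 1 - card (B k) = Suc (card i - 1 - card (B k))" if "k \<in> i" for k
    proof -
      have "card (B k) \<le> card (i - {k})" using B(1)[OF that] insert.hyps by (intro card_mono) auto
      moreover have "0 < card i" using that insert.hyps by (auto simp: card_gt_0_iff)
      ultimately show ?thesis using that insert.hyps by simp
    qed
    then have "(\<Sum>k\<in>i. (incl {k} S - p) * p ^ (card (insert l i) - 1 - card (B k)) * incl (B k) S)
      = p * (incl i S - p ^ card i)"
      unfolding B(2) sum_distrib_left by (intro sum.cong) (auto simp: mult_ac)
    moreover have "(\<Sum>k\<in>i. (incl {k} S - p) * p ^ (card (insert l i) - 1 - card (B' k)) * incl (B' k) S)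
      = (\<Sum>k\<in>i. (incl {k} S - p) * p ^ (card (insert l i) - 1 - card (B k)) * incl (B k) S)"
      using insert.hyps by (intro sum.cong) (auto simp: B'_def)
    moreover have "incl (insert l i) S = incl {l} S * incl i S" by (simp add: incl_def)
    ultimately show ?thesis using insert.hyps by (simp add: B'_def algebra_simps)
  qed
  moreover have "B' k \<subseteq> insert l i - {k}" if "k \<in> insert l i" for k
    using B(1)[of k] that insert.hyps by (auto simp: B'_def)
  ultimately show ?case by blast
qed

section \<open>Expectation over a binomial random subset\<close>

locale bernoulli_subset =
  fixes E :: "'e set" and p q :: real
  assumes finite_E: "finite E" and p_pos: "0 < p" and q_pos: "0 < q" and p_plus_q: "p + q = 1"
begin

lemma p_le_1: "p \<le> 1" and q_le_1: "q \<le> 1"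
  using p_pos q_pos p_plus_q by auto

lemma p_power_antimono: "m \<le> n \<Longrightarrow> p ^ n \<le> p ^ m"
  using p_pos p_le_1 by (intro power_decreasing) auto

definition expect :: "('e set \<Rightarrow> real) \<Rightarrow> real" where
  "expect f = (\<Sum>S\<in>Pow E. p ^ card S * q ^ card (E - S) * f S)"

lemma expect_mono: "(\<And>S. S \<subseteq> E \<Longrightarrow> f S \<le> g S) \<Longrightarrow> expect f \<le> expect g"
  unfolding expect_def using p_pos q_pos by (intro sum_mono mult_left_mono) auto

lemma expect_cong: "(\<And>S. S \<subseteq> E \<Longrightarrow> f S = g S) \<Longrightarrow> expect f = expect g"
  unfolding expect_def by (intro sum.cong) auto

lemma expect_nonneg: "(\<And>S. S \<subseteq> E \<Longrightarrow> 0 \<le> f S) \<Longrightarrow> 0 \<le> expect f"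
  unfolding expect_def using p_pos q_pos by (intro sum_nonneg mult_nonneg_nonneg) auto

lemma expect_pos: 
  assumes "\<And>S. S \<subseteq> E \<Longrightarrow> 0 < f S"
  shows "0 < expect f"
  unfolding expect_def using p_pos q_pos assms finite_E by (intro sum_pos) auto

lemma expect_add: "expect (\<lambda>S. f S + g S) = expect f + expect g"
  by (simp add: expect_def sum.distrib algebra_simps)

lemma expect_diff: "expect (\<lambda>S. f S - g S) = expect f - expect g"
  by (simp add: expect_def sum_subtractf algebra_simps)

lemma expect_cmult: "expect (\<lambda>S. a * f S) = a * expect f"
  unfolding expect_def sum_distrib_left by (intro sum.cong) auto

lemma expect_cmult_right: "expect (\<lambda>S. f S * a) = expect f * a"
  unfolding expect_def sum_distrib_right by (intro sum.cong) auto

lemma expect_sum: "expect (\<lambda>S. \<Sum>a\<in>A. f a S) = (\<Sum>a\<in>A. expect (f a))"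
  unfolding expect_def by (subst sum.swap) (simp add: sum_distrib_left)

lemma abs_expect_le: "\<bar>expect f\<bar> \<le> expect (\<lambda>S. \<bar>f S\<bar>)"
  unfolding expect_def using p_pos q_pos
  by (intro order.trans[OF sum_abs] sum_mono) (simp add: abs_mult)

text \<open>Drawing the membership of \<open>k\<close> afresh leaves the law unchanged. The new
  integrand no longer depends on whether \<open>k\<close> is in \<open>S\<close>.\<close>

lemma expect_split:
  assumes k: "k \<in> E"
  shows "expect f = expect (\<lambda>S. p * f (insert k S) + q * f (S - {k}))"
proof -
  let ?E = "E - {k}"
  let ?w = "\<lambda>S. p ^ card S * q ^ card (?E - S)"
  have fin: "finite ?E" using finite_E by simp
  have *: "expect g = (\<Sum>S\<in>Pow ?E. ?w S * (p * g (insert k S) + q * g S))" for g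
  proof -
    have "Pow E = Pow ?E \<union> insert k ` Pow ?E"
      using k Pow_insert[of k ?E] by (simp add: insert_absorb)
    then have "expect g = (\<Sum>S\<in>Pow ?E. p ^ card S * q ^ card (E - S) * g S)
        + (\<Sum>S\<in>insert k ` Pow ?E. p ^ card S * q ^ card (E - S) * g S)"
      unfolding expect_def using fin by (simp only:) (intro sum.union_disjoint, auto)
    also have "(\<Sum>S\<in>insert k ` Pow ?E. p ^ card S * q ^ card (E - S) * g S)
      = (\<Sum>S\<in>Pow ?E. p ^ card (insert k S) * q ^ card (E - insert k S) * g (insert k S))"
      by (subst sum.reindex) (auto simp: inj_on_def)
    also have "\<dots> = (\<Sum>S\<in>Pow ?E. ?w S * p * g (insert k S))"
    proof (intro sum.cong refl)
      fix S assume S: "S \<in> Pow ?E"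
      then have "finite S" "k \<notin> S" using fin finite_subset by auto
      moreover have "E - insert k S = ?E - S" by auto
      ultimately show "p ^ card (insert k S) * q ^ card (E - insert k S) * g (insert k S)
        = ?w S * p * g (insert k S)" by simp
    qed
    also have "(\<Sum>S\<in>Pow ?E. p ^ card S * q ^ card (E - S) * g S) = (\<Sum>S\<in>Pow ?E. ?w S * q * g S)"
    proof (intro sum.cong refl)
      fix S assume S: "S \<in> Pow ?E"
      then have "E - S = insert k (?E - S)" using k by auto
      then show "p ^ card S * q ^ card (E - S) * g S = ?w S * q * g S"
        using fin by simp
    qed
    finally show ?thesis by (simp add: sum.distrib algebra_simps)
  qed
  have "expect (\<lambda>S. p * f (insert k S) + q * f (S - {k}))
     = (\<Sum>S\<in>Pow ?E. ?w S * ((p + q) * (p * f (insert k S) + q * f S)))"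
  proof (unfold *, intro sum.cong refl)
    fix S assume "S \<in> Pow ?E"
    then have "S - {k} = S" by auto
    then show "?w S * (p * (p * f (insert k (insert k S)) + q * f (insert k S - {k})) + q * (p * f (insert k S) + q * f (S - {k})))
      = ?w S * ((p + q) * (p * f (insert k S) + q * f S))"
      by (simp add: algebra_simps)
  qed
  then show ?thesis unfolding * p_plus_q by simp
qed

lemma expect_const [simp]: "expect (\<lambda>_. c) = c"
proof -
  have "(\<Sum>S\<in>Pow E. p ^ card S * q ^ card (E - S)) = (\<Prod>x\<in>E. p + q)"
    by (subst prod_add[OF finite_E]) simp
  then show ?thesis
    by (simp add: expect_def p_plus_q flip: sum_distrib_right)
qed

text \<open>By independence, conditioning on \<open>A \<subseteq> S\<close> turns \<open>S\<close>
  into \<open>A \<union> S\<close> and leaves the rest alone.\<close>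

lemma expect_incl_mult:
  assumes "A \<subseteq> E"
  shows "expect (\<lambda>S. incl A S * f S) = p ^ card A * expect (\<lambda>S. f (A \<union> S))"
proof -
  have "finite A" using assms finite_E finite_subset by blast
  then show ?thesis using assms
  proof (induction A arbitrary: f)
    case (insert k A)
    have "expect (\<lambda>S. incl (insert k A) S * f S) = expect (\<lambda>S. p * (incl A S * f (insert k S)))"
      using insert by (subst expect_split[of k]) (auto simp: incl_insert_mem)
    also have "\<dots> = p * (p ^ card A * expect (\<lambda>S. f (insert k (A \<union> S))))"
      using insert by (simp add: expect_cmult)
    finally show ?case using insert.hyps by simp
  qed simp
qed

lemma expect_incl: "A \<subseteq> E \<Longrightarrow> expect (incl A) = p ^ card A"
  using expect_incl_mult[of A "\<lambda>_. 1"] by simp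

text \<open>The common shape of \<open>W\<close> and of the two error variables \<open>U\<close> and
  \<open>V\<close>, so that one integration by parts serves all three. The index type is left open
  because the three sums run over increasingly nested tuples.\<close>

definition zform :: "'i set \<Rightarrow> ('i \<Rightarrow> real) \<Rightarrow> ('i \<Rightarrow> 'e) \<Rightarrow> ('i \<Rightarrow> 'e set) \<Rightarrow> bool" where
  "zform A c kk B \<longleftrightarrow> finite A \<and> (\<forall>a\<in>A. 0 \<le> c a \<and> kk a \<in> E \<and> B a \<subseteq> E - {kk a})"

definition zf :: "'i set \<Rightarrow> ('i \<Rightarrow> real) \<Rightarrow> ('i \<Rightarrow> 'e) \<Rightarrow> ('i \<Rightarrow> 'e set) \<Rightarrow> 'e set \<Rightarrow> real" where
  "zf A c kk B S = (\<Sum>a\<in>A. c a * ((incl {kk a} S - p) * incl (B a) S))"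

text \<open>Given everything except \<open>kk a\<close>, the centred indicator is \<open>q\<close>
  with probability \<open>p\<close> and \<open>- p\<close> with probability \<open>q\<close>, while
  \<open>B a\<close> avoids \<open>kk a\<close>; the average is \<open>p * q\<close> times an
  increment of \<open>f\<close>.\<close>

lemma zf_ibp:
  assumes "zform A c kk B"
  shows "expect (\<lambda>S. zf A c kk B S * f S)
    = p * q * (\<Sum>a\<in>A. c a * expect (\<lambda>S. incl (B a) S * (f (insert (kk a) S) - f (S - {kk a}))))"
proof -
  have "expect (\<lambda>S. c a * ((incl {kk a} S - p) * incl (B a) S) * f S)
     = p * q * (c a * expect (\<lambda>S. incl (B a) S * (f (insert (kk a) S) - f (S - {kk a}))))" if "a \<in> A" for a
  proof -
    have a: "kk a \<in> E" "kk a \<notin> B a" using assms that by (auto simp: zform_def)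
    have "expect (\<lambda>S. (incl {kk a} S - p) * incl (B a) S * f S)
      = expect (\<lambda>S. p * q * (incl (B a) S * (f (insert (kk a) S) - f (S - {kk a}))))"
    proof (subst expect_split[OF a(1)], rule expect_cong)
      fix S
      have q: "1 - p = q" using p_plus_q by simp
      show "p * ((incl {kk a} (insert (kk a) S) - p) * incl (B a) (insert (kk a) S) * f (insert (kk a) S)) +
         q * ((incl {kk a} (S - {kk a}) - p) * incl (B a) (S - {kk a}) * f (S - {kk a})) =
         p * q * (incl (B a) S * (f (insert (kk a) S) - f (S - {kk a})))"
        using a(2) by (simp add: q right_diff_distrib)
    qed
    then show ?thesis by (simp add: expect_cmult mult.assoc)
  qed
  then show ?thesis
    by (simp add: zf_def sum_distrib_right sum_distrib_left expect_sum)
qed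

text \<open>Read \<open>pre i k\<close> as the part of \<open>i\<close> preceding \<open>k\<close> in some enumeration: \<open>E\<close> carries no order, so the
  sets are chosen from the existence statement.\<close>

definition pre :: "'e set \<Rightarrow> 'e \<Rightarrow> 'e set" where
  "pre i = (SOME B. (\<forall>k\<in>i. B k \<subseteq> i - {k}) \<and>
    (\<forall>S. incl i S - p ^ card i = (\<Sum>k\<in>i. (incl {k} S - p) * p ^ (card i - 1 - card (B k)) * incl (B k) S)))"

lemma
  assumes "finite i"
  shows pre_subset: "k \<in> i \<Longrightarrow> pre i k \<subseteq> i - {k}"
    and incl_pre: "incl i S - p ^ card i = (\<Sum>k\<in>i. (incl {k} S - p) * p ^ (card i - 1 - card (pre i k)) * incl (pre i k) S)"
  using someI_ex[OF incl_telescope[OF assms, of p], folded pre_def] by blast+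

end

text \<open>Of the graph structure only a family of edge sets of equal size remains here, with a
  bound on how many of them meet a given one; the finer overlap estimates enter with
  \<open>chained\<close>.\<close>

locale subset_count = bernoulli_subset E p q for E :: "'e set" and p q :: real +
  fixes M :: "'e set set" and e :: nat and \<sigma> :: real and D :: nat
  assumes M_subset: "i \<in> M \<Longrightarrow> i \<subseteq> E"
    and card_M: "i \<in> M \<Longrightarrow> card i = e"
    and e_pos: "0 < e"
    and \<sigma>_pos: "0 < \<sigma>"
    and variance: "expect (\<lambda>S. ((\<Sum>i\<in>M. incl i S) - card M * p ^ e)\<^sup>2) = \<sigma>\<^sup>2"
    and card_touching: "i \<in> M \<Longrightarrow> card {j \<in> M. j \<inter> i \<noteq> {}} \<le> D"
begin

lemma finite_M [simp]: "finite M"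
  using finite_E M_subset by (meson PowI finite_Pow_iff finite_subset subsetI)

lemma finite_mem_M [simp]: "i \<in> M \<Longrightarrow> finite i"
  using M_subset finite_E finite_subset by blast

section \<open>The normalised count, its increments and the Stein identity\<close>

definition W :: "'e set \<Rightarrow> real" where
  "W S = ((\<Sum>i\<in>M. incl i S) - card M * p ^ e) / \<sigma>"

definition AW :: "('e set \<times> 'e) set" where "AW = (SIGMA i:M. i)"
definition cW :: "'e set \<times> 'e \<Rightarrow> real" where
  "cW a = p ^ (e - 1 - card (pre (fst a) (snd a))) / \<sigma>"
definition BW :: "'e set \<times> 'e \<Rightarrow> 'e set" where "BW a = pre (fst a) (snd a)"

lemma W_eq_zf: "W = zf AW cW snd BW"
proof
  fix S
  have "zf AW cW snd BW S = (\<Sum>i\<in>M. \<Sum>k\<in>i. (incl {k} S - p) * p ^ (card i - 1 - card (pre i k)) * incl (pre i k) S / \<sigma>)"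
    unfolding zf_def AW_def by (subst sum_Sigma_pair) (auto simp: cW_def BW_def card_M intro!: sum.cong)
  also have "\<dots> = (\<Sum>i\<in>M. (incl i S - p ^ card i) / \<sigma>)"
    by (simp add: incl_pre sum_divide_distrib)
  also have "\<dots> = W S"
    by (simp add: W_def card_M sum_subtractf sum_divide_distrib[symmetric])
  finally show "W S = zf AW cW snd BW S" ..
qed

lemma BW_AW: "a \<in> AW \<Longrightarrow> BW a \<subseteq> fst a - {snd a} \<and> fst a \<in> M \<and> snd a \<in> fst a"
  using pre_subset[of "fst a" "snd a"] by (auto simp: AW_def BW_def)

lemma finite_AW: "finite AW"
  unfolding AW_def by (intro finite_SigmaI) auto

lemma zform_W: "zform AW cW snd BW"
  unfolding zform_def
proof (intro conjI ballI)
  fix a assume "a \<in> AW"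
  from BW_AW[OF this] M_subset[of "fst a"] show "snd a \<in> E" "BW a \<subseteq> E - {snd a}" by auto
  show "0 \<le> cW a" using p_pos \<sigma>_pos by (simp add: cW_def)
qed (rule finite_AW)

definition \<Delta> :: "'e \<Rightarrow> 'e set \<Rightarrow> real" where
  "\<Delta> k S = (\<Sum>j\<in>{j \<in> M. k \<in> j}. incl (j - {k}) S) / \<sigma>"

lemma \<Delta>_eq: "W (insert k S) - W (S - {k}) = \<Delta> k S"
proof -
  have "(\<Sum>i\<in>M. incl i (insert k S)) - (\<Sum>i\<in>M. incl i (S - {k})) = (\<Sum>i\<in>M. if k \<in> i then incl (i - {k}) S else 0)"
    unfolding sum_subtractf[symmetric] by (intro sum.cong) (auto simp: incl_insert_mem)
  also have "\<dots> = (\<Sum>i\<in>{j \<in> M. k \<in> j}. incl (i - {k}) S)"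
    by (simp add: sum.If_cases Collect_conj_eq Int_commute)
  finally show ?thesis by (simp add: W_def \<Delta>_def diff_divide_distrib[symmetric])
qed

lemma \<Delta>_nonneg: "0 \<le> \<Delta> k S"
  unfolding \<Delta>_def using \<sigma>_pos by (intro divide_nonneg_pos sum_nonneg) auto

lemma \<Delta>_invariant [simp]: "\<Delta> k (insert k S) = \<Delta> k S" "\<Delta> k (S - {k}) = \<Delta> k S"
  by (simp_all add: \<Delta>_def)

text \<open>All members containing \<open>k\<close> meet any one of them, so there are at most
  \<open>D\<close>.\<close>

lemma \<Delta>_le: "\<Delta> k S \<le> D / \<sigma>"
proof (cases "\<exists>i\<in>M. k \<in> i")
  case True
  then obtain i where i: "i \<in> M" "k \<in> i" by blast
  have "(\<Sum>j\<in>{j \<in> M. k \<in> j}. incl (j - {k}) S) \<le> (\<Sum>j\<in>{j \<in> M. k \<in> j}. 1)"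
    by (intro sum_mono) (simp add: incl_def)
  also have "\<dots> = card {j \<in> M. k \<in> j}" by simp
  also have "\<dots> \<le> card {j \<in> M. j \<inter> i \<noteq> {}}"
    using i by (intro of_nat_mono card_mono) auto
  also have "\<dots> \<le> D" using card_touching[OF i(1)] by simp
  finally show ?thesis using \<sigma>_pos by (simp add: \<Delta>_def divide_right_mono)
next
  case False
  then have "\<Delta> k S = 0" unfolding \<Delta>_def by (subst sum.neutral) auto
  then show ?thesis using \<sigma>_pos by simp
qed

text \<open>An index is a summand of \<open>W\<close>, centred at \<open>k\<close>, together with a
  member \<open>j\<close> containing \<open>k\<close>. Summing over \<open>j\<close> restores
  \<open>\<Delta> k\<close>: the form \<open>U\<close> is \<open>W\<close> with every summand
  multiplied by the increment of \<open>W\<close> at its own \<open>k\<close>.\<close>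

definition AU :: "(('e set \<times> 'e) \<times> 'e set) set" where
  "AU = (SIGMA a:AW. {j \<in> M. snd a \<in> j})"
definition cU :: "('e set \<times> 'e) \<times> 'e set \<Rightarrow> real" where "cU a = cW (fst a) / \<sigma>"
definition kU :: "('e set \<times> 'e) \<times> 'e set \<Rightarrow> 'e" where "kU a = snd (fst a)"
definition BU :: "('e set \<times> 'e) \<times> 'e set \<Rightarrow> 'e set" where
  "BU a = BW (fst a) \<union> (snd a - {snd (fst a)})"

text \<open>\<open>T\<close> plays the role of a Stein kernel (it has mean \<open>1\<close>), and \<open>U\<close> measures the error made by
  linearising the increments of \<open>F\<close>.\<close>

definition U :: "'e set \<Rightarrow> real" where "U = zf AU cU kU BU"

definition T :: "'e set \<Rightarrow> real" where "T S = p * q * (\<Sum>a\<in>AU. cU a * incl (BU a) S)"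

lemma finite_AU: "finite AU"
  unfolding AU_def using finite_AW by (intro finite_SigmaI) auto

lemma zform_U: "zform AU cU kU BU"
  unfolding zform_def
proof (intro conjI ballI)
  fix a assume a: "a \<in> AU"
  then have a1: "fst a \<in> AW" "snd a \<in> M" by (auto simp: AU_def)
  show "0 \<le> cU a" using p_pos \<sigma>_pos by (simp add: cU_def cW_def)
  show "kU a \<in> E" using BW_AW[OF a1(1)] M_subset by (auto simp: kU_def)
  show "BU a \<subseteq> E - {kU a}" using BW_AW[OF a1(1)] M_subset a1 by (fastforce simp: kU_def BU_def)
qed (rule finite_AU)

lemma sum_AU: "(\<Sum>a\<in>AU. cU a * (f (fst a) * incl (BU a) S))
    = (\<Sum>a\<in>AW. cW a * (f a * (incl (BW a) S * \<Delta> (snd a) S)))"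
proof -
  have "(\<Sum>a\<in>AU. cU a * (f (fst a) * incl (BU a) S))
    = (\<Sum>a\<in>AW. \<Sum>j\<in>{j \<in> M. snd a \<in> j}. cW a / \<sigma> * (f a * (incl (BW a) S * incl (j - {snd a}) S)))"
    unfolding AU_def using finite_AW by (subst sum_Sigma_pair) (simp_all add: cU_def BU_def incl_Un)
  also have "\<dots> = (\<Sum>a\<in>AW. cW a * (f a * (incl (BW a) S * \<Delta> (snd a) S)))"
    unfolding \<Delta>_def sum_divide_distrib sum_distrib_left by (intro sum.cong refl) simp
  finally show ?thesis .
qed

lemma U_mult_ibp:
  "expect (\<lambda>S. U S * f S) = p * q * (\<Sum>a\<in>AW. cW a *
     expect (\<lambda>S. incl (BW a) S * \<Delta> (snd a) S * (f (insert (snd a) S) - f (S - {snd a}))))"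
proof -
  have "expect (\<lambda>S. U S * f S) = p * q * (\<Sum>a\<in>AU. cU a * expect (\<lambda>S. incl (BU a) S * (f (insert (snd (fst a)) S) - f (S - {snd (fst a)}))))"
    unfolding U_def zf_ibp[OF zform_U] kU_def ..
  also have "\<dots> = p * q * expect (\<lambda>S. \<Sum>a\<in>AU. cU a * ((f (insert (snd (fst a)) S) - f (S - {snd (fst a)})) * incl (BU a) S))"
    unfolding expect_sum expect_cmult by (simp only: mult.commute[of "incl _ _"])
  also have "\<dots> = p * q * expect (\<lambda>S. \<Sum>a\<in>AW. cW a * ((f (insert (snd a) S) - f (S - {snd a})) * (incl (BW a) S * \<Delta> (snd a) S)))"
    by (simp only: sum_AU[of "\<lambda>a. f (insert (snd a) S) - f (S - {snd a})" S for S])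
  finally show ?thesis unfolding expect_sum expect_cmult by (simp only: mult.commute[of "f _ - f _"])
qed

lemma T_eq: "T S = p * q * (\<Sum>a\<in>AW. cW a * (incl (BW a) S * \<Delta> (snd a) S))"
  using sum_AU[of "\<lambda>_. 1" S] by (simp add: T_def)

text \<open>Given the rest of the set, \<open>W S\<close> is the upper end of its increment with
  probability \<open>p\<close> and the lower end with probability \<open>q\<close>; this is why
  \<open>u\<close> may be either end. As the coefficients, indicators and \<open>\<Delta>\<close>
  are nonnegative, the pointwise error bound survives summation. It is \<open>\<Delta>\<close> times
  an increment of \<open>H\<close>, so \<open>U_mult_ibp\<close> read backwards identifies the
  total.\<close>

lemma stein_identity:
  fixes F g H :: "real \<Rightarrow> real"
  assumes FgH: "\<And>v w u. v \<le> w \<Longrightarrow> u = v \<or> u = w \<Longrightarrow>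
     \<bar>F w - F v - (w - v) * g u\<bar> \<le> (w - v) * (H w - H v)"
  shows "\<bar>expect (\<lambda>S. W S * F (W S)) - expect (\<lambda>S. T S * g (W S))\<bar> \<le> expect (\<lambda>S. U S * H (W S))"
proof -
  let ?P = "\<lambda>a S. incl (BW a) S"
  let ?w1 = "\<lambda>a S. W (insert (snd a) S)" and ?w0 = "\<lambda>a S. W (S - {snd a})"
  let ?err = "\<lambda>a S. (F (?w1 a S) - F (?w0 a S)) - \<Delta> (snd a) S * (p * g (?w1 a S) + q * g (?w0 a S))"
  let ?bnd = "\<lambda>a S. ?P a S * \<Delta> (snd a) S * (H (?w1 a S) - H (?w0 a S))"
  have 1: "expect (\<lambda>S. W S * F (W S)) = p * q * (\<Sum>a\<in>AW. cW a * expect (\<lambda>S. ?P a S * (F (?w1 a S) - F (?w0 a S))))"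
    by (subst W_eq_zf, subst zf_ibp[OF zform_W]) (simp add: W_eq_zf)
  have "expect (\<lambda>S. ?P a S * \<Delta> (snd a) S * g (W S))
     = expect (\<lambda>S. ?P a S * (\<Delta> (snd a) S * (p * g (?w1 a S) + q * g (?w0 a S))))" if "a \<in> AW" for a
  proof -
    have "snd a \<in> E" "snd a \<notin> BW a" using BW_AW[OF that] M_subset by auto
    then show ?thesis by (subst expect_split[of "snd a"]) (auto simp: algebra_simps intro!: expect_cong)
  qed
  then have 2: "expect (\<lambda>S. T S * g (W S)) = p * q * (\<Sum>a\<in>AW. cW a *
      expect (\<lambda>S. ?P a S * (\<Delta> (snd a) S * (p * g (?w1 a S) + q * g (?w0 a S)))))"
    by (simp add: T_eq mult.assoc expect_cmult sum_distrib_right expect_sum cong: sum.cong)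
  have point: "\<bar>(F w1 - F w0) - (w1 - w0) * (p * g w1 + q * g w0)\<bar> \<le> (w1 - w0) * (H w1 - H w0)"
    if "w0 \<le> w1" for w0 w1
  proof -
    have "(F w1 - F w0) = p * (F w1 - F w0) + q * (F w1 - F w0)"
      using p_plus_q by (simp flip: distrib_right)
    then have "\<bar>(F w1 - F w0) - (w1 - w0) * (p * g w1 + q * g w0)\<bar>
       = \<bar>p * (F w1 - F w0 - (w1 - w0) * g w1) + q * (F w1 - F w0 - (w1 - w0) * g w0)\<bar>"
      by (simp add: algebra_simps)
    also have "\<dots> \<le> p * \<bar>F w1 - F w0 - (w1 - w0) * g w1\<bar> + q * \<bar>F w1 - F w0 - (w1 - w0) * g w0\<bar>"
      using p_pos q_pos by (intro order.trans[OF abs_triangle_ineq]) (simp add: abs_mult)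
    also have "\<dots> \<le> p * ((w1 - w0) * (H w1 - H w0)) + q * ((w1 - w0) * (H w1 - H w0))"
      using FgH[OF that] p_pos q_pos by (intro add_mono mult_left_mono) auto
    also have "\<dots> = (w1 - w0) * (H w1 - H w0)"
      using p_plus_q by (simp flip: distrib_right)
    finally show ?thesis .
  qed
  have c: "0 \<le> cW a" for a using p_pos \<sigma>_pos by (simp add: cW_def)
  have "\<bar>expect (\<lambda>S. W S * F (W S)) - expect (\<lambda>S. T S * g (W S))\<bar>
    = p * q * \<bar>\<Sum>a\<in>AW. cW a * expect (\<lambda>S. ?P a S * ?err a S)\<bar>"
    unfolding 1 2 using p_pos q_pos
    by (simp add: right_diff_distrib[symmetric] sum_subtractf[symmetric] expect_diff[symmetric] abs_mult)
  also have "\<dots> \<le> p * q * (\<Sum>a\<in>AW. cW a * expect (\<lambda>S. ?bnd a S))"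
  proof (intro mult_left_mono order.trans[OF sum_abs] sum_mono)
    fix a
    have "\<bar>cW a * expect (\<lambda>S. ?P a S * ?err a S)\<bar>
      \<le> cW a * expect (\<lambda>S. \<bar>?P a S * ?err a S\<bar>)"
      unfolding abs_mult[of "cW a"] abs_of_nonneg[OF c] by (intro mult_left_mono abs_expect_le c)
    also have "\<dots> \<le> cW a * expect (\<lambda>S. ?bnd a S)"
    proof (intro mult_left_mono expect_mono c)
      fix S
      have "?w0 a S \<le> ?w1 a S" using \<Delta>_eq[of "snd a" S] \<Delta>_nonneg[of "snd a" S] by linarith
      from point[OF this] show "\<bar>?P a S * ?err a S\<bar>
        \<le> ?bnd a S"
        unfolding \<Delta>_eq by (simp add: abs_mult mult.assoc mult_left_mono)
    qed
    finally show "\<bar>cW a * expect (\<lambda>S. ?P a S * ?err a S)\<bar>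
      \<le> cW a * expect (\<lambda>S. ?bnd a S)" .
  qed (use p_pos q_pos in simp)
  also have "\<dots> = expect (\<lambda>S. U S * H (W S))" by (simp add: U_mult_ibp)
  finally show ?thesis .
qed

text \<open>For the identity as \<open>F\<close> the linearisation is exact, so \<open>H = 0\<close>
  is allowed and the inequality becomes an equality with the normalised variance.\<close>

lemma expect_T: "expect T = 1"
proof -
  have "\<bar>expect (\<lambda>S. W S * W S) - expect (\<lambda>S. T S * 1)\<bar> \<le> expect (\<lambda>S. U S * 0)"
    using stein_identity[of "\<lambda>x. x" "\<lambda>_. 1" "\<lambda>_. 0"] by simp
  moreover have "expect (\<lambda>S. W S * W S) = expect (\<lambda>S. ((\<Sum>i\<in>M. incl i S) - card M * p ^ e)\<^sup>2 * (1 / \<sigma>\<^sup>2))"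
    by (intro expect_cong) (simp add: W_def power2_eq_square)
  moreover have "\<dots> = 1" using \<sigma>_pos unfolding expect_cmult_right variance by simp
  ultimately show ?thesis by simp
qed

definition V :: "'e set \<Rightarrow> real" where "V S = T S - 1"

lemma stein_bound:
  fixes F g H G :: "real \<Rightarrow> real"
  assumes "\<And>v w u. v \<le> w \<Longrightarrow> u = v \<or> u = w \<Longrightarrow>
     \<bar>F w - F v - (w - v) * g u\<bar> \<le> (w - v) * (H w - H v)"
    and g: "\<And>w. \<bar>g w\<bar> \<le> G w" and H: "\<And>w. \<bar>H w\<bar> \<le> G w"
  shows "\<bar>expect (\<lambda>S. W S * F (W S)) - expect (\<lambda>S. g (W S))\<bar> \<le> expect (\<lambda>S. \<bar>V S\<bar> * G (W S)) + expect (\<lambda>S. \<bar>U S\<bar> * G (W S))"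
proof -
  have "expect (\<lambda>S. T S * g (W S)) - expect (\<lambda>S. g (W S)) = expect (\<lambda>S. V S * g (W S))"
    by (simp add: V_def expect_diff[symmetric] algebra_simps)
  moreover have "\<bar>expect (\<lambda>S. V S * g (W S))\<bar> \<le> expect (\<lambda>S. \<bar>V S\<bar> * G (W S))"
    by (rule order.trans[OF abs_expect_le expect_mono]) (simp add: abs_mult g mult_left_mono)
  moreover have "expect (\<lambda>S. U S * H (W S)) \<le> expect (\<lambda>S. \<bar>U S\<bar> * G (W S))"
  proof (rule expect_mono)
    fix S
    have "U S * H (W S) \<le> \<bar>U S\<bar> * \<bar>H (W S)\<bar>" by (metis abs_ge_self abs_mult)
    also have "\<dots> \<le> \<bar>U S\<bar> * G (W S)" by (intro mult_left_mono H) simp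
    finally show "U S * H (W S) \<le> \<bar>U S\<bar> * G (W S)" .
  qed
  moreover have "\<bar>expect (\<lambda>S. W S * F (W S)) - expect (\<lambda>S. T S * g (W S))\<bar> \<le> expect (\<lambda>S. U S * H (W S))"
  proof (rule stein_identity)
    fix v w u :: real assume "v \<le> w" "u = v \<or> u = w"
    then show "\<bar>F w - F v - (w - v) * g u\<bar> \<le> (w - v) * (H w - H v)" by (rule assms(1))
  qed
  ultimately show ?thesis
    using abs_triangle_ineq[of "expect (\<lambda>S. W S * F (W S)) - expect (\<lambda>S. T S * g (W S))"
        "expect (\<lambda>S. T S * g (W S)) - expect (\<lambda>S. g (W S))"] by simp
qed

end

section \<open>Second moments under exponential tilting\<close>

lemma card_Un4_le: "card (A \<union> B \<union> C \<union> D) \<le> card A + card B + card C + card D"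
  using card_Un_le[of "A \<union> B \<union> C" D] card_Un_le[of "A \<union> B" C] card_Un_le[of A B] by linarith

context subset_count
begin

section \<open>Moment generating function and the cost of forcing members to be present\<close>

definition h :: "real \<Rightarrow> real" where "h \<theta> = expect (\<lambda>S. exp (\<theta> * W S))"

lemma h_pos: "0 < h \<theta>"
  unfolding h_def by (rule expect_pos) simp

text \<open>A member that becomes included when \<open>A\<close> is added must meet
  \<open>A\<close>, hence one of the at most \<open>r\<close> members covering \<open>A\<close>;
  each of these meets at most \<open>D\<close> members.\<close>

lemma W_union_le:
  assumes "finite C" "C \<subseteq> M" "A \<subseteq> \<Union>C" "card C \<le> r"
  shows "W (A \<union> S) \<le> W S + r * (D / \<sigma>)"
proof -
  have "(\<Sum>i\<in>M. incl i (A \<union> S)) - (\<Sum>i\<in>M. incl i S) \<le> (\<Sum>i\<in>M. of_bool (i \<inter> A \<noteq> {}))"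
    unfolding sum_subtractf[symmetric] by (intro sum_mono) (auto simp: incl_def)
  also have "\<dots> = card {i \<in> M. i \<inter> A \<noteq> {}}"
    by (simp add: of_bool_def sum.If_cases Int_def)
  also have "{i \<in> M. i \<inter> A \<noteq> {}} \<subseteq> (\<Union>c\<in>C. {i \<in> M. i \<inter> c \<noteq> {}})" using assms by blast
  then have "card {i \<in> M. i \<inter> A \<noteq> {}} \<le> card (\<Union>c\<in>C. {i \<in> M. i \<inter> c \<noteq> {}})"
    using assms by (intro card_mono) auto
  also have "\<dots> \<le> (\<Sum>c\<in>C. card {i \<in> M. i \<inter> c \<noteq> {}})" using assms by (intro card_UN_le)
  also have "\<dots> \<le> (\<Sum>c\<in>C. D)" using assms card_touching by (intro sum_mono) auto
  also have "\<dots> \<le> r * D" using assms by simp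
  finally have "(\<Sum>i\<in>M. incl i (A \<union> S)) - (\<Sum>i\<in>M. incl i S) \<le> real (r * D)" by simp
  then have "((\<Sum>i\<in>M. incl i (A \<union> S)) - (\<Sum>i\<in>M. incl i S)) / \<sigma> \<le> real (r * D) / \<sigma>"
    using \<sigma>_pos by (intro divide_right_mono) auto
  then show ?thesis by (simp add: W_def diff_divide_distrib)
qed

text \<open>Forcing \<open>A\<close> to be present shifts \<open>W\<close> by a bounded amount, so
  the tilt costs only a constant factor. The exponential in \<open>D * t / \<sigma>\<close> of the
  final bound originates here.\<close>

lemma tilted_incl_le:
  fixes \<theta> :: real
  assumes "finite C" "C \<subseteq> M" "A \<subseteq> \<Union>C" "card C \<le> r" "0 \<le> \<theta>"
  shows "expect (\<lambda>S. incl A S * exp (\<theta> * W S)) \<le> p ^ card A * (exp (r * (\<theta> * D / \<sigma>)) * h \<theta>)"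
proof -
  have "A \<subseteq> E" using assms M_subset by blast
  then have "expect (\<lambda>S. incl A S * exp (\<theta> * W S)) = p ^ card A * expect (\<lambda>S. exp (\<theta> * W (A \<union> S)))"
    by (rule expect_incl_mult)
  also have "\<dots> \<le> p ^ card A * expect (\<lambda>S. exp (r * (\<theta> * D / \<sigma>)) * exp (\<theta> * W S))"
  proof (intro mult_left_mono expect_mono)
    fix S
    have "\<theta> * W (A \<union> S) \<le> \<theta> * (W S + r * (D / \<sigma>))"
      using assms by (intro mult_left_mono W_union_le[where C = C]) auto
    then show "exp (\<theta> * W (A \<union> S)) \<le> exp (r * (\<theta> * D / \<sigma>)) * exp (\<theta> * W S)"
      by (simp add: exp_add[symmetric] algebra_simps)
  qed (use p_pos in simp)
  finally show ?thesis by (simp add: expect_cmult h_def)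
qed

definition pairs :: "('e set \<times> 'e set) set" where
  "pairs = {(i, j). i \<in> M \<and> j \<in> M \<and> i \<inter> j \<noteq> {}}"

lemma finite_pairs [simp]: "finite pairs"
  by (rule finite_subset[of _ "M \<times> M"]) (auto simp: pairs_def)

definition un :: "'e set \<times> 'e set \<Rightarrow> 'e set" where "un x = fst x \<union> snd x"

definition C4 :: real where
  "C4 = (\<Sum>x\<in>pairs. \<Sum>y\<in>pairs. of_bool (un x \<inter> un y \<noteq> {}) * p ^ card (un x \<union> un y))"

text \<open>Two chains of three members each, \<open>x\<close> with \<open>j\<close> and
  \<open>y\<close> with \<open>l\<close>. Unlike in \<open>C4\<close>, the chains need not touch
  each other, since this sum arises from a square and not from a derivative of one form with respect
  to an element of the other.\<close>

definition C6 :: real where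
  "C6 = (\<Sum>x\<in>pairs. \<Sum>y\<in>pairs. \<Sum>j\<in>{j \<in> M. j \<inter> un x \<noteq> {}}. \<Sum>l\<in>{l \<in> M. l \<inter> un y \<noteq> {}}. p ^ card ((un x \<union> j) \<union> (un y \<union> l)))"

end

text \<open>Each summand of the form is attached to a pair of overlapping sets \<open>I a\<close>. The bound on \<open>c a\<close> says
  that the missing edges of the pair are paid for by powers of \<open>p\<close>, so that a product of summands has
  expectation at most that of all the attached sets being present.\<close>

locale dominated_form = subset_count E p q M e \<sigma> D
  for E :: "'e set" and p q :: real and M e \<sigma> D +
  fixes A :: "'i set" and c :: "'i \<Rightarrow> real" and kk :: "'i \<Rightarrow> 'e" and B :: "'i \<Rightarrow> 'e set"
    and I :: "'i \<Rightarrow> 'e set \<times> 'e set" and \<tau> :: real and m :: nat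
  assumes zform: "zform A c kk B"
    and I_touching: "a \<in> A \<Longrightarrow> I a \<in> pairs"
    and kk_mem: "a \<in> A \<Longrightarrow> kk a \<in> un (I a)"
    and B_subset: "a \<in> A \<Longrightarrow> B a \<subseteq> un (I a)"
    and c_le: "a \<in> A \<Longrightarrow> c a \<le> \<tau> * p ^ card (un (I a) - insert (kk a) (B a))"
    and \<tau>_nonneg: "0 \<le> \<tau>"
    and fibre: "x \<in> pairs \<Longrightarrow> card {a \<in> A. I a = x} \<le> m"
begin

section \<open>Second moments of a dominated form\<close>

abbreviation Z where "Z \<equiv> zf A c kk B"

definition dZ :: "'e \<Rightarrow> 'e set \<Rightarrow> real" where "dZ k S = Z (insert k S) - Z (S - {k})"

text \<open>Integrating \<open>Z * (Z * exp (\<theta> * W))\<close> by parts leaves an increment of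
  a product. \<open>energy\<close> collects the increments of \<open>Z\<close>, in absolute value,
  and \<open>Q\<close> below those of \<open>exp (\<theta> * W)\<close>, which are proportional to
  \<open>\<Delta>\<close>.\<close>

definition energy :: "'e set \<Rightarrow> real" where
  "energy S = p * q * (\<Sum>a\<in>A. c a * (incl (B a) S * \<bar>dZ (kk a) S\<bar>))"

definition Q :: "'e set \<Rightarrow> real" where
  "Q S = p * q * (\<Sum>a\<in>A. c a * (incl (B a) S * \<Delta> (kk a) S))"

lemma finite_A: "finite A" and c_nonneg: "a \<in> A \<Longrightarrow> 0 \<le> c a" and kk_E: "a \<in> A \<Longrightarrow> kk a \<in> E"
  and kk_notin: "a \<in> A \<Longrightarrow> kk a \<notin> B a"
  using zform by (auto simp: zform_def)

lemma finite_un: "a \<in> A \<Longrightarrow> finite (un (I a))"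
  using I_touching[of a] by (auto simp: pairs_def un_def)

lemma second_moment_step:
  fixes \<theta> :: real
  assumes \<theta>: "0 \<le> \<theta>"
  defines "L \<equiv> exp (\<theta> * D / \<sigma>)"
  shows "expect (\<lambda>S. (Z S)\<^sup>2 * exp (\<theta> * W S)) \<le> L * expect (\<lambda>S. energy S * exp (\<theta> * W S))
     + \<theta> * L * expect (\<lambda>S. \<bar>Z S\<bar> * Q S * exp (\<theta> * W S))"
proof -
  let ?e = "\<lambda>S. exp (\<theta> * W S)"
  have point: "Z (insert k S) * ?e (insert k S) - Z (S - {k}) * ?e (S - {k})
     \<le> L * (\<bar>dZ k S\<bar> * (p * ?e (insert k S) + q * ?e (S - {k})))
       + \<theta> * L * (\<Delta> k S * (p * (\<bar>Z (insert k S)\<bar> * ?e (insert k S)) + q * (\<bar>Z (S - {k})\<bar> * ?e (S - {k}))))" for k S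
  proof -
    define z1 z0 e1 e0 where defs: "z1 = Z (insert k S)" "z0 = Z (S - {k})" "e1 = ?e (insert k S)" "e0 = ?e (S - {k})"
    have W: "W (insert k S) = W (S - {k}) + \<Delta> k S" using \<Delta>_eq[of k S] by simp
    have e1: "e1 = exp (\<theta> * \<Delta> k S) * e0" unfolding defs W by (simp add: exp_add[symmetric] algebra_simps)
    have e0: "0 < e0" "0 < e1" by (simp_all add: defs)
    have x: "0 \<le> \<theta> * \<Delta> k S" "\<theta> * \<Delta> k S \<le> \<theta> * D / \<sigma>"
      using \<theta> \<Delta>_nonneg[of k S] mult_left_mono[OF \<Delta>_le[of k S] \<theta>] by auto
    have L: "e1 \<le> L * e0" "e0 \<le> e1" unfolding e1 L_def using x e0 by auto
    have "1 \<le> L" using x by (simp add: L_def)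
    then have "1 * e1 \<le> L * e1" using e0 by (intro mult_right_mono) auto
    then have L1: "e1 \<le> L * e1" by simp
    have "1 - exp (- (\<theta> * \<Delta> k S)) \<le> \<theta> * \<Delta> k S" using exp_ge_add_one_self[of "- (\<theta> * \<Delta> k S)"] by simp
    then have "(1 - exp (- (\<theta> * \<Delta> k S))) * e1 \<le> \<theta> * \<Delta> k S * e1" using e0 by (intro mult_right_mono) auto
    moreover have "exp (- (\<theta> * \<Delta> k S)) * e1 = e0" unfolding e1 by (simp add: exp_minus)
    ultimately have de: "e1 - e0 \<le> \<theta> * \<Delta> k S * e1" by (simp add: left_diff_distrib)
    have "z1 * e1 - z0 * e0 = (p + q) * (z1 * e1 - z0 * e0)" by (simp add: p_plus_q)
    \<comment> \<open>Product rule with weights chosen for what follows. In the first term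
      \<open>e1 \<le> L * e0\<close> and \<open>e0 \<le> L * e1\<close> swap the two exponentials;
      in the second \<open>p\<close> already stands at \<open>z1\<close>. Afterwards both terms are
      averages over the membership of \<open>k\<close> and can be folded back by
      \<open>expect_split\<close>.\<close>
    also have "\<dots> = (z1 - z0) * (q * e1 + p * e0) + (q * z0 + p * z1) * (e1 - e0)"
      by (simp add: algebra_simps)
    also have "\<dots> \<le> \<bar>z1 - z0\<bar> * (L * (p * e1 + q * e0)) + (q * \<bar>z0\<bar> + p * \<bar>z1\<bar>) * (\<theta> * \<Delta> k S * e1)"
    proof (rule add_mono)
      have "q * e1 + p * e0 \<le> q * (L * e0) + p * (L * e1)"
        using L L1 p_pos q_pos by (intro add_mono mult_left_mono) auto
      then have "q * e1 + p * e0 \<le> L * (p * e1 + q * e0)" by (simp add: algebra_simps)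
      then show "(z1 - z0) * (q * e1 + p * e0) \<le> \<bar>z1 - z0\<bar> * (L * (p * e1 + q * e0))"
        using e0 p_pos q_pos by (intro mult_mono) auto
      have "q * z0 + p * z1 \<le> q * \<bar>z0\<bar> + p * \<bar>z1\<bar>"
        using p_pos q_pos by (intro add_mono mult_left_mono) auto
      then show "(q * z0 + p * z1) * (e1 - e0) \<le> (q * \<bar>z0\<bar> + p * \<bar>z1\<bar>) * (\<theta> * \<Delta> k S * e1)"
        using de L p_pos q_pos by (intro mult_mono) auto
    qed
    also have "(q * \<bar>z0\<bar> + p * \<bar>z1\<bar>) * (\<theta> * \<Delta> k S * e1)
      = \<theta> * \<Delta> k S * (p * (\<bar>z1\<bar> * e1) + q * (\<bar>z0\<bar> * e1))" by (simp add: algebra_simps)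
    also have "\<dots> \<le> \<theta> * \<Delta> k S * (p * (\<bar>z1\<bar> * (L * e1)) + q * (\<bar>z0\<bar> * (L * e0)))"
      using x L L1 p_pos q_pos by (intro mult_left_mono add_mono) auto
    finally show ?thesis by (simp add: defs dZ_def algebra_simps)
  qed
  have "expect (\<lambda>S. (Z S)\<^sup>2 * ?e S) = expect (\<lambda>S. Z S * (Z S * ?e S))" by (simp add: power2_eq_square mult_ac)
  also have "\<dots> = p * q * (\<Sum>a\<in>A. c a * expect (\<lambda>S. incl (B a) S *
      (Z (insert (kk a) S) * ?e (insert (kk a) S) - Z (S - {kk a}) * ?e (S - {kk a}))))"
    by (rule zf_ibp[OF zform])
  also have "\<dots> \<le> p * q * (\<Sum>a\<in>A. c a * expect (\<lambda>S. L * (incl (B a) S * \<bar>dZ (kk a) S\<bar> * ?e S)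
      + \<theta> * L * (incl (B a) S * \<Delta> (kk a) S * \<bar>Z S\<bar> * ?e S)))"
  proof (intro mult_left_mono sum_mono c_nonneg)
    fix a assume a: "a \<in> A"
    have [simp]: "dZ k (insert k S) = dZ k S" "dZ k (S - {k}) = dZ k S" for k S
      by (simp_all add: dZ_def)
    have "expect (\<lambda>S. L * (incl (B a) S * \<bar>dZ (kk a) S\<bar> * ?e S) + \<theta> * L * (incl (B a) S * \<Delta> (kk a) S * \<bar>Z S\<bar> * ?e S))
      = expect (\<lambda>S. incl (B a) S * (L * (\<bar>dZ (kk a) S\<bar> * (p * ?e (insert (kk a) S) + q * ?e (S - {kk a})))
       + \<theta> * L * (\<Delta> (kk a) S * (p * (\<bar>Z (insert (kk a) S)\<bar> * ?e (insert (kk a) S)) + q * (\<bar>Z (S - {kk a})\<bar> * ?e (S - {kk a}))))))"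
      unfolding expect_split[OF kk_E[OF a], of "\<lambda>S. L * (incl (B a) S * \<bar>dZ (kk a) S\<bar> * ?e S) + \<theta> * L * (incl (B a) S * \<Delta> (kk a) S * \<bar>Z S\<bar> * ?e S)"]
      using kk_notin[OF a] by (intro expect_cong) (simp add: algebra_simps)
    then show "expect (\<lambda>S. incl (B a) S * (Z (insert (kk a) S) * ?e (insert (kk a) S) - Z (S - {kk a}) * ?e (S - {kk a})))
      \<le> expect (\<lambda>S. L * (incl (B a) S * \<bar>dZ (kk a) S\<bar> * ?e S) + \<theta> * L * (incl (B a) S * \<Delta> (kk a) S * \<bar>Z S\<bar> * ?e S))"
      using point by (auto intro!: expect_mono mult_left_mono)
  qed (use p_pos q_pos in auto)
  also have "\<dots> = expect (\<lambda>S. p * q * (\<Sum>a\<in>A. c a * (L * (incl (B a) S * \<bar>dZ (kk a) S\<bar> * ?e S)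
      + \<theta> * L * (incl (B a) S * \<Delta> (kk a) S * \<bar>Z S\<bar> * ?e S))))"
    by (simp only: expect_cmult expect_sum)
  also have "\<dots> = expect (\<lambda>S. L * (energy S * ?e S) + \<theta> * L * (\<bar>Z S\<bar> * Q S * ?e S))"
    by (rule expect_cong) (simp add: energy_def Q_def distrib_left sum.distrib sum_distrib_left sum_distrib_right mult_ac)
  finally show ?thesis by (simp only: expect_add expect_cmult)
qed

text \<open>\<open>2 |Z| b Q \<le> Z\<^sup>2 + (b Q)\<^sup>2\<close> lets the mixed term be absorbed into the left-hand side.\<close>

lemma second_moment_le:
  fixes \<theta> :: real
  assumes \<theta>: "0 \<le> \<theta>"
  defines "L \<equiv> exp (\<theta> * D / \<sigma>)"
  shows "expect (\<lambda>S. (Z S)\<^sup>2 * exp (\<theta> * W S)) \<le> 2 * L * expect (\<lambda>S. energy S * exp (\<theta> * W S))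
     + (\<theta> * L)\<^sup>2 * expect (\<lambda>S. (Q S)\<^sup>2 * exp (\<theta> * W S))"
proof -
  let ?e = "\<lambda>S. exp (\<theta> * W S)"
  have "\<theta> * L * expect (\<lambda>S. \<bar>Z S\<bar> * Q S * ?e S) = expect (\<lambda>S. (\<bar>Z S\<bar> * (\<theta> * L * Q S)) * ?e S)"
    unfolding expect_cmult[symmetric] by (simp add: mult_ac)
  also have "\<dots> \<le> expect (\<lambda>S. ((Z S)\<^sup>2 / 2 + (\<theta> * L * Q S)\<^sup>2 / 2) * ?e S)"
  proof (intro expect_mono mult_right_mono)
    fix S
    show "\<bar>Z S\<bar> * (\<theta> * L * Q S) \<le> (Z S)\<^sup>2 / 2 + (\<theta> * L * Q S)\<^sup>2 / 2"
      using sum_squares_bound[of "\<bar>Z S\<bar>" "\<theta> * L * Q S"] by simp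
  qed simp
  also have "\<dots> = expect (\<lambda>S. 1 / 2 * ((Z S)\<^sup>2 * ?e S) + (\<theta> * L)\<^sup>2 / 2 * ((Q S)\<^sup>2 * ?e S))"
    by (intro expect_cong) (simp add: algebra_simps power_mult_distrib)
  also have "\<dots> = 1 / 2 * expect (\<lambda>S. (Z S)\<^sup>2 * ?e S) + (\<theta> * L)\<^sup>2 / 2 * expect (\<lambda>S. (Q S)\<^sup>2 * ?e S)"
    unfolding expect_add expect_cmult ..
  finally show ?thesis using second_moment_step[OF \<theta>, folded L_def] by simp
qed

text \<open>A summand reacts to \<open>k\<close> either because it is centred at \<open>k\<close> or
  because \<open>k\<close> lies in \<open>B b\<close>; \<open>kk_notin\<close> excludes both at
  once. In the second case the centred factor is split by |\<xi> - p| <= \<xi> + p, so that only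
  inclusions remain.\<close>

lemma abs_dZ_le:
  "\<bar>dZ k S\<bar> \<le> (\<Sum>b\<in>A. of_bool (kk b = k) * (c b * incl (B b) S))
     + (\<Sum>b\<in>A. of_bool (k \<in> B b) * (c b * ((incl {kk b} S + p) * incl (B b - {k}) S)))"
proof -
  have "dZ k S = (\<Sum>b\<in>A. of_bool (kk b = k) * (c b * incl (B b) S)
      + of_bool (k \<in> B b) * (c b * ((incl {kk b} S - p) * incl (B b - {k}) S)))"
    unfolding dZ_def zf_def sum_subtractf[symmetric]
  proof (intro sum.cong refl)
    fix b assume b: "b \<in> A"
    show "c b * ((incl {kk b} (insert k S) - p) * incl (B b) (insert k S)) - c b * ((incl {kk b} (S - {k}) - p) * incl (B b) (S - {k}))
      = of_bool (kk b = k) * (c b * incl (B b) S) + of_bool (k \<in> B b) * (c b * ((incl {kk b} S - p) * incl (B b - {k}) S))"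
      using kk_notin[OF b] by (cases "kk b = k"; cases "k \<in> B b") (auto simp: incl_insert_mem algebra_simps)
  qed
  also have "\<bar>\<dots>\<bar> \<le> (\<Sum>b\<in>A. of_bool (kk b = k) * (c b * incl (B b) S)
      + of_bool (k \<in> B b) * (c b * ((incl {kk b} S + p) * incl (B b - {k}) S)))"
  proof (rule order.trans[OF sum_abs sum_mono])
    fix b assume b: "b \<in> A"
    have "\<bar>incl {kk b} S - p\<bar> \<le> incl {kk b} S + p" using p_pos incl_nonneg[of "{kk b}" S] by linarith
    then show "\<bar>of_bool (kk b = k) * (c b * incl (B b) S) + of_bool (k \<in> B b) * (c b * ((incl {kk b} S - p) * incl (B b - {k}) S))\<bar>
      \<le> of_bool (kk b = k) * (c b * incl (B b) S) + of_bool (k \<in> B b) * (c b * ((incl {kk b} S + p) * incl (B b - {k}) S))"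
      using c_nonneg[OF b]
      by (intro order.trans[OF abs_triangle_ineq add_mono]) (auto simp: abs_mult intro!: mult_mono)
  qed
  finally show ?thesis by (simp add: sum.distrib)
qed

lemma fibre_sum:
  assumes "\<And>x. x \<in> pairs \<Longrightarrow> 0 \<le> f x"
  shows "(\<Sum>a\<in>A. f (I a)) \<le> m * (\<Sum>x\<in>pairs. f x :: real)"
proof -
  have "(\<Sum>a\<in>A. f (I a)) = (\<Sum>x\<in>pairs. card {a \<in> A. I a = x} * f x)"
    using finite_A I_touching by (intro sum_fun_comp) auto
  also have "\<dots> \<le> (\<Sum>x\<in>pairs. m * f x)"
    using assms fibre by (intro sum_mono mult_right_mono) auto
  finally show ?thesis by (simp add: sum_distrib_left)
qed

text \<open>Bookkeeping of edges: the coefficients pay for the edges missing from each pair, the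
  expectation for \<open>Y\<close>, and the extra power of \<open>p\<close> for the removed edges in
  \<open>R\<close>. By \<open>cov\<close> these cover the whole union. \<open>Y\<close> lies in at
  most four members, whence the 4 in the exponent.\<close>

lemma tilted_pair_le:
  fixes \<theta> :: real
  assumes \<theta>: "0 \<le> \<theta>" and a: "a \<in> A" and b: "b \<in> A" and Y: "Y \<subseteq> un (I a) \<union> un (I b)"
    and cov: "un (I a) \<union> un (I b) \<subseteq> (un (I a) - insert (kk a) (B a)) \<union> (un (I b) - insert (kk b) (B b)) \<union> Y \<union> R"
    and R: "finite R" "card R \<le> n"
  shows "c a * c b * p ^ n * expect (\<lambda>S. incl Y S * exp (\<theta> * W S))
     \<le> \<tau>\<^sup>2 * p ^ card (un (I a) \<union> un (I b)) * (exp (4 * (\<theta> * D / \<sigma>)) * h \<theta>)"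
proof -
  let ?a = "un (I a) - insert (kk a) (B a)" and ?b = "un (I b) - insert (kk b) (B b)"
  have fin: "finite ?a" "finite ?b" "finite Y"
    using finite_un[OF a] finite_un[OF b] Y finite_subset by blast+
  let ?C = "{fst (I a), snd (I a), fst (I b), snd (I b)}"
  have C: "finite ?C" "?C \<subseteq> M" "Y \<subseteq> \<Union>?C" "card ?C \<le> 4"
    using I_touching[OF a] I_touching[OF b] Y card_length[of "[fst (I a), snd (I a), fst (I b), snd (I b)]"]
    by (auto simp: pairs_def un_def)
  have "expect (\<lambda>S. incl Y S * exp (\<theta> * W S)) \<le> p ^ card Y * (exp (real 4 * (\<theta> * D / \<sigma>)) * h \<theta>)"
    by (rule tilted_incl_le[OF C \<theta>])
  then have "expect (\<lambda>S. incl Y S * exp (\<theta> * W S)) \<le> p ^ card Y * (exp (4 * (\<theta> * D / \<sigma>)) * h \<theta>)"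
    by (simp only: of_nat_numeral)
  moreover have "c a * c b \<le> (\<tau> * p ^ card ?a) * (\<tau> * p ^ card ?b)"
    using c_le[OF a] c_le[OF b] c_nonneg[OF a] c_nonneg[OF b] by (intro mult_mono) auto
  ultimately have "c a * c b * p ^ n * expect (\<lambda>S. incl Y S * exp (\<theta> * W S))
    \<le> (\<tau> * p ^ card ?a) * (\<tau> * p ^ card ?b) * p ^ n * (p ^ card Y * (exp (4 * (\<theta> * D / \<sigma>)) * h \<theta>))"
    using c_nonneg[OF a] c_nonneg[OF b] p_pos \<tau>_nonneg
    by (intro mult_mono[OF mult_right_mono] mult_nonneg_nonneg expect_nonneg) auto
  also have "\<dots> = \<tau>\<^sup>2 * p ^ (card ?a + card ?b + card Y + n) * (exp (4 * (\<theta> * D / \<sigma>)) * h \<theta>)"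
    by (simp add: power2_eq_square power_add)
  also have "\<dots> \<le> \<tau>\<^sup>2 * p ^ card (un (I a) \<union> un (I b)) * (exp (4 * (\<theta> * D / \<sigma>)) * h \<theta>)"
  proof (intro mult_right_mono mult_left_mono p_power_antimono)
    have "card (un (I a) \<union> un (I b)) \<le> card (?a \<union> ?b \<union> Y \<union> R)"
      using cov fin R by (intro card_mono) auto
    also have "\<dots> \<le> card ?a + card ?b + card Y + card R"
      by (rule card_Un4_le)
    finally show "card (un (I a) \<union> un (I b)) \<le> card ?a + card ?b + card Y + n" using R by simp
  qed (use h_pos[of \<theta>] in auto)
  finally show ?thesis .
qed

lemma tilted_energy_le:
  fixes \<theta> :: real
  assumes \<theta>: "0 \<le> \<theta>"
  shows "expect (\<lambda>S. energy S * exp (\<theta> * W S)) \<le> 3 * q * \<tau>\<^sup>2 * m\<^sup>2 * C4 * (exp (4 * (\<theta> * D / \<sigma>)) * h \<theta>)"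
proof -
  let ?e = "\<lambda>S. exp (\<theta> * W S)"
  let ?K = "exp (4 * (\<theta> * D / \<sigma>)) * h \<theta>"
  let ?G = "\<lambda>x y. of_bool (un x \<inter> un y \<noteq> {}) * p ^ card (un x \<union> un y)"
  \<comment> \<open>The three terms of \<open>abs_dZ_le\<close>: both summands centred at the same
    edge, or \<open>kk a\<close> in \<open>B b\<close> with the centred factor of \<open>b\<close>
    replaced by its indicator or by \<open>p\<close>. One power of \<open>p\<close> pays for
    \<open>kk a\<close>; the second, in the last term, for \<open>kk b\<close>. This is the source
    of the factor 3.\<close>
  let ?t = "\<lambda>a b S. of_bool (kk b = kk a) * (c a * c b * p ^ 1 * (incl (B a \<union> B b) S * ?e S))
        + of_bool (kk a \<in> B b) * (c a * c b * p ^ 1 * (incl ({kk b} \<union> (B a \<union> (B b - {kk a}))) S * ?e S))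
        + of_bool (kk a \<in> B b) * (c a * c b * p ^ 2 * (incl (B a \<union> (B b - {kk a})) S * ?e S))"
  have "energy S * ?e S \<le> q * (\<Sum>a\<in>A. \<Sum>b\<in>A. ?t a b S)" for S
  proof -
    have arith: "p * q * (ca * (xa * (x * (cb * xb) + y * (cb * ((xk + p) * xc))))) * ex
      = q * (x * (ca * cb * p ^ 1 * (xa * xb * ex)) + y * (ca * cb * p ^ 1 * (xk * (xa * xc) * ex))
        + y * (ca * cb * p\<^sup>2 * (xa * xc * ex)))" for ca cb x y xa xb xc xk ex :: real
      by (simp add: algebra_simps power2_eq_square)
    have "energy S * ?e S \<le> p * q * (\<Sum>a\<in>A. c a * (incl (B a) S * ((\<Sum>b\<in>A. of_bool (kk b = kk a) * (c b * incl (B b) S))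
     + (\<Sum>b\<in>A. of_bool (kk a \<in> B b) * (c b * ((incl {kk b} S + p) * incl (B b - {kk a}) S)))))) * ?e S"
      unfolding energy_def using p_pos q_pos c_nonneg
      by (intro mult_right_mono mult_left_mono sum_mono abs_dZ_le) auto
    also have "\<dots> = q * (\<Sum>a\<in>A. \<Sum>b\<in>A. ?t a b S)"
      unfolding incl_Un sum.distrib[symmetric] sum_distrib_left sum_distrib_right
      by (intro sum.cong refl) (rule arith)
    finally show ?thesis .
  qed
  then have "expect (\<lambda>S. energy S * ?e S) \<le> expect (\<lambda>S. q * (\<Sum>a\<in>A. \<Sum>b\<in>A. ?t a b S))" by (rule expect_mono)
  also have "\<dots> = q * (\<Sum>a\<in>A. \<Sum>b\<in>A. expect (?t a b))" by (simp only: expect_cmult expect_sum)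
  also have "\<dots> \<le> q * (\<Sum>a\<in>A. \<Sum>b\<in>A. 3 * \<tau>\<^sup>2 * ?K * ?G (I a) (I b))"
  proof (intro mult_left_mono sum_mono)
    fix a b assume a: "a \<in> A" and b: "b \<in> A"
    let ?x = "of_bool (kk b = kk a) :: real" and ?y = "of_bool (kk a \<in> B b) :: real"
    let ?F = "\<tau>\<^sup>2 * p ^ card (un (I a) \<union> un (I b)) * ?K"
    note mem = kk_mem[OF a] kk_mem[OF b] B_subset[OF a] B_subset[OF b]
    have F: "0 \<le> ?F" using p_pos h_pos[of \<theta>] by simp
    have 1: "?x * (c a * c b * p ^ 1 * expect (\<lambda>S. incl (B a \<union> B b) S * ?e S)) \<le> ?x * ?F"
    proof (cases "kk b = kk a")
      case True
      then show ?thesis using tilted_pair_le[OF \<theta> a b, of "B a \<union> B b" "{kk a}" 1] mem by auto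
    qed simp
    have 2: "?y * (c a * c b * p ^ 1 * expect (\<lambda>S. incl ({kk b} \<union> (B a \<union> (B b - {kk a}))) S * ?e S)) \<le> ?y * ?F"
    proof (cases "kk a \<in> B b")
      case True
      then show ?thesis
        using tilted_pair_le[OF \<theta> a b, of "{kk b} \<union> (B a \<union> (B b - {kk a}))" "{kk a}" 1] mem by auto
    qed simp
    have 3: "?y * (c a * c b * p ^ 2 * expect (\<lambda>S. incl (B a \<union> (B b - {kk a})) S * ?e S)) \<le> ?y * ?F"
    proof (cases "kk a \<in> B b")
      case True
      have "card {kk a, kk b} \<le> 2" by (simp add: card_insert_if)
      then show ?thesis
        using True tilted_pair_le[OF \<theta> a b, of "B a \<union> (B b - {kk a})" "{kk a, kk b}" 2] mem by auto
    qed simp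
    have arith: "?x * r + ?y * r + ?y * r \<le> 3 * (of_bool (un (I a) \<inter> un (I b) \<noteq> {}) * r)"
      if "0 \<le> r" for r :: real
    proof (cases "kk b = kk a \<or> kk a \<in> B b")
      case True
      then have "un (I a) \<inter> un (I b) \<noteq> {}" using mem by auto
      then show ?thesis using that by auto
    qed (use that in auto)
    have "expect (?t a b) = ?x * (c a * c b * p ^ 1 * expect (\<lambda>S. incl (B a \<union> B b) S * ?e S))
       + ?y * (c a * c b * p ^ 1 * expect (\<lambda>S. incl ({kk b} \<union> (B a \<union> (B b - {kk a}))) S * ?e S))
       + ?y * (c a * c b * p ^ 2 * expect (\<lambda>S. incl (B a \<union> (B b - {kk a})) S * ?e S))"
      by (simp only: expect_add expect_cmult)
    also have "\<dots> \<le> ?x * ?F + ?y * ?F + ?y * ?F" using 1 2 3 by (intro add_mono)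
    also have "\<dots> \<le> 3 * (of_bool (un (I a) \<inter> un (I b) \<noteq> {}) * ?F)"
      by (rule arith, rule F)
    finally show "expect (?t a b) \<le> 3 * \<tau>\<^sup>2 * ?K * ?G (I a) (I b)" by (simp add: mult_ac)
  qed (use q_pos in simp)
  also have "\<dots> = 3 * q * \<tau>\<^sup>2 * ?K * (\<Sum>a\<in>A. \<Sum>b\<in>A. ?G (I a) (I b))"
    unfolding sum_distrib_left by (intro sum.cong refl) (simp only: mult_ac)
  also have "\<dots> \<le> 3 * q * \<tau>\<^sup>2 * ?K * (m\<^sup>2 * C4)"
  proof (rule mult_left_mono)
    have "(\<Sum>a\<in>A. \<Sum>b\<in>A. ?G (I a) (I b)) \<le> m * (\<Sum>x\<in>pairs. \<Sum>b\<in>A. ?G x (I b))"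
      using p_pos by (intro fibre_sum[of "\<lambda>x. \<Sum>b\<in>A. ?G x (I b)"] sum_nonneg) auto
    also have "\<dots> \<le> m * (\<Sum>x\<in>pairs. m * (\<Sum>y\<in>pairs. ?G x y))"
      using p_pos by (intro mult_left_mono sum_mono fibre_sum) auto
    also have "\<dots> = m\<^sup>2 * C4"
      unfolding C4_def sum_distrib_left[symmetric] by (simp only: power2_eq_square of_nat_mult mult.assoc)
    finally show "(\<Sum>a\<in>A. \<Sum>b\<in>A. ?G (I a) (I b)) \<le> m\<^sup>2 * C4" .
  qed (use q_pos h_pos[of \<theta>] in simp)
  finally show ?thesis by (simp only: mult_ac)
qed

text \<open>Each factor \<open>Q\<close> brings its own \<open>p * q\<close>: the two powers of
  \<open>p\<close> pay for \<open>kk a\<close> and \<open>kk b\<close>. Expanding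
  \<open>\<Delta>\<close> adds one member to each of the two pairs, so six members are forced; the
  added one contains \<open>kk a\<close> and therefore meets its pair.\<close>

lemma tilted_Q_le:
  fixes \<theta> :: real
  assumes \<theta>: "0 \<le> \<theta>"
  shows "expect (\<lambda>S. (Q S)\<^sup>2 * exp (\<theta> * W S)) \<le> (q * \<tau> * m / \<sigma>)\<^sup>2 * C6 * (exp (6 * (\<theta> * D / \<sigma>)) * h \<theta>)"
proof -
  let ?e = "\<lambda>S. exp (\<theta> * W S)"
  let ?K = "exp (6 * (\<theta> * D / \<sigma>)) * h \<theta>"
  let ?J = "\<lambda>a. {j \<in> M. kk a \<in> j}" and ?w = "\<lambda>a. p * q * c a / \<sigma>"
  let ?C = "\<lambda>a j. B a \<union> (j - {kk a})"
  let ?T = "\<lambda>x j. {j \<in> M. j \<inter> un x \<noteq> {}}"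
  have Q: "Q S = (\<Sum>a\<in>A. \<Sum>j\<in>?J a. ?w a * incl (?C a j) S)" for S
    unfolding Q_def \<Delta>_def sum_distrib_left sum_divide_distrib incl_Un
    by (intro sum.cong refl) simp
  have "expect (\<lambda>S. (Q S)\<^sup>2 * ?e S)
    = (\<Sum>a\<in>A. \<Sum>b\<in>A. \<Sum>j\<in>?J a. \<Sum>l\<in>?J b. ?w a * ?w b * expect (\<lambda>S. incl (?C a j \<union> ?C b l) S * ?e S))"
  proof -
    have "(Q S)\<^sup>2 * ?e S = (\<Sum>a\<in>A. \<Sum>b\<in>A. \<Sum>j\<in>?J a. \<Sum>l\<in>?J b. ?w a * ?w b * (incl (?C a j \<union> ?C b l) S * ?e S))" for S
    proof -
      have "(Q S)\<^sup>2 = (\<Sum>a\<in>A. \<Sum>b\<in>A. (\<Sum>j\<in>?J a. ?w a * incl (?C a j) S) * (\<Sum>l\<in>?J b. ?w b * incl (?C b l) S))"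
        unfolding power2_eq_square Q by (rule sum_product)
      also have "\<dots> = (\<Sum>a\<in>A. \<Sum>b\<in>A. \<Sum>j\<in>?J a. \<Sum>l\<in>?J b. ?w a * ?w b * incl (?C a j \<union> ?C b l) S)"
        unfolding sum_product incl_Un[of "?C _ _"] by (intro sum.cong refl) (simp only: mult_ac)
      finally show ?thesis by (simp only: sum_distrib_right mult.assoc)
    qed
    then show ?thesis by (simp only: expect_sum expect_cmult)
  qed
  also have "\<dots> \<le> (\<Sum>a\<in>A. \<Sum>b\<in>A. \<Sum>j\<in>?J a. \<Sum>l\<in>?J b.
      (q * \<tau> / \<sigma>)\<^sup>2 * ?K * p ^ card ((un (I a) \<union> j) \<union> (un (I b) \<union> l)))"
  proof (intro sum_mono)
    fix a b j l assume a: "a \<in> A" and b: "b \<in> A" and j: "j \<in> ?J a" and l: "l \<in> ?J b"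
    let ?a = "un (I a) - insert (kk a) (B a)" and ?b = "un (I b) - insert (kk b) (B b)"
    let ?Y = "?C a j \<union> ?C b l"
    note mem = kk_mem[OF a] kk_mem[OF b] B_subset[OF a] B_subset[OF b]
    have fin: "finite ?a" "finite ?b" "finite ?Y"
      using finite_un[OF a] finite_un[OF b] j l mem by (auto intro: finite_subset)
    let ?S = "{fst (I a), snd (I a), j, fst (I b), snd (I b), l}"
    have C: "finite ?S" "?S \<subseteq> M" "?Y \<subseteq> \<Union>?S" "card ?S \<le> 6"
      using I_touching[OF a] I_touching[OF b] j l mem card_length[of "[fst (I a), snd (I a), j, fst (I b), snd (I b), l]"]
      by (auto simp: pairs_def un_def)
    have "expect (\<lambda>S. incl ?Y S * ?e S) \<le> p ^ card ?Y * (exp (real 6 * (\<theta> * D / \<sigma>)) * h \<theta>)"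
      by (rule tilted_incl_le[OF C \<theta>])
    then have "expect (\<lambda>S. incl ?Y S * ?e S) \<le> p ^ card ?Y * ?K"
      by (simp only: of_nat_numeral)
    moreover have "?w a * ?w b \<le> (p * q * (\<tau> * p ^ card ?a) / \<sigma>) * (p * q * (\<tau> * p ^ card ?b) / \<sigma>)"
      using c_le[OF a] c_le[OF b] c_nonneg[OF a] c_nonneg[OF b] p_pos q_pos \<sigma>_pos \<tau>_nonneg
      by (intro mult_mono divide_right_mono mult_left_mono) auto
    ultimately have "?w a * ?w b * expect (\<lambda>S. incl ?Y S * ?e S)
      \<le> (p * q * (\<tau> * p ^ card ?a) / \<sigma>) * (p * q * (\<tau> * p ^ card ?b) / \<sigma>) * (p ^ card ?Y * ?K)"
      using c_nonneg[OF a] c_nonneg[OF b] p_pos q_pos \<sigma>_pos \<tau>_nonneg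
      by - (rule mult_mono, auto intro!: expect_nonneg)
    also have "\<dots> = (q * \<tau> / \<sigma>)\<^sup>2 * ?K * p ^ (card ?a + card ?b + card ?Y + 2)"
      by (simp add: power2_eq_square power_add)
    also have "\<dots> \<le> (q * \<tau> / \<sigma>)\<^sup>2 * ?K * p ^ card ((un (I a) \<union> j) \<union> (un (I b) \<union> l))"
    proof (intro mult_left_mono p_power_antimono)
      have "card ((un (I a) \<union> j) \<union> (un (I b) \<union> l)) \<le> card (?a \<union> ?b \<union> ?Y \<union> {kk a, kk b})"
        using fin by (intro card_mono) auto
      also have "\<dots> \<le> card ?a + card ?b + card ?Y + card {kk a, kk b}"
        by (rule card_Un4_le)
      also have "card {kk a, kk b} \<le> 2" by (simp add: card_insert_if)
      finally show "card ((un (I a) \<union> j) \<union> (un (I b) \<union> l)) \<le> card ?a + card ?b + card ?Y + 2" by simp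
    qed (use h_pos[of \<theta>] in auto)
    finally show "?w a * ?w b * expect (\<lambda>S. incl ?Y S * ?e S)
      \<le> (q * \<tau> / \<sigma>)\<^sup>2 * ?K * p ^ card ((un (I a) \<union> j) \<union> (un (I b) \<union> l))" .
  qed
  also have "\<dots> = (q * \<tau> / \<sigma>)\<^sup>2 * ?K * (\<Sum>a\<in>A. \<Sum>b\<in>A. \<Sum>j\<in>?J a. \<Sum>l\<in>?J b. p ^ card ((un (I a) \<union> j) \<union> (un (I b) \<union> l)))"
    by (simp only: sum_distrib_left)
  also have "\<dots> \<le> (q * \<tau> / \<sigma>)\<^sup>2 * ?K * (m\<^sup>2 * C6)"
  proof (intro mult_left_mono)
    let ?G = "\<lambda>x y. \<Sum>j\<in>{j \<in> M. j \<inter> un x \<noteq> {}}. \<Sum>l\<in>{l \<in> M. l \<inter> un y \<noteq> {}}. p ^ card ((un x \<union> j) \<union> (un y \<union> l))"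
    have "(\<Sum>a\<in>A. \<Sum>b\<in>A. \<Sum>j\<in>?J a. \<Sum>l\<in>?J b. p ^ card ((un (I a) \<union> j) \<union> (un (I b) \<union> l)))
      \<le> (\<Sum>a\<in>A. \<Sum>b\<in>A. ?G (I a) (I b))"
    proof (intro sum_mono)
      fix a b assume a: "a \<in> A" and b: "b \<in> A"
      let ?g = "\<lambda>j. \<Sum>l\<in>{l \<in> M. l \<inter> un (I b) \<noteq> {}}. p ^ card ((un (I a) \<union> j) \<union> (un (I b) \<union> l))"
      have "(\<Sum>j\<in>?J a. \<Sum>l\<in>?J b. p ^ card ((un (I a) \<union> j) \<union> (un (I b) \<union> l))) \<le> (\<Sum>j\<in>?J a. ?g j)"
        using p_pos kk_mem[OF b] by (intro sum_mono sum_mono2) auto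
      also have "\<dots> \<le> ?G (I a) (I b)"
        using p_pos kk_mem[OF a] by (intro sum_mono2 sum_nonneg) auto
      finally show "(\<Sum>j\<in>?J a. \<Sum>l\<in>?J b. p ^ card ((un (I a) \<union> j) \<union> (un (I b) \<union> l))) \<le> ?G (I a) (I b)" .
    qed
    also have "\<dots> \<le> m * (\<Sum>x\<in>pairs. \<Sum>b\<in>A. ?G x (I b))"
      using p_pos by (intro fibre_sum[of "\<lambda>x. \<Sum>b\<in>A. ?G x (I b)"] sum_nonneg) auto
    also have "\<dots> \<le> m * (\<Sum>x\<in>pairs. m * (\<Sum>y\<in>pairs. ?G x y))"
      using p_pos by (intro mult_left_mono sum_mono fibre_sum sum_nonneg) auto
    also have "\<dots> = m\<^sup>2 * C6"
      unfolding C6_def sum_distrib_left[symmetric] by (simp only: power2_eq_square of_nat_mult mult.assoc)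
    finally show "(\<Sum>a\<in>A. \<Sum>b\<in>A. \<Sum>j\<in>?J a. \<Sum>l\<in>?J b. p ^ card ((un (I a) \<union> j) \<union> (un (I b) \<union> l))) \<le> m\<^sup>2 * C6" .
  qed (use h_pos[of \<theta>] in auto)
  finally show ?thesis by (simp add: power_mult_distrib power_divide mult_ac)
qed

text \<open>The 6 in the first condition on \<open>K\<close> is the 2 of
  \<open>second_moment_le\<close> times the 3 of \<open>tilted_energy_le\<close>. The first moment
  follows from 2 Y |Z| <= Y^2 + Z^2, with \<open>Y\<close> the root of the second-moment
  bound.\<close>

lemma tilted_abs_le:
  fixes \<theta> :: real
  assumes \<theta>: "0 \<le> \<theta>" and K: "0 < K" "6 * q * \<tau>\<^sup>2 * m\<^sup>2 * C4 \<le> K\<^sup>2" "(q * \<tau> * m / \<sigma>)\<^sup>2 * C6 \<le> K\<^sup>2"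
  shows "expect (\<lambda>S. \<bar>Z S\<bar> * exp (\<theta> * W S)) \<le> K * (1 + \<theta>) * exp (5 * (\<theta> * D / \<sigma>)) * h \<theta>"
proof -
  let ?e = "\<lambda>S. exp (\<theta> * W S)"
  define x where "x = \<theta> * D / \<sigma>"
  define L where "L = exp x"
  define Y where "Y = K * (1 + \<theta>) * L ^ 5"
  have x: "0 \<le> x" using \<theta> \<sigma>_pos by (simp add: x_def)
  then have L: "1 \<le> L" by (simp add: L_def)
  have Lp: "exp (n * x) = L ^ n" for n :: nat by (simp add: L_def exp_of_nat_mult)
  have Y: "0 < Y" using K(1) \<theta> L by (simp add: Y_def)
  have "expect (\<lambda>S. (Z S)\<^sup>2 * ?e S) \<le> 2 * L * expect (\<lambda>S. energy S * ?e S) + (\<theta> * L)\<^sup>2 * expect (\<lambda>S. (Q S)\<^sup>2 * ?e S)"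
    using second_moment_le[OF \<theta>] by (simp add: L_def x_def)
  also have "\<dots> \<le> 2 * L * (3 * q * \<tau>\<^sup>2 * m\<^sup>2 * C4 * (L ^ 4 * h \<theta>))
     + (\<theta> * L)\<^sup>2 * ((q * \<tau> * m / \<sigma>)\<^sup>2 * C6 * (L ^ 6 * h \<theta>))"
    using tilted_energy_le[OF \<theta>] tilted_Q_le[OF \<theta>] L Lp[of 4] Lp[of 6]
    by (intro add_mono mult_left_mono) (auto simp: x_def)
  also have "\<dots> = ((6 * q * \<tau>\<^sup>2 * m\<^sup>2 * C4) * L ^ 5 + (q * \<tau> * m / \<sigma>)\<^sup>2 * C6 * (\<theta>\<^sup>2 * L ^ 8)) * h \<theta>"
    by (simp add: algebra_simps power_mult_distrib eval_nat_numeral)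
  \<comment> \<open>Both \<open>L ^ 5\<close> and \<open>L ^ 8\<close> are raised to
    \<open>L ^ 10\<close>, whose root is the exponential with the factor 5.\<close>
  also have "\<dots> \<le> (K\<^sup>2 * L ^ 10 + K\<^sup>2 * (\<theta>\<^sup>2 * L ^ 10)) * h \<theta>"
    using K h_pos[of \<theta>] L power_increasing[of 5 10 L] power_increasing[of 8 10 L]
    by (intro mult_right_mono add_mono mult_mono) auto
  also have "\<dots> \<le> Y\<^sup>2 * h \<theta>"
  proof (intro mult_right_mono)
    have "K\<^sup>2 * L ^ 10 + K\<^sup>2 * (\<theta>\<^sup>2 * L ^ 10) = (K\<^sup>2 * L ^ 10) * (1 + \<theta>\<^sup>2)" by (simp add: algebra_simps)
    also have "\<dots> \<le> (K\<^sup>2 * L ^ 10) * (1 + \<theta>)\<^sup>2"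
      using \<theta> L by (intro mult_left_mono) (auto simp: power2_sum)
    also have "\<dots> = Y\<^sup>2" by (simp add: Y_def power_mult_distrib flip: power_mult)
    finally show "K\<^sup>2 * L ^ 10 + K\<^sup>2 * (\<theta>\<^sup>2 * L ^ 10) \<le> Y\<^sup>2" .
  qed (use h_pos[of \<theta>] in simp)
  finally have Z2: "expect (\<lambda>S. (Z S)\<^sup>2 * ?e S) \<le> Y\<^sup>2 * h \<theta>" .
  have "expect (\<lambda>S. \<bar>Z S\<bar> * ?e S) \<le> expect (\<lambda>S. Y / 2 * ?e S + 1 / (2 * Y) * ((Z S)\<^sup>2 * ?e S))"
  proof (rule expect_mono)
    fix S
    have "2 * Y * \<bar>Z S\<bar> \<le> Y\<^sup>2 + (Z S)\<^sup>2" using sum_squares_bound[of Y "\<bar>Z S\<bar>"] by simp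
    then have "\<bar>Z S\<bar> \<le> Y / 2 + 1 / (2 * Y) * (Z S)\<^sup>2" using Y by (simp add: field_simps power2_eq_square)
    then have "\<bar>Z S\<bar> * ?e S \<le> (Y / 2 + 1 / (2 * Y) * (Z S)\<^sup>2) * ?e S" by (intro mult_right_mono) auto
    then show "\<bar>Z S\<bar> * ?e S \<le> Y / 2 * ?e S + 1 / (2 * Y) * ((Z S)\<^sup>2 * ?e S)" by (simp add: algebra_simps)
  qed
  also have "\<dots> = Y / 2 * h \<theta> + 1 / (2 * Y) * expect (\<lambda>S. (Z S)\<^sup>2 * ?e S)"
    by (simp only: expect_add expect_cmult h_def)
  also have "\<dots> \<le> Y / 2 * h \<theta> + 1 / (2 * Y) * (Y\<^sup>2 * h \<theta>)"
    using Z2 Y by (intro add_mono mult_left_mono) auto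
  also have "\<dots> = Y * h \<theta>" using Y by (simp add: field_simps power2_eq_square)
  finally show ?thesis using Lp[of 5] by (simp add: Y_def x_def)
qed

end

section \<open>Sums over overlapping sets\<close>

context subset_count
begin

lemma power_card_Un: "finite Y \<Longrightarrow> finite Y' \<Longrightarrow> p ^ card (Y \<union> Y') = p ^ card Y * p ^ card (Y' - Y)"
  by (metis Un_Diff_cancel card_Un_disjoint Diff_disjoint finite_Diff power_add)

lemma sum_pairs: "(\<Sum>x\<in>pairs. f x) = (\<Sum>i\<in>M. \<Sum>j\<in>{j \<in> M. j \<inter> i \<noteq> {}}. f (i, j))"
proof -
  have "pairs = (SIGMA i:M. {j \<in> M. j \<inter> i \<noteq> {}})" by (auto simp: pairs_def)
  then show ?thesis by (simp add: sum_Sigma_pair)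
qed

lemma sum_pairs_swap: "(\<Sum>x\<in>pairs. f x) = (\<Sum>x\<in>pairs. f (snd x, fst x))"
  by (rule sum.reindex_bij_witness[of _ "\<lambda>x. (snd x, fst x)" "\<lambda>x. (snd x, fst x)"]) (auto simp: pairs_def)

lemma pairs_memD: "x \<in> pairs \<Longrightarrow> fst x \<in> M \<and> snd x \<in> M \<and> finite (un x) \<and> un x \<subseteq> E \<and> card (un x) \<le> 2 * e"
  using card_Un_le[of "fst x" "snd x"] M_subset card_M by (force simp: pairs_def un_def)

section \<open>\<open>U\<close> and \<open>V\<close> as dominated forms\<close>

definition \<mu> :: real where "\<mu> = card M * p ^ e"

lemma \<mu>_nonneg: "0 \<le> \<mu>"
  using p_pos by (simp add: \<mu>_def)

text \<open>The exponent \<open>e - 1 - card (pre i k)\<close> in \<open>cW\<close> is the number of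
  edges of \<open>i\<close> outside \<open>pre i k\<close> and \<open>k\<close>. All edges of
  \<open>j\<close> are in \<open>BU\<close> or equal to \<open>k\<close>, so nothing else of the
  pair is missing.\<close>

lemma dominated_U:
  "dominated_form E p q M e \<sigma> D AU cU kU BU (\<lambda>a. (fst (fst a), snd a)) (1 / \<sigma>\<^sup>2) (2 * e * e)"
proof
  show "zform AU cU kU BU" by (rule zform_U)
  show "0 \<le> 1 / \<sigma>\<^sup>2" by simp
next
  fix a assume a: "a \<in> AU"
  obtain i k j where ikj: "a = ((i, k), j)" by (metis surj_pair)
  have m: "i \<in> M" "k \<in> i" "j \<in> M" "k \<in> j" using a by (auto simp: ikj AU_def AW_def)
  have pre: "pre i k \<subseteq> i - {k}" by (rule pre_subset) (use m in auto)
  show "(fst (fst a), snd a) \<in> pairs" using m by (auto simp: ikj pairs_def)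
  show "kU a \<in> un (fst (fst a), snd a)" using m by (auto simp: ikj kU_def un_def)
  show "BU a \<subseteq> un (fst (fst a), snd a)" using pre by (auto simp: ikj BU_def BW_def un_def)
  have "card (un (i, j) - insert k (BU a)) \<le> card (i - insert k (pre i k))"
    using m by (intro card_mono) (auto simp: ikj un_def BU_def BW_def)
  also have "\<dots> = e - 1 - card (pre i k)"
    using pre m card_M[of i] finite_subset[OF pre]
    by (subst card_Diff_subset) (auto simp: card_insert_if)
  finally show "cU a \<le> 1 / \<sigma>\<^sup>2 * p ^ card (un (fst (fst a), snd a) - insert (kU a) (BU a))"
    using \<sigma>_pos by (auto simp: ikj cU_def cW_def kU_def power2_eq_square intro!: divide_right_mono p_power_antimono)
next
  fix x assume x: "x \<in> pairs"
  have "card {a \<in> AU. (fst (fst a), snd a) = x} \<le> card (fst x)"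
    using pairs_memD[OF x]
    by (intro card_inj_on_le[of kU]) (auto simp: inj_on_def kU_def AU_def AW_def)
  also have "\<dots> = e" using pairs_memD[OF x] card_M by auto
  \<comment> \<open>Within a fibre the edge \<open>kU a\<close> determines the index, giving
    \<open>e\<close>; it is enlarged to the multiplicity of \<open>V\<close> so that both forms
    share one constant.\<close>
  also have "e \<le> 2 * e * e" using e_pos by simp
  finally show "card {a \<in> AU. (fst (fst a), snd a) = x} \<le> 2 * e * e" .
qed

definition AV :: "((('e set \<times> 'e) \<times> 'e set) \<times> 'e) set" where "AV = (SIGMA a:AU. BU a)"
definition cV :: "(('e set \<times> 'e) \<times> 'e set) \<times> 'e \<Rightarrow> real" where
  "cV b = p * q * cU (fst b) * p ^ (card (BU (fst b)) - 1 - card (pre (BU (fst b)) (snd b)))"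
definition BV :: "(('e set \<times> 'e) \<times> 'e set) \<times> 'e \<Rightarrow> 'e set" where
  "BV b = pre (BU (fst b)) (snd b)"

lemma BU_subset: "a \<in> AU \<Longrightarrow> BU a \<subseteq> E \<and> finite (BU a)"
proof -
  assume "a \<in> AU"
  then have "BU a \<subseteq> E" using zform_U by (auto simp: zform_def)
  then show ?thesis using finite_E finite_subset by blast
qed

text \<open>As \<open>T\<close> has mean 1, \<open>V\<close> is the sum of its centred products, and
  each of these telescopes again.\<close>

lemma V_eq_zf: "V = zf AV cV snd BV"
proof
  fix S
  have "1 = p * q * (\<Sum>a\<in>AU. cU a * p ^ card (BU a))"
    unfolding expect_T[symmetric] T_def expect_cmult expect_sum
    by (intro arg_cong[where f = "\<lambda>x. p * q * x"] sum.cong refl) (simp add: expect_incl BU_subset)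
  then have "V S = p * q * (\<Sum>a\<in>AU. cU a * (incl (BU a) S - p ^ card (BU a)))"
    unfolding V_def T_def by (simp add: right_diff_distrib sum_subtractf)
  also have "\<dots> = (\<Sum>a\<in>AU. p * q * (cU a * (\<Sum>k\<in>BU a.
      (incl {k} S - p) * p ^ (card (BU a) - 1 - card (pre (BU a) k)) * incl (pre (BU a) k) S)))"
    unfolding sum_distrib_left[of _ _ AU] using BU_subset
    by (intro sum.cong refl) (simp add: incl_pre)
  also have "\<dots> = zf AV cV snd BV S"
    unfolding zf_def AV_def using finite_AU BU_subset
    by (subst sum_Sigma_pair) (auto simp: cV_def BV_def sum_distrib_left mult_ac intro!: sum.cong)
  finally show "V S = zf AV cV snd BV S" .
qed

lemma dominated_V:
  "dominated_form E p q M e \<sigma> D AV cV snd BV (\<lambda>b. (fst (fst (fst b)), snd (fst b))) (1 / \<sigma>\<^sup>2) (2 * e * e)"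
proof -
  interpret U: dominated_form E p q M e \<sigma> D AU cU kU BU "\<lambda>a. (fst (fst a), snd a)" "1 / \<sigma>\<^sup>2" "2 * e * e"
    by (rule dominated_U)
  show ?thesis
  proof
    show "zform AV cV snd BV"
      unfolding zform_def
    proof (intro conjI ballI)
      show "finite AV" unfolding AV_def using finite_AU BU_subset by (intro finite_SigmaI) auto
      fix b assume b: "b \<in> AV"
      then have b': "fst b \<in> AU" "snd b \<in> BU (fst b)" by (auto simp: AV_def)
      show "0 \<le> cV b" using U.c_nonneg[OF b'(1)] p_pos q_pos by (simp add: cV_def)
      show "snd b \<in> E" using BU_subset[OF b'(1)] b'(2) by auto
      show "BV b \<subseteq> E - {snd b}"
        using BU_subset[OF b'(1)] pre_subset[of "BU (fst b)", OF _ b'(2)] by (auto simp: BV_def)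
    qed
    show "0 \<le> 1 / \<sigma>\<^sup>2" by simp
  next
    fix b assume b: "b \<in> AV"
    obtain a k' where ak: "b = (a, k')" by (metis surj_pair)
    have a: "a \<in> AU" and k': "k' \<in> BU a" using b by (auto simp: AV_def ak)
    let ?u = "un (fst (fst a), snd a)"
    have pre: "pre (BU a) k' \<subseteq> BU a - {k'}" by (rule pre_subset) (use BU_subset[OF a] k' in auto)
    show "(fst (fst (fst b)), snd (fst b)) \<in> pairs" using U.I_touching[OF a] by (simp add: ak)
    show "snd b \<in> un (fst (fst (fst b)), snd (fst b))" using U.B_subset[OF a] k' by (auto simp: ak)
    show "BV b \<subseteq> un (fst (fst (fst b)), snd (fst b))" using U.B_subset[OF a] pre by (auto simp: ak BV_def)
    have fin: "finite ?u" using U.finite_un[OF a] .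
    \<comment> \<open>The missing edges are those already missing for \<open>a\<close>, the edge
      \<open>kU a\<close>, and the part of \<open>BU a\<close> dropped by the second telescoping.
      The factor \<open>p\<close> in \<open>cV\<close> pays for \<open>kU a\<close>; the empty set
      only fits the shape of \<open>card_Un4_le\<close>.\<close>
    have "card (?u - insert k' (pre (BU a) k')) \<le> card ((?u - insert (kU a) (BU a)) \<union> {kU a} \<union> (BU a - insert k' (pre (BU a) k')) \<union> {})"
      using fin BU_subset[OF a] by (intro card_mono) auto
    also have "\<dots> \<le> card (?u - insert (kU a) (BU a)) + card {kU a} + card (BU a - insert k' (pre (BU a) k')) + card ({} :: 'e set)"
      by (rule card_Un4_le)
    also have "card (BU a - insert k' (pre (BU a) k')) = card (BU a) - 1 - card (pre (BU a) k')"
      using pre k' BU_subset[OF a] finite_subset[OF pre]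
      by (subst card_Diff_subset) (auto simp: card_insert_if)
    finally have card: "card (?u - insert k' (pre (BU a) k'))
      \<le> card (?u - insert (kU a) (BU a)) + 1 + (card (BU a) - 1 - card (pre (BU a) k'))" by simp
    have "cV b \<le> p * 1 * (1 / \<sigma>\<^sup>2 * p ^ card (?u - insert (kU a) (BU a))) * p ^ (card (BU a) - 1 - card (pre (BU a) k'))"
      unfolding cV_def ak fst_conv snd_conv using U.c_le[OF a] U.c_nonneg[OF a] p_pos q_pos q_le_1
      by (intro mult_right_mono mult_mono) auto
    also have "\<dots> = 1 / \<sigma>\<^sup>2 * p ^ (card (?u - insert (kU a) (BU a)) + 1 + (card (BU a) - 1 - card (pre (BU a) k')))"
      by (simp add: power_add)
    also have "\<dots> \<le> 1 / \<sigma>\<^sup>2 * p ^ card (?u - insert k' (pre (BU a) k'))"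
      by (intro mult_left_mono p_power_antimono card) auto
    finally show "cV b \<le> 1 / \<sigma>\<^sup>2 * p ^ card (un (fst (fst (fst b)), snd (fst b)) - insert (snd b) (BV b))"
      by (simp add: ak BV_def)
  next
    fix x assume x: "x \<in> pairs"
    let ?N = "{b \<in> AV. (fst (fst (fst b)), snd (fst b)) = x}"
    have "card ?N \<le> card (fst x \<times> un x)"
    proof (intro card_inj_on_le[of "\<lambda>b. (kU (fst b), snd b)"])
      show "inj_on (\<lambda>b. (kU (fst b), snd b)) ?N"
        by (auto simp: inj_on_def kU_def)
      show "(\<lambda>b. (kU (fst b), snd b)) ` ?N \<subseteq> fst x \<times> un x"
        using U.B_subset by (fastforce simp: AV_def kU_def AU_def AW_def)
      show "finite (fst x \<times> un x)" using pairs_memD[OF x] by auto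
    qed
    also have "\<dots> \<le> e * (2 * e)"
      using pairs_memD[OF x] card_M[of "fst x"] by (auto simp: card_cartesian_product)
    finally show "card ?N \<le> 2 * e * e" by (simp add: mult_ac)
  qed
qed

end

text \<open>\<open>l r\<close> bounds the price of one more overlapping member: given that all of
  \<open>S\<close> is present, the sum in \<open>chain\<close> is the expected number of present
  members meeting \<open>S\<close>.\<close>

locale chained = subset_count E p q M e \<sigma> D
  for E :: "'e set" and p q :: real and M e \<sigma> D +
  fixes l :: "nat \<Rightarrow> real"
  assumes chain: "S \<subseteq> E \<Longrightarrow> card S \<le> r * e \<Longrightarrow> (\<Sum>j\<in>{j \<in> M. j \<inter> S \<noteq> {}}. p ^ card (j - S)) \<le> l r"
begin

section \<open>Adding members to a chain one at a time\<close>

lemma l_nonneg: "0 \<le> l r"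
  using chain[of "{}" r] by simp

lemma sum_pairs_le: "(\<Sum>x\<in>pairs. p ^ card (un x)) \<le> \<mu> * l 1"
proof -
  have "(\<Sum>x\<in>pairs. p ^ card (un x)) = (\<Sum>i\<in>M. p ^ e * (\<Sum>j\<in>{j \<in> M. j \<inter> i \<noteq> {}}. p ^ card (j - i)))"
    unfolding sum_pairs sum_distrib_left by (intro sum.cong refl) (auto simp: un_def power_card_Un card_M)
  also have "\<dots> \<le> (\<Sum>i\<in>M. p ^ e * l 1)"
    using p_pos chain M_subset card_M by (intro sum_mono mult_left_mono) auto
  finally show ?thesis by (simp add: \<mu>_def)
qed

lemma second_of_pair_le:
  assumes "S \<subseteq> E" "card S \<le> r * e" "i \<in> M"
  shows "(\<Sum>j\<in>{j \<in> M. j \<inter> i \<noteq> {}}. p ^ card (un (i, j) - S)) \<le> p ^ card (i - S) * l (Suc r)"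
proof -
  have fin: "finite S" using assms finite_E finite_subset by blast
  have "(\<Sum>j\<in>{j \<in> M. j \<inter> i \<noteq> {}}. p ^ card (un (i, j) - S))
     = (\<Sum>j\<in>{j \<in> M. j \<inter> i \<noteq> {}}. p ^ card (i - S) * p ^ card (j - (S \<union> i)))"
  proof (intro sum.cong refl)
    fix j assume "j \<in> {j \<in> M. j \<inter> i \<noteq> {}}"
    moreover have "un (i, j) - S = (i - S) \<union> (j - (S \<union> i))" by (auto simp: un_def)
    moreover have "j - (S \<union> i) - (i - S) = j - (S \<union> i)" by auto
    ultimately show "p ^ card (un (i, j) - S) = p ^ card (i - S) * p ^ card (j - (S \<union> i))"
      using assms by (simp add: power_card_Un)
  qed
  also have "\<dots> = p ^ card (i - S) * (\<Sum>j\<in>{j \<in> M. j \<inter> i \<noteq> {}}. p ^ card (j - (S \<union> i)))"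
    by (simp add: sum_distrib_left)
  also have "\<dots> \<le> p ^ card (i - S) * l (Suc r)"
  proof (intro mult_left_mono)
    have "(\<Sum>j\<in>{j \<in> M. j \<inter> i \<noteq> {}}. p ^ card (j - (S \<union> i))) \<le> (\<Sum>j\<in>{j \<in> M. j \<inter> (S \<union> i) \<noteq> {}}. p ^ card (j - (S \<union> i)))"
      using p_pos by (intro sum_mono2) auto
    also have "\<dots> \<le> l (Suc r)"
      using assms M_subset[of i] card_M[of i] card_Un_le[of S i] by (intro chain) auto
    finally show "(\<Sum>j\<in>{j \<in> M. j \<inter> i \<noteq> {}}. p ^ card (j - (S \<union> i))) \<le> l (Suc r)" .
  qed (use p_pos in simp)
  finally show ?thesis .
qed

text \<open>Either component of the pair may be the one that meets \<open>S\<close>; exchanging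
  components reduces the second case to the first, whence the 2.\<close>

lemma pairs_touching_le:
  assumes "S \<subseteq> E" "card S \<le> r * e"
  shows "(\<Sum>y\<in>pairs. of_bool (S \<inter> un y \<noteq> {}) * p ^ card (un y - S)) \<le> 2 * l r * l (Suc r)"
proof -
  let ?f = "\<lambda>y. of_bool (fst y \<inter> S \<noteq> {}) * p ^ card (un y - S)"
  have "(\<Sum>y\<in>pairs. of_bool (S \<inter> un y \<noteq> {}) * p ^ card (un y - S)) \<le> (\<Sum>y\<in>pairs. ?f y + ?f (snd y, fst y))"
    using p_pos by (intro sum_mono) (auto simp: un_def Un_commute)
  also have "\<dots> = 2 * (\<Sum>y\<in>pairs. ?f y)"
    unfolding sum.distrib sum_pairs_swap[of ?f, symmetric] by simp
  also have "(\<Sum>y\<in>pairs. ?f y) = (\<Sum>i\<in>M. of_bool (i \<inter> S \<noteq> {}) * (\<Sum>j\<in>{j \<in> M. j \<inter> i \<noteq> {}}. p ^ card (un (i, j) - S)))"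
    unfolding sum_pairs sum_distrib_left by simp
  finally have 1: "(\<Sum>y\<in>pairs. of_bool (S \<inter> un y \<noteq> {}) * p ^ card (un y - S))
    \<le> 2 * (\<Sum>i\<in>M. of_bool (i \<inter> S \<noteq> {}) * (\<Sum>j\<in>{j \<in> M. j \<inter> i \<noteq> {}}. p ^ card (un (i, j) - S)))" .
  have "(\<Sum>i\<in>M. of_bool (i \<inter> S \<noteq> {}) * (\<Sum>j\<in>{j \<in> M. j \<inter> i \<noteq> {}}. p ^ card (un (i, j) - S)))
    \<le> (\<Sum>i\<in>M. of_bool (i \<inter> S \<noteq> {}) * (p ^ card (i - S) * l (Suc r)))"
    using second_of_pair_le[OF assms] by (intro sum_mono mult_left_mono) auto
  also have "\<dots> = (\<Sum>i\<in>{i \<in> M. i \<inter> S \<noteq> {}}. p ^ card (i - S)) * l (Suc r)"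
    unfolding sum_distrib_right by (rule sum.mono_neutral_cong_right) auto
  also have "\<dots> \<le> l r * l (Suc r)"
    using l_nonneg chain[OF assms] by (intro mult_right_mono) auto
  finally show ?thesis using 1 by simp
qed

text \<open>With no contact to \<open>S\<close> required, the first member is either disjoint from
  \<open>S\<close>, contributing at most \<open>\<mu>\<close> in total, or meets it, contributing
  \<open>l r\<close>.\<close>

lemma pairs_le:
  assumes "S \<subseteq> E" "card S \<le> r * e"
  shows "(\<Sum>y\<in>pairs. p ^ card (un y - S)) \<le> (\<mu> + l r) * l (Suc r)"
proof -
  have "(\<Sum>y\<in>pairs. p ^ card (un y - S)) = (\<Sum>i\<in>M. \<Sum>j\<in>{j \<in> M. j \<inter> i \<noteq> {}}. p ^ card (un (i, j) - S))"
    by (rule sum_pairs)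
  also have "\<dots> \<le> (\<Sum>i\<in>M. p ^ card (i - S) * l (Suc r))"
    using second_of_pair_le[OF assms] by (intro sum_mono) auto
  also have "\<dots> = (\<Sum>i\<in>M. p ^ card (i - S)) * l (Suc r)" by (simp add: sum_distrib_right)
  also have "\<dots> \<le> (\<mu> + l r) * l (Suc r)"
  proof (intro mult_right_mono l_nonneg)
    have "(\<Sum>i\<in>M. p ^ card (i - S)) \<le> (\<Sum>i\<in>M. p ^ e + of_bool (i \<inter> S \<noteq> {}) * p ^ card (i - S))"
    proof (intro sum_mono)
      fix i assume i: "i \<in> M"
      show "p ^ card (i - S) \<le> p ^ e + of_bool (i \<inter> S \<noteq> {}) * p ^ card (i - S)"
      proof (cases "i \<inter> S = {}")
        case True
        then have "i - S = i" by auto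
        then show ?thesis using card_M[OF i] True by simp
      qed (use p_pos in simp)
    qed
    also have "\<dots> = \<mu> + (\<Sum>i\<in>M. of_bool (i \<inter> S \<noteq> {}) * p ^ card (i - S))"
      by (simp add: sum.distrib \<mu>_def)
    also have "(\<Sum>i\<in>M. of_bool (i \<inter> S \<noteq> {}) * p ^ card (i - S)) = (\<Sum>i\<in>{i \<in> M. i \<inter> S \<noteq> {}}. p ^ card (i - S))"
      by (rule sum.mono_neutral_cong_right) auto
    finally show "(\<Sum>i\<in>M. p ^ card (i - S)) \<le> \<mu> + l r" using chain[OF assms] by simp
  qed
  finally show ?thesis .
qed

lemma C4_le: "C4 \<le> 2 * \<mu> * l 1 * l 2 * l 3"
proof -
  have "C4 = (\<Sum>x\<in>pairs. p ^ card (un x) * (\<Sum>y\<in>pairs. of_bool (un x \<inter> un y \<noteq> {}) * p ^ card (un y - un x)))"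
    unfolding C4_def sum_distrib_left using pairs_memD
    by (intro sum.cong refl) (simp add: power_card_Un)
  also have "\<dots> \<le> (\<Sum>x\<in>pairs. p ^ card (un x) * (2 * l 2 * l 3))"
    using pairs_memD p_pos pairs_touching_le[of _ 2] by (intro sum_mono mult_left_mono) (auto simp: eval_nat_numeral)
  also have "\<dots> = (\<Sum>x\<in>pairs. p ^ card (un x)) * (2 * l 2 * l 3)" by (simp add: sum_distrib_right)
  also have "\<dots> \<le> \<mu> * l 1 * (2 * l 2 * l 3)"
    using l_nonneg by (intro mult_right_mono sum_pairs_le) auto
  finally show ?thesis by (simp add: mult_ac)
qed

text \<open>The chain of \<open>x\<close> and \<open>j\<close> is fixed as a set of at most
  \<open>3 * e\<close> elements and the other chain is summed relative to it. Its first member is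
  free to avoid that set, which produces \<open>\<mu> + l 3\<close>.\<close>

lemma C6_le: "C6 \<le> \<mu> * l 1 * l 2 * (\<mu> + l 3) * l 4 * l 5"
proof -
  let ?T = "\<lambda>x. {j \<in> M. j \<inter> un x \<noteq> {}}"
  have inner: "(\<Sum>y\<in>pairs. \<Sum>k\<in>?T y. p ^ card (S \<union> (un y \<union> k))) \<le> p ^ card S * ((\<mu> + l 3) * l 4 * l 5)"
    if S: "S \<subseteq> E" "card S \<le> 3 * e" for S
  proof -
    have fin: "finite S" using S finite_E finite_subset by blast
    have "(\<Sum>y\<in>pairs. \<Sum>k\<in>?T y. p ^ card (S \<union> (un y \<union> k)))
      = (\<Sum>y\<in>pairs. p ^ card S * (p ^ card (un y - S) * (\<Sum>k\<in>?T y. p ^ card (k - (S \<union> un y)))))"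
      unfolding sum_distrib_left
    proof (intro sum.cong refl)
      fix y k assume y: "y \<in> pairs" and k: "k \<in> ?T y"
      have "p ^ card ((S \<union> un y) \<union> k) = p ^ card S * p ^ card (un y - S) * p ^ card (k - (S \<union> un y))"
        using fin pairs_memD[OF y] k by (simp only: power_card_Un finite_UnI finite_mem_M mem_Collect_eq)
      then show "p ^ card (S \<union> (un y \<union> k)) = p ^ card S * (p ^ card (un y - S) * p ^ card (k - (S \<union> un y)))"
        by (simp add: Un_assoc mult.assoc)
    qed
    also have "\<dots> \<le> (\<Sum>y\<in>pairs. p ^ card S * (p ^ card (un y - S) * l 5))"
    proof (intro sum_mono mult_left_mono)
      fix y assume y: "y \<in> pairs"
      have "(\<Sum>k\<in>?T y. p ^ card (k - (S \<union> un y))) \<le> (\<Sum>k\<in>{k \<in> M. k \<inter> (S \<union> un y) \<noteq> {}}. p ^ card (k - (S \<union> un y)))"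
        using p_pos by (intro sum_mono2) auto
      also have "\<dots> \<le> l 5"
        using S pairs_memD[OF y] card_Un_le[of S "un y"] by (intro chain) auto
      finally show "(\<Sum>k\<in>?T y. p ^ card (k - (S \<union> un y))) \<le> l 5" .
    qed (use p_pos in auto)
    also have "\<dots> = p ^ card S * ((\<Sum>y\<in>pairs. p ^ card (un y - S)) * l 5)"
      by (simp add: sum_distrib_left sum_distrib_right)
    also have "\<dots> \<le> p ^ card S * ((\<mu> + l 3) * l 4 * l 5)"
      using pairs_le[of S 3] S p_pos l_nonneg by (intro mult_left_mono mult_right_mono) (auto simp: eval_nat_numeral)
    finally show ?thesis .
  qed
  have "C6 = (\<Sum>x\<in>pairs. \<Sum>j\<in>?T x. \<Sum>y\<in>pairs. \<Sum>k\<in>?T y. p ^ card ((un x \<union> j) \<union> (un y \<union> k)))"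
    unfolding C6_def by (intro sum.cong refl) (rule sum.swap)
  also have "\<dots> \<le> (\<Sum>x\<in>pairs. \<Sum>j\<in>?T x. p ^ card (un x \<union> j) * ((\<mu> + l 3) * l 4 * l 5))"
  proof (intro sum_mono inner)
    fix x j assume x: "x \<in> pairs" and j: "j \<in> ?T x"
    show "un x \<union> j \<subseteq> E" using pairs_memD[OF x] j M_subset by auto
    show "card (un x \<union> j) \<le> 3 * e"
      using pairs_memD[OF x] j card_M[of j] card_Un_le[of "un x" j] by auto
  qed
  also have "\<dots> = (\<Sum>x\<in>pairs. p ^ card (un x) * (\<Sum>j\<in>?T x. p ^ card (j - un x))) * ((\<mu> + l 3) * l 4 * l 5)"
    unfolding sum_distrib_right sum_distrib_left using pairs_memD
    by (intro sum.cong refl) (auto simp: power_card_Un)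
  also have "\<dots> \<le> (\<Sum>x\<in>pairs. p ^ card (un x) * l 2) * ((\<mu> + l 3) * l 4 * l 5)"
    using l_nonneg p_pos chain[of _ 2] pairs_memD \<mu>_nonneg
    by (intro mult_right_mono sum_mono mult_left_mono) (auto intro!: mult_nonneg_nonneg add_nonneg_nonneg)
  also have "(\<Sum>x\<in>pairs. p ^ card (un x) * l 2) \<le> \<mu> * l 1 * l 2"
    unfolding sum_distrib_right[symmetric] by (intro mult_right_mono sum_pairs_le l_nonneg)
  finally show ?thesis using l_nonneg \<mu>_nonneg by (simp add: mult_ac mult_right_mono)
qed

end

section \<open>Moderate deviations of inclusion counts\<close>

context subset_count
begin

section \<open>Gaussian comparison of the moment generating function and of the tail\<close>

lemma h_has_derivative: "(h has_real_derivative expect (\<lambda>S. W S * exp (\<theta> * W S))) (at \<theta>)"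
proof -
  have "((\<lambda>\<theta>. \<Sum>S\<in>Pow E. p ^ card S * q ^ card (E - S) * exp (\<theta> * W S)) has_real_derivative
     (\<Sum>S\<in>Pow E. p ^ card S * q ^ card (E - S) * (W S * exp (\<theta> * W S)))) (at \<theta>)"
    by (intro DERIV_sum DERIV_cmult) (auto intro!: derivative_eq_intros)
  moreover have "h = (\<lambda>\<theta>. \<Sum>S\<in>Pow E. p ^ card S * q ^ card (E - S) * exp (\<theta> * W S))"
    by (rule ext) (simp only: h_def expect_def)
  ultimately show ?thesis unfolding expect_def by (simp only:)
qed

lemma exp_increment:
  fixes \<theta> :: real
  assumes \<theta>: "0 \<le> \<theta>" and vw: "v \<le> w" and u: "u = v \<or> u = w"
  shows "\<bar>exp (\<theta> * w) - exp (\<theta> * v) - (w - v) * (\<theta> * exp (\<theta> * u))\<bar>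
    \<le> (w - v) * (\<theta> * exp (\<theta> * w) - \<theta> * exp (\<theta> * v))"
proof (cases "v = w")
  case False
  then have "v < w" using vw by simp
  have deriv: "((\<lambda>w. exp (\<theta> * w)) has_real_derivative \<theta> * exp (\<theta> * w)) (at w)" for w
    by (auto intro!: derivative_eq_intros)
  from MVT2[OF \<open>v < w\<close> deriv]
  obtain z where z: "v < z" "z < w" "exp (\<theta> * w) - exp (\<theta> * v) = (w - v) * (\<theta> * exp (\<theta> * z))" by blast
  have mono: "\<theta> * exp (\<theta> * a) \<le> \<theta> * exp (\<theta> * b)" if "a \<le> b" for a b
    using \<theta> that by (intro mult_left_mono exp_mono_mult) auto
  have "\<bar>exp (\<theta> * w) - exp (\<theta> * v) - (w - v) * (\<theta> * exp (\<theta> * u))\<bar> = (w - v) * \<bar>\<theta> * exp (\<theta> * z) - \<theta> * exp (\<theta> * u)\<bar>"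
    unfolding z(3) using vw by (simp add: right_diff_distrib[symmetric] abs_mult)
  also have "\<dots> \<le> (w - v) * (\<theta> * exp (\<theta> * w) - \<theta> * exp (\<theta> * v))"
    using u vw mono[of v z] mono[of z w] z by (intro mult_left_mono) auto
  finally show ?thesis .
qed (use u in auto)

definition remainder :: "real \<Rightarrow> real" where
  "remainder \<theta> = expect (\<lambda>S. \<bar>V S\<bar> * exp (\<theta> * W S)) + expect (\<lambda>S. \<bar>U S\<bar> * exp (\<theta> * W S))"

lemma h_derivative_bound:
  assumes \<theta>: "0 \<le> \<theta>"
  shows "\<bar>expect (\<lambda>S. W S * exp (\<theta> * W S)) - \<theta> * h \<theta>\<bar> \<le> \<theta> * remainder \<theta>"
proof -
  have "\<bar>expect (\<lambda>S. W S * exp (\<theta> * W S)) - expect (\<lambda>S. \<theta> * exp (\<theta> * W S))\<bar>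
    \<le> expect (\<lambda>S. \<bar>V S\<bar> * (\<theta> * exp (\<theta> * W S))) + expect (\<lambda>S. \<bar>U S\<bar> * (\<theta> * exp (\<theta> * W S)))"
    using \<theta>
    by (intro stein_bound[where F = "\<lambda>w. exp (\<theta> * w)" and g = "\<lambda>w. \<theta> * exp (\<theta> * w)"
          and H = "\<lambda>w. \<theta> * exp (\<theta> * w)" and G = "\<lambda>w. \<theta> * exp (\<theta> * w)"] exp_increment) auto
  then show ?thesis
    unfolding h_def remainder_def distrib_left mult.left_commute[of _ \<theta>] expect_cmult .
qed

text \<open>By the definition of \<open>stein_g\<close>,
  \<open>w * stein_F t w - stein_g t w\<close> is the centred test function up to sign. The envelope
  3 e^(tw) reduces the error to the same remainder that controls \<open>h\<close>.\<close>

lemma tail_stein_bound: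
  assumes t: "0 \<le> t"
  shows "\<bar>exp (t\<^sup>2) * expect (\<lambda>S. of_bool (t < W S)) - stein_const t * h t\<bar> \<le> 3 * remainder t"
proof -
  have "\<bar>expect (\<lambda>S. W S * stein_F t (W S)) - expect (\<lambda>S. stein_g t (W S))\<bar>
    \<le> expect (\<lambda>S. \<bar>V S\<bar> * (3 * exp (t * W S))) + expect (\<lambda>S. \<bar>U S\<bar> * (3 * exp (t * W S)))"
  proof (rule stein_bound[where H = "stein_H t" and G = "\<lambda>w. 3 * exp (t * w)"])
    fix w
    show "\<bar>stein_g t w\<bar> \<le> 3 * exp (t * w)"
      using stein_g_le_H[OF t, of w] stein_H_le[OF t, of w] by linarith
    show "\<bar>stein_H t w\<bar> \<le> 3 * exp (t * w)"
      using stein_g_le_H[OF t, of w] stein_H_le[OF t, of w] by linarith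
  qed (rule stein_F_increment[OF t])
  also have "\<dots> = 3 * remainder t"
    unfolding remainder_def distrib_left mult.left_commute[of _ 3] expect_cmult ..
  also have "expect (\<lambda>S. W S * stein_F t (W S)) - expect (\<lambda>S. stein_g t (W S))
    = - (exp (t\<^sup>2) * expect (\<lambda>S. of_bool (t < W S)) - stein_const t * h t)"
    unfolding h_def expect_cmult[symmetric] expect_diff[symmetric]
    by (simp add: stein_g_def expect_diff expect_add of_bool_def)
  finally show ?thesis by simp
qed

text \<open>A Gronwall argument: h' lies between (1 - R) \<theta> h and (1 + R) \<theta> h, so
  \<open>h\<close> divided by the exponential of (1 + R) \<theta>^2 / 2 decreases and by that of (1
  - R) \<theta>^2 / 2 increases, starting from \<open>h 0 = 1\<close>.\<close>

lemma h_bounds: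
  assumes t: "0 \<le> t" and R: "\<And>\<theta>. 0 \<le> \<theta> \<Longrightarrow> \<theta> \<le> t \<Longrightarrow> remainder \<theta> \<le> R * h \<theta>"
  shows "h t * exp (- t\<^sup>2 / 2) \<le> exp (t\<^sup>2 * R / 2)" "exp (- (t\<^sup>2 * R / 2)) \<le> h t * exp (- t\<^sup>2 / 2)"
proof -
  let ?h' = "\<lambda>\<theta>. expect (\<lambda>S. W S * exp (\<theta> * W S))"
  have h0: "h 0 = 1" by (simp add: h_def)
  have deriv: "((\<lambda>\<theta>. h \<theta> * exp (- b * \<theta>\<^sup>2 / 2)) has_real_derivative
      exp (- b * \<theta>\<^sup>2 / 2) * (?h' \<theta> - b * \<theta> * h \<theta>)) (at \<theta>)" for b \<theta>
    by (auto intro!: derivative_eq_intros h_has_derivative simp: algebra_simps)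
  have bound: "\<bar>?h' \<theta> - \<theta> * h \<theta>\<bar> \<le> \<theta> * (R * h \<theta>)" if "0 \<le> \<theta>" "\<theta> \<le> t" for \<theta>
    using h_derivative_bound[OF that(1)] mult_left_mono[OF R[OF that] that(1)] by linarith
  have "h t * exp (- (1 + R) * t\<^sup>2 / 2) \<le> h 0 * exp (- (1 + R) * 0\<^sup>2 / 2)"
  proof (rule DERIV_nonpos_imp_nonincreasing[OF t, of "\<lambda>\<theta>. h \<theta> * exp (- (1 + R) * \<theta>\<^sup>2 / 2)"], rule exI, rule conjI, rule deriv)
    fix \<theta> assume "0 \<le> \<theta>" "\<theta> \<le> t"
    from bound[OF this] have "?h' \<theta> - (1 + R) * \<theta> * h \<theta> \<le> 0" by (simp add: algebra_simps)
    then show "exp (- (1 + R) * \<theta>\<^sup>2 / 2) * (?h' \<theta> - (1 + R) * \<theta> * h \<theta>) \<le> 0"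
      by (intro mult_nonneg_nonpos) auto
  qed
  moreover have "exp (- t\<^sup>2 / 2) = exp (- (1 + R) * t\<^sup>2 / 2) * exp (t\<^sup>2 * R / 2)"
    by (simp add: exp_add[symmetric] field_simps)
  ultimately show "h t * exp (- t\<^sup>2 / 2) \<le> exp (t\<^sup>2 * R / 2)"
    by (simp add: h0 mult.assoc[symmetric] mult_right_mono[where b = 1, simplified])
  have "h 0 * exp (- (1 - R) * 0\<^sup>2 / 2) \<le> h t * exp (- (1 - R) * t\<^sup>2 / 2)"
  proof (rule DERIV_nonneg_imp_nondecreasing[OF t, of "\<lambda>\<theta>. h \<theta> * exp (- (1 - R) * \<theta>\<^sup>2 / 2)"], rule exI, rule conjI, rule deriv)
    fix \<theta> assume "0 \<le> \<theta>" "\<theta> \<le> t"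
    from bound[OF this] have "0 \<le> ?h' \<theta> - (1 - R) * \<theta> * h \<theta>" by (simp add: algebra_simps)
    then show "0 \<le> exp (- (1 - R) * \<theta>\<^sup>2 / 2) * (?h' \<theta> - (1 - R) * \<theta> * h \<theta>)"
      by (intro mult_nonneg_nonneg) auto
  qed
  then have "1 * exp (- (t\<^sup>2 * R / 2)) \<le> h t * exp (- (1 - R) * t\<^sup>2 / 2) * exp (- (t\<^sup>2 * R / 2))"
    using h0 by (intro mult_right_mono) auto
  moreover have "exp (- t\<^sup>2 / 2) = exp (- (1 - R) * t\<^sup>2 / 2) * exp (- (t\<^sup>2 * R / 2))"
    by (simp add: exp_add[symmetric] field_simps)
  ultimately show "exp (- (t\<^sup>2 * R / 2)) \<le> h t * exp (- t\<^sup>2 / 2)" by (simp add: mult.assoc)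
qed

text \<open>The tail is compared with \<open>stein_const t * h t\<close>, and \<open>h t\<close>
  with e^(t^2/2). Dividing by \<open>stein_const t\<close> costs 2.6 (1 + t), which with the 3 of
  \<open>tail_stein_bound\<close> gives 7.8 (1 + t); the second comparison adds t^2 / 2. Both are
  collected in 11 (1 + t^2).\<close>

lemma tail_ratio_bound:
  assumes t: "0 \<le> t" and R0: "0 \<le> R"
    and R: "\<And>\<theta>. 0 \<le> \<theta> \<Longrightarrow> \<theta> \<le> t \<Longrightarrow> remainder \<theta> \<le> R * h \<theta>"
  shows "\<bar>expect (\<lambda>S. of_bool (t < W S)) / (1 - Phi t) - 1\<bar> \<le> 11 * (1 + t\<^sup>2) * R * exp (t\<^sup>2 * R / 2)"
proof -
  define k where "k = stein_const t"
  define Pr where "Pr = expect (\<lambda>S. of_bool (t < W S))"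
  define x where "x = t\<^sup>2 * R / 2"
  have k: "0 < k" and k1: "1 / k \<le> 2.6 * (1 + t)"
    unfolding k_def by (rule stein_const_pos[OF t] inverse_stein_const_le[OF t])+
  have tail: "1 - Phi t = k * exp (- t\<^sup>2 / 2)" by (simp add: one_minus_Phi_stein_const k_def)
  have "\<bar>exp (t\<^sup>2) * Pr - k * h t\<bar> \<le> 3 * (R * h t)"
    using tail_stein_bound[OF t] R[OF t order_refl] by (simp add: Pr_def k_def)
  then have "\<bar>exp (t\<^sup>2) * Pr - k * h t\<bar> * (exp (- t\<^sup>2 / 2) / k) \<le> 3 * (R * h t) * (exp (- t\<^sup>2 / 2) / k)"
    using k by (intro mult_right_mono) auto
  moreover have "\<bar>exp (t\<^sup>2) * Pr - k * h t\<bar> * (exp (- t\<^sup>2 / 2) / k) = \<bar>Pr / (1 - Phi t) - h t * exp (- t\<^sup>2 / 2)\<bar>"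
  proof -
    have e: "exp (t\<^sup>2) * exp (- t\<^sup>2 / 2) = 1 / exp (- t\<^sup>2 / 2)"
    proof -
      have "exp (t\<^sup>2) * exp (- t\<^sup>2 / 2) * exp (- t\<^sup>2 / 2) = 1"
        unfolding exp_add[symmetric] by simp
      then show ?thesis by (simp only: eq_divide_eq_1 nonzero_eq_divide_eq[OF exp_not_eq_zero])
    qed
    have "\<bar>exp (t\<^sup>2) * Pr - k * h t\<bar> * (exp (- t\<^sup>2 / 2) / k) = \<bar>(exp (t\<^sup>2) * Pr - k * h t) * (exp (- t\<^sup>2 / 2) / k)\<bar>"
      using k by (simp add: abs_mult)
    also have "(exp (t\<^sup>2) * Pr - k * h t) * (exp (- t\<^sup>2 / 2) / k) = (exp (t\<^sup>2) * exp (- t\<^sup>2 / 2)) * Pr / k - h t * exp (- t\<^sup>2 / 2)"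
      using k by (simp add: field_simps)
    finally show ?thesis unfolding e tail by (simp add: mult.commute)
  qed
  ultimately have "\<bar>Pr / (1 - Phi t) - h t * exp (- t\<^sup>2 / 2)\<bar> \<le> 3 * R * (1 / k) * (h t * exp (- t\<^sup>2 / 2))"
    by (simp add: mult_ac)
  also have "\<dots> \<le> 3 * R * (2.6 * (1 + t)) * exp x"
    using k1 R0 t h_bounds(1)[OF t R] h_pos[of t] k
    by (intro mult_mono mult_left_mono) (auto simp: x_def)
  also have "\<dots> = 7.8 * (1 + t) * R * exp x" by (simp add: algebra_simps)
  finally have 1: "\<bar>Pr / (1 - Phi t) - h t * exp (- t\<^sup>2 / 2)\<bar> \<le> 7.8 * (1 + t) * R * exp x" .
  have x0: "0 \<le> x" using R0 by (simp add: x_def)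
  have "1 - exp (- x) \<le> x" using exp_ge_add_one_self[of "- x"] by simp
  then have x1: "(1 - exp (- x)) * exp x \<le> x * exp x" by (intro mult_right_mono) auto
  then have x2: "exp x - 1 \<le> x * exp x" by (simp add: left_diff_distrib exp_minus)
  have "x * 1 \<le> x * exp x" using x0 by (intro mult_left_mono) auto
  then have x3: "1 - exp (- x) \<le> x * exp x" using \<open>1 - exp (- x) \<le> x\<close> by simp
  have 2: "\<bar>h t * exp (- t\<^sup>2 / 2) - 1\<bar> \<le> x * exp x"
  proof -
    have "h t * exp (- t\<^sup>2 / 2) \<le> exp x"
      unfolding x_def by (rule h_bounds(1)[OF t R])
    moreover have "exp (- x) \<le> h t * exp (- t\<^sup>2 / 2)"
      unfolding x_def by (rule h_bounds(2)[OF t R])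
    ultimately show ?thesis using x2 x3 by linarith
  qed
  have "\<bar>Pr / (1 - Phi t) - 1\<bar> \<le> 7.8 * (1 + t) * R * exp x + x * exp x"
    using 1 2 by linarith
  also have "\<dots> = (7.8 * (1 + t) + t\<^sup>2 / 2) * (R * exp x)" by (simp add: x_def algebra_simps)
  also have "\<dots> \<le> (11 * (1 + t\<^sup>2)) * (R * exp x)"
  proof (intro mult_right_mono)
    have "0 \<le> (2 * t - 1)\<^sup>2" by simp
    then have "4 * t \<le> 4 * t\<^sup>2 + 1" by (simp add: power2_diff power_mult_distrib)
    moreover have "0 \<le> t\<^sup>2" by simp
    ultimately have "78 * t + 5 * t\<^sup>2 \<le> 32 + 110 * t\<^sup>2" by linarith
    then show "7.8 * (1 + t) + t\<^sup>2 / 2 \<le> 11 * (1 + t\<^sup>2)" by (simp add: field_simps)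
  qed (use R0 in simp)
  finally show ?thesis by (simp add: Pr_def x_def mult_ac)
qed

lemma remainder_le:
  fixes \<theta> t K :: real
  assumes \<theta>: "0 \<le> \<theta>" "\<theta> \<le> t" and K: "0 < K"
    "6 * q * (1 / \<sigma>\<^sup>2)\<^sup>2 * (2 * e * e)\<^sup>2 * C4 \<le> K\<^sup>2" "(q * (1 / \<sigma>\<^sup>2) * (2 * e * e) / \<sigma>)\<^sup>2 * C6 \<le> K\<^sup>2"
  shows "remainder \<theta> \<le> 2 * K * (1 + t) * exp (5 * D * t / \<sigma>) * h \<theta>"
proof -
  interpret U: dominated_form E p q M e \<sigma> D AU cU kU BU "\<lambda>a. (fst (fst a), snd a)" "1 / \<sigma>\<^sup>2" "2 * e * e"
    by (rule dominated_U)
  interpret V: dominated_form E p q M e \<sigma> D AV cV snd BV "\<lambda>b. (fst (fst (fst b)), snd (fst b))" "1 / \<sigma>\<^sup>2" "2 * e * e"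
    by (rule dominated_V)
  have "remainder \<theta> \<le> 2 * (K * (1 + \<theta>) * exp (5 * (\<theta> * D / \<sigma>)) * h \<theta>)"
    using U.tilted_abs_le[OF \<theta>(1), of K] V.tilted_abs_le[OF \<theta>(1), of K] K
    by (simp add: remainder_def V_eq_zf U_def)
  also have "K * (1 + \<theta>) * exp (5 * (\<theta> * D / \<sigma>)) * h \<theta> \<le> K * (1 + t) * exp (5 * D * t / \<sigma>) * h \<theta>"
  proof (intro mult_right_mono mult_mono)
    have "\<theta> * (5 * D) / \<sigma> \<le> t * (5 * D) / \<sigma>"
      using \<theta> \<sigma>_pos by (intro divide_right_mono mult_right_mono) auto
    then show "exp (5 * (\<theta> * D / \<sigma>)) \<le> exp (5 * D * t / \<sigma>)" by (simp add: mult_ac)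
  qed (use \<theta> K h_pos[of \<theta>] in auto)
  finally show ?thesis by simp
qed

theorem moderate_deviation:
  fixes t K :: real
  assumes t: "0 \<le> t" and K: "0 < K"
    "6 * q * (1 / \<sigma>\<^sup>2)\<^sup>2 * (2 * e * e)\<^sup>2 * C4 \<le> K\<^sup>2" "(q * (1 / \<sigma>\<^sup>2) * (2 * e * e) / \<sigma>)\<^sup>2 * C6 \<le> K\<^sup>2"
  defines "R \<equiv> 2 * K * (1 + t) * exp (5 * D * t / \<sigma>)"
  shows "\<bar>expect (\<lambda>S. of_bool (t < W S)) / (1 - Phi t) - 1\<bar> \<le> 11 * (1 + t\<^sup>2) * R * exp (t\<^sup>2 * R / 2)"
  using t K remainder_le[of _ t K, folded R_def] by (intro tail_ratio_bound) (auto simp: R_def)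

end

section \<open>Copies of a graph in the complete graph\<close>

lemma Kn_edges_card: "x \<in> Kn_edges n \<Longrightarrow> card x = 2 \<and> x \<subseteq> {..<n}"
  by (auto simp: Kn_edges_def)

lemma Kn_edgesI: "card x = 2 \<Longrightarrow> x \<subseteq> {..<n} \<Longrightarrow> x \<in> Kn_edges n"
  unfolding Kn_edges_def card_2_iff by blast

lemma finite_Kn_edges [simp]: "finite (Kn_edges n)"
  by (rule finite_subset[of _ "Pow {..<n}"]) (auto dest: Kn_edges_card)

lemma inj_on_image_edges: "inj_on f (\<Union>G) \<Longrightarrow> inj_on ((`) f) G"
  by (rule inj_onI) (auto simp: inj_on_image_eq_iff Sup_upper)

lemma card_injections_le:
  assumes "finite A" "finite B"
  shows "card {g \<in> A \<rightarrow>\<^sub>E B. inj_on g A} \<le> fact (card B)"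
proof -
  let ?I = "{g \<in> A \<rightarrow>\<^sub>E B. inj_on g A}"
  show ?thesis
  proof (cases "card A \<le> card B")
    case True
    obtain as where as: "set as = A" "distinct as" using finite_distinct_list[OF assms(1)] by blast
    have "card ?I \<le> card {xs. length xs = card A \<and> distinct xs \<and> set xs \<subseteq> B}"
    proof (rule card_inj_on_le[of "\<lambda>g. map g as"])
      show "inj_on (\<lambda>g. map g as) ?I"
        using as by (intro inj_onI) (auto intro: PiE_ext)
      show "(\<lambda>g. map g as) ` ?I \<subseteq> {xs. length xs = card A \<and> distinct xs \<and> set xs \<subseteq> B}"
        using as by (auto simp: distinct_map distinct_card)
      show "finite {xs. length xs = card A \<and> distinct xs \<and> set xs \<subseteq> B}"
        by (rule finite_subset[OF _ finite_lists_length_eq[OF assms(2), of "card A"]]) auto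
    qed
    also have "\<dots> = \<Prod>{card B - card A + 1..card B}"
      using True assms by (simp add: card_lists_distinct_length_eq)
    also have "\<dots> \<le> \<Prod>{1..card B}" by (intro dvd_imp_le prod_dvd_prod_subset prod_pos) auto
    also have "\<dots> = fact (card B)" by (simp add: fact_prod)
    finally show ?thesis .
  next
    case False
    have "\<not> inj_on g A" if "g \<in> A \<rightarrow>\<^sub>E B" for g
      using False card_inj_on_le[of g A B] that assms by auto
    then have "?I = {}" by auto
    then show ?thesis by (simp only: card.empty)
  qed
qed

lemma card_injections_ge:
  assumes "finite A" "card A \<le> n"
  shows "(n - card A) ^ card A \<le> card {g \<in> A \<rightarrow>\<^sub>E {..<n}. inj_on g A}"
proof -
  let ?I = "{g \<in> A \<rightarrow>\<^sub>E {..<n}. inj_on g A}"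
  obtain f where f: "bij_betw f A {..<card A}"
    using ex_bij_betw_finite_nat[OF assms(1)] by (auto simp: lessThan_atLeast0)
  then have fA: "f u < card A" if "u \<in> A" for u using that by (auto simp: bij_betw_def)
  let ?L = "{xs. length xs = card A \<and> distinct xs \<and> set xs \<subseteq> {..<n}}"
  have "(n - card A) ^ card A \<le> (\<Prod>i\<in>{n - card A + 1..n}. i)"
  proof -
    have "(n - card A) ^ card A = (\<Prod>i\<in>{n - card A + 1..n}. n - card A)"
      using assms by simp
    also have "\<dots> \<le> (\<Prod>i\<in>{n - card A + 1..n}. i)" by (rule prod_mono) auto
    finally show ?thesis .
  qed
  also have "\<dots> = card ?L" using assms by (simp add: card_lists_distinct_length_eq)
  also have "\<dots> \<le> card ?I"
  proof (rule card_inj_on_le[of "\<lambda>xs. restrict (\<lambda>u. xs ! f u) A"])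
    show "inj_on (\<lambda>xs. restrict (\<lambda>u. xs ! f u) A) ?L"
    proof (rule inj_onI)
      fix xs ys assume xs: "xs \<in> ?L" and ys: "ys \<in> ?L"
        and eq: "restrict (\<lambda>u. xs ! f u) A = restrict (\<lambda>u. ys ! f u) A"
      show "xs = ys"
      proof (rule nth_equalityI)
        fix i assume "i < length xs"
        then have "i \<in> f ` A" using f xs by (auto simp: bij_betw_def)
        then obtain u where "u \<in> A" "i = f u" by blast
        then show "xs ! i = ys ! i" using fun_cong[OF eq, of u] by simp
      qed (use xs ys in simp)
    qed
    show "(\<lambda>xs. restrict (\<lambda>u. xs ! f u) A) ` ?L \<subseteq> ?I"
    proof (clarify, intro conjI)
      fix xs :: "nat list" assume xs: "length xs = card A" "distinct xs" "set xs \<subseteq> {..<n}"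
      have "xs ! f u < n" if "u \<in> A" for u
        using xs fA[OF that] nth_mem[of "f u" xs] by (auto simp del: nth_mem)
      then show "restrict (\<lambda>u. xs ! f u) A \<in> A \<rightarrow>\<^sub>E {..<n}" by auto
      show "inj_on (restrict (\<lambda>u. xs ! f u) A) A"
      proof (rule inj_onI)
        fix u v assume uv: "u \<in> A" "v \<in> A" "restrict (\<lambda>u. xs ! f u) A u = restrict (\<lambda>u. xs ! f u) A v"
        then have "f u = f v" using xs fA by (simp add: nth_eq_iff_index_eq)
        then show "u = v" using f uv by (auto simp: bij_betw_def inj_on_def)
      qed
    qed
    show "finite ?I"
      using assms by (intro finite_subset[OF _ finite_PiE[of A "\<lambda>_. {..<n}"]]) auto
  qed
  finally show ?thesis .
qed

section \<open>Copies as images of injections, and their symmetry\<close>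

locale pattern =
  fixes V0 :: "'a set" and E0 :: "'a set set" and n :: nat
  assumes simple: "simple_graph V0 E0" and E0_nonempty: "E0 \<noteq> {}"
    and n_large: "4 * (card V0)\<^sup>2 \<le> n"
begin

abbreviation V1 where "V1 \<equiv> \<Union>E0"
abbreviation M where "M \<equiv> copies n V0 E0"

lemma finite_V0: "finite V0" and V1_subset: "V1 \<subseteq> V0" and card_E0: "x \<in> E0 \<Longrightarrow> card x = 2"
  and E0_subset: "x \<in> E0 \<Longrightarrow> x \<subseteq> V1"
  using simple by (auto simp: simple_graph_def)

lemma finite_V1: "finite V1"
  using finite_V0 V1_subset finite_subset by blast

lemma finite_E0: "finite E0"
  using finite_UnionD finite_V1 by blast

definition emb :: "('a \<Rightarrow> nat) set" where
  "emb = {\<phi> \<in> V1 \<rightarrow>\<^sub>E {..<n}. inj_on \<phi> V1}"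

definition img :: "('a \<Rightarrow> nat) \<Rightarrow> nat set set" where "img \<phi> = (`) \<phi> ` E0"

lemma finite_emb: "finite emb"
  unfolding emb_def by (rule finite_subset[OF _ finite_PiE[OF finite_V1, of "\<lambda>_. {..<n}"]]) auto

lemma Union_img: "\<Union>(img \<phi>) = \<phi> ` V1"
  by (auto simp: img_def)

lemma card_img: "\<phi> \<in> emb \<Longrightarrow> card (img \<phi>) = card E0"
  unfolding img_def by (intro card_image inj_on_image_edges) (simp add: emb_def)

lemma img_in_copies:
  assumes "\<phi> \<in> emb"
  shows "img \<phi> \<in> M"
proof -
  have \<phi>: "inj_on \<phi> V1" "\<phi> ` V1 \<subseteq> {..<n}" using assms by (auto simp: emb_def)
  have "img \<phi> \<subseteq> Kn_edges n"
  proof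
    fix y assume "y \<in> img \<phi>"
    then obtain x where x: "x \<in> E0" "y = \<phi> ` x" by (auto simp: img_def)
    have "card (\<phi> ` x) = card x"
      using \<phi>(1) E0_subset[OF x(1)] by (intro card_image) (rule inj_on_subset)
    then show "y \<in> Kn_edges n"
      using x E0_subset[OF x(1)] \<phi>(2) card_E0[OF x(1)] by (intro Kn_edgesI) auto
  qed
  moreover have "graph_iso (\<phi> ` V1) (img \<phi>) V1 E0"
    unfolding graph_iso_def
  proof (intro exI[of _ "inv_into V1 \<phi>"] conjI ballI)
    show "bij_betw (inv_into V1 \<phi>) (\<phi> ` V1) V1"
      using \<phi>(1) by (intro bij_betw_inv_into) (simp add: bij_betw_def)
    fix x y assume "x \<in> \<phi> ` V1" "y \<in> \<phi> ` V1"
    then obtain u v where uv: "u \<in> V1" "v \<in> V1" "x = \<phi> u" "y = \<phi> v" by blast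
    have inv: "inv_into V1 \<phi> x = u" "inv_into V1 \<phi> y = v"
      using uv \<phi>(1) by (simp_all add: inv_into_f_f)
    have "\<phi> ` {u, v} \<in> (`) \<phi> ` E0 \<longleftrightarrow> {u, v} \<in> E0"
    proof
      assume "\<phi> ` {u, v} \<in> (`) \<phi> ` E0"
      then obtain z where z: "z \<in> E0" "\<phi> ` {u, v} = \<phi> ` z" by blast
      have "{u, v} = z"
        using inj_on_image_eq_iff[OF \<phi>(1), of "{u, v}" z] z uv E0_subset[OF z(1)] by auto
      then show "{u, v} \<in> E0" using z by simp
    qed blast
    then show "({x, y} \<in> img \<phi>) = ({inv_into V1 \<phi> x, inv_into V1 \<phi> y} \<in> E0)"
      unfolding inv img_def by (simp add: uv)
  qed
  ultimately show ?thesis by (simp add: copies_def Union_img)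
qed

lemma copies_are_images:
  assumes "G \<in> M"
  shows "\<exists>\<phi>\<in>emb. img \<phi> = G"
proof -
  from assms obtain f where K: "G \<subseteq> Kn_edges n" and f: "bij_betw f (\<Union>G) V1"
    and iff: "\<And>x y. x \<in> \<Union>G \<Longrightarrow> y \<in> \<Union>G \<Longrightarrow> {x, y} \<in> G \<longleftrightarrow> {f x, f y} \<in> E0"
    unfolding copies_def graph_iso_def by blast
  define \<phi> where "\<phi> = restrict (inv_into (\<Union>G) f) V1"
  have bij: "bij_betw (inv_into (\<Union>G) f) V1 (\<Union>G)" by (rule bij_betw_inv_into[OF f])
  have \<phi>: "inj_on \<phi> V1" "\<phi> ` V1 = \<Union>G"
    using bij by (auto simp: \<phi>_def bij_betw_def inj_on_def)
  have "\<Union>G \<subseteq> {..<n}" using K Kn_edges_card by blast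
  then have "\<phi> ` V1 \<subseteq> {..<n}" using \<phi>(2) by simp
  moreover have "\<phi> \<in> extensional V1" by (simp add: \<phi>_def)
  ultimately have "\<phi> \<in> emb" using \<phi>(1) by (auto simp: emb_def PiE_def)
  moreover have f\<phi>: "f (\<phi> u) = u" if "u \<in> V1" for u
    using that f by (simp add: \<phi>_def bij_betw_def f_inv_into_f)
  have "img \<phi> = G"
  proof (intro equalityI subsetI)
    fix y assume "y \<in> img \<phi>"
    then obtain x where x: "x \<in> E0" "y = \<phi> ` x" by (auto simp: img_def)
    then obtain u v where uv: "x = {u, v}" using card_E0[OF x(1)] by (auto simp: card_2_iff)
    then have mem: "u \<in> V1" "v \<in> V1" using E0_subset[OF x(1)] by auto
    then have "\<phi> u \<in> \<Union>G" "\<phi> v \<in> \<Union>G" using \<phi>(2) by blast+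
    from iff[OF this] show "y \<in> G" using x uv f\<phi>[OF mem(1)] f\<phi>[OF mem(2)] by simp
  next
    fix y assume y: "y \<in> G"
    then have "card y = 2" using K Kn_edges_card by blast
    then obtain a b where ab: "y = {a, b}" by (auto simp: card_2_iff)
    then have "a \<in> \<Union>G" "b \<in> \<Union>G" using y by auto
    then obtain u v where uv: "u \<in> V1" "v \<in> V1" "a = \<phi> u" "b = \<phi> v" using \<phi>(2) by (metis imageE)
    have "{f a, f b} \<in> E0" using iff[of a b] y ab by auto
    then have "{u, v} \<in> E0" using f\<phi> uv by simp
    moreover have "\<phi> ` {u, v} = y" using ab uv by simp
    ultimately show "y \<in> img \<phi>" unfolding img_def by blast
  qed
  ultimately show ?thesis by blast
qed

lemma card_copy: "G \<in> M \<Longrightarrow> card G = card E0"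
  using copies_are_images card_img by blast

lemma copies_subset: "G \<in> M \<Longrightarrow> G \<subseteq> Kn_edges n"
  by (simp add: copies_def)

lemma finite_copies [simp]: "finite M"
  by (rule finite_subset[of _ "Pow (Kn_edges n)"]) (auto simp: copies_def)

lemma finite_copy: "G \<in> M \<Longrightarrow> finite G"
  using copies_subset finite_subset by (metis finite_Kn_edges)

text \<open>The complements of the two images have equal size, so the bijection between the images
  extends to all vertices. Vertex permutations thus act transitively on embeddings and on
  copies.\<close>

lemma ex_permutation_extending:
  assumes "\<phi> \<in> emb" "\<psi> \<in> emb"
  shows "\<exists>\<pi>. bij_betw \<pi> {..<n} {..<n} \<and> (\<forall>u\<in>V1. \<pi> (\<phi> u) = \<psi> u)"
proof -
  let ?A = "\<phi> ` V1" and ?B = "\<psi> ` V1"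
  have inj: "inj_on \<phi> V1" "inj_on \<psi> V1" "?A \<subseteq> {..<n}" "?B \<subseteq> {..<n}"
    using assms by (auto simp: emb_def)
  have card: "card ?A = card ?B" using inj by (simp add: card_image)
  have "card ({..<n} - ?A) = card ({..<n} - ?B)"
    using inj card finite_V1 by (simp add: card_Diff_subset)
  then obtain c where c: "bij_betw c ({..<n} - ?A) ({..<n} - ?B)"
    using finite_same_card_bij[of "{..<n} - ?A" "{..<n} - ?B"] by auto
  have d: "bij_betw (\<psi> \<circ> inv_into V1 \<phi>) ?A ?B"
    using inj by (intro bij_betw_trans[of _ _ V1] bij_betw_inv_into) (auto simp: bij_betw_def)
  define \<pi> where "\<pi> x = (if x \<in> ?A then (\<psi> \<circ> inv_into V1 \<phi>) x else c x)" for x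
  have "bij_betw \<pi> (?A \<union> ({..<n} - ?A)) (?B \<union> ({..<n} - ?B))"
  proof (rule bij_betw_combine)
    show "bij_betw \<pi> ?A ?B" using d by (rule bij_betw_cong[THEN iffD1, rotated]) (simp add: \<pi>_def)
    show "bij_betw \<pi> ({..<n} - ?A) ({..<n} - ?B)"
      using c by (rule bij_betw_cong[THEN iffD1, rotated]) (auto simp: \<pi>_def)
  qed auto
  moreover have eq: "?A \<union> ({..<n} - ?A) = {..<n}" "?B \<union> ({..<n} - ?B) = {..<n}" using inj by auto
  ultimately have "bij_betw \<pi> {..<n} {..<n}" by (simp only: eq)
  moreover have "\<pi> (\<phi> u) = \<psi> u" if "u \<in> V1" for u
    using that inj by (simp add: \<pi>_def)
  ultimately show ?thesis by (intro exI[of _ \<pi>]) blast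
qed

lemma permuted_emb:
  assumes \<pi>: "bij_betw \<pi> {..<n} {..<n}" and \<phi>: "\<phi> \<in> emb"
  shows "restrict (\<pi> \<circ> \<phi>) V1 \<in> emb" "img (restrict (\<pi> \<circ> \<phi>) V1) = (`) \<pi> ` img \<phi>"
proof -
  have \<phi>': "inj_on \<phi> V1" "\<phi> ` V1 \<subseteq> {..<n}" using \<phi> by (auto simp: emb_def)
  have "inj_on (\<pi> \<circ> \<phi>) V1"
    using \<pi> \<phi>' by (intro comp_inj_on) (auto simp: bij_betw_def intro: inj_on_subset)
  moreover have "\<pi> (\<phi> u) < n" if "u \<in> V1" for u
    using \<pi> \<phi>' that by (auto simp: bij_betw_def)
  ultimately show "restrict (\<pi> \<circ> \<phi>) V1 \<in> emb" by (auto simp: emb_def inj_on_def)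
  have "restrict (\<pi> \<circ> \<phi>) V1 ` x = \<pi> ` \<phi> ` x" if "x \<in> E0" for x
    using E0_subset[OF that] by (auto simp: image_def)
  then show "img (restrict (\<pi> \<circ> \<phi>) V1) = (`) \<pi> ` img \<phi>"
    by (simp add: img_def image_image cong: image_cong)
qed

lemma ex_permutation_between_copies:
  assumes "G1 \<in> M" "G2 \<in> M"
  shows "\<exists>\<pi>. bij_betw \<pi> {..<n} {..<n} \<and> (`) \<pi> ` G1 = G2"
proof -
  obtain \<phi> \<psi> where \<phi>: "\<phi> \<in> emb" "img \<phi> = G1" and \<psi>: "\<psi> \<in> emb" "img \<psi> = G2"
    using copies_are_images assms by meson
  obtain \<pi> where \<pi>: "bij_betw \<pi> {..<n} {..<n}" "\<And>u. u \<in> V1 \<Longrightarrow> \<pi> (\<phi> u) = \<psi> u"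
    using ex_permutation_extending[OF \<phi>(1) \<psi>(1)] by blast
  have "restrict (\<pi> \<circ> \<phi>) V1 = \<psi>"
    using \<pi>(2) \<psi>(1) by (auto simp: emb_def PiE_def extensional_def restrict_def fun_eq_iff)
  then have "(`) \<pi> ` G1 = G2" using permuted_emb(2)[OF \<pi>(1) \<phi>(1)] \<phi> \<psi> by simp
  then show ?thesis using \<pi>(1) by blast
qed

lemma card_touching_le:
  assumes "G1 \<in> M" "G2 \<in> M"
  shows "card {G' \<in> M. G' \<inter> G1 \<noteq> {}} \<le> card {G' \<in> M. G' \<inter> G2 \<noteq> {}}"
proof -
  obtain \<pi> where \<pi>: "bij_betw \<pi> {..<n} {..<n}" and map: "(`) \<pi> ` G1 = G2"
    using ex_permutation_between_copies[OF assms] by blast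
  show ?thesis
  proof (rule card_inj_on_le[of "(`) ((`) \<pi>)"])
    have "\<Union>(\<Union>M) \<subseteq> {..<n}"
    proof (intro Union_least)
      fix x assume "x \<in> \<Union>M"
      then show "x \<subseteq> {..<n}" using copies_subset Kn_edges_card by (meson UnionE subsetD)
    qed
    then have "inj_on \<pi> (\<Union>(\<Union>M))" using \<pi> inj_on_subset by (auto simp: bij_betw_def)
    then have "inj_on ((`) ((`) \<pi>)) M" by (intro inj_on_image_edges)
    then show "inj_on ((`) ((`) \<pi>)) {G' \<in> M. G' \<inter> G1 \<noteq> {}}" by (rule inj_on_subset) auto
    show "(`) ((`) \<pi>) ` {G' \<in> M. G' \<inter> G1 \<noteq> {}} \<subseteq> {G' \<in> M. G' \<inter> G2 \<noteq> {}}"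
    proof (rule image_subsetI)
      fix G assume "G \<in> {G' \<in> M. G' \<inter> G1 \<noteq> {}}"
      then obtain x where G: "G \<in> M" and x: "x \<in> G" "x \<in> G1" by blast
      obtain \<eta> where \<eta>: "\<eta> \<in> emb" "img \<eta> = G" using copies_are_images[OF G] by blast
      have "(`) \<pi> ` G \<in> M"
        using img_in_copies[OF permuted_emb(1)[OF \<pi> \<eta>(1)]] permuted_emb(2)[OF \<pi> \<eta>(1)] \<eta>(2) by simp
      moreover have "\<pi> ` x \<in> (`) \<pi> ` G" "\<pi> ` x \<in> G2" using x map by auto
      ultimately show "(`) \<pi> ` G \<in> {G' \<in> M. G' \<inter> G2 \<noteq> {}}" by blast
    qed
  qed simp
qed

definition fib :: "nat set set \<Rightarrow> ('a \<Rightarrow> nat) set" where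
  "fib G = {\<phi> \<in> emb. img \<phi> = G}"

text \<open>Used in both directions: all copies have equally many embeddings, and this common number
  cancels in \<open>card_copies_containing_le\<close>.\<close>

lemma card_fib_le:
  assumes "G1 \<in> M" "G2 \<in> M"
  shows "card (fib G1) \<le> card (fib G2)"
proof -
  obtain \<pi> where \<pi>: "bij_betw \<pi> {..<n} {..<n}" and map: "(`) \<pi> ` G1 = G2"
    using ex_permutation_between_copies[OF assms] by blast
  show ?thesis
  proof (rule card_inj_on_le[of "\<lambda>\<eta>. restrict (\<pi> \<circ> \<eta>) V1"])
    show "inj_on (\<lambda>\<eta>. restrict (\<pi> \<circ> \<eta>) V1) (fib G1)"
    proof (rule inj_onI)
      fix \<eta> \<eta>' assume \<eta>: "\<eta> \<in> fib G1" "\<eta>' \<in> fib G1" and eq: "restrict (\<pi> \<circ> \<eta>) V1 = restrict (\<pi> \<circ> \<eta>') V1"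
      have mem: "\<eta> \<in> V1 \<rightarrow>\<^sub>E {..<n}" "\<eta>' \<in> V1 \<rightarrow>\<^sub>E {..<n}" using \<eta> by (auto simp: fib_def emb_def)
      show "\<eta> = \<eta>'"
      proof (rule PiE_ext[OF mem])
        fix u assume u: "u \<in> V1"
        then have "\<pi> (\<eta> u) = \<pi> (\<eta>' u)" using fun_cong[OF eq, of u] by simp
        moreover have "\<eta> u \<in> {..<n}" "\<eta>' u \<in> {..<n}" using mem u by blast+
        ultimately show "\<eta> u = \<eta>' u" using \<pi> by (auto simp: bij_betw_def inj_on_def)
      qed
    qed
    show "(\<lambda>\<eta>. restrict (\<pi> \<circ> \<eta>) V1) ` fib G1 \<subseteq> fib G2"
      using permuted_emb[OF \<pi>] map by (auto simp: fib_def)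
    show "finite (fib G2)" using finite_emb by (simp add: fib_def)
  qed
qed

section \<open>Numbers of embeddings and of copies through a given edge set\<close>

lemma n_V1: "4 * (card V1)\<^sup>2 \<le> n"
proof -
  have "(card V1)\<^sup>2 \<le> (card V0)\<^sup>2" using V1_subset finite_V0 by (intro power_mono card_mono) auto
  then show ?thesis using n_large by linarith
qed

lemma V1_card_pos: "0 < card V1"
proof -
  obtain x where "x \<in> E0" using E0_nonempty by blast
  then have "x \<noteq> {}" "x \<subseteq> V1" using card_E0[of x] by auto
  then show ?thesis using finite_V1 by (auto simp: card_gt_0_iff)
qed

lemma card_V1_le_n: "card V1 \<le> n"
proof -
  have "card V1 \<le> card V1 * card V1" using V1_card_pos by simp
  also have "\<dots> \<le> n" using n_V1 by (simp add: power2_eq_square)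
  finally show ?thesis .
qed

lemma n_pos: "0 < n"
  using card_V1_le_n V1_card_pos by linarith

text \<open>With v = \<open>card V1\<close>, Bernoulli's inequality gives (1 - v/n)^v >= 1 - v^2/n
  >= 3/4; this is where the lower bound on \<open>n\<close> enters.\<close>

lemma card_emb_ge: "3 / 4 * real n ^ card V1 \<le> card emb"
proof -
  let ?v = "card V1"
  have n: "real n > 0" using n_pos by simp
  have "real (4 * ?v\<^sup>2) \<le> real n" using n_V1 by (rule of_nat_mono)
  then have "real ?v * real ?v \<le> n / 4" by (simp add: power2_eq_square)
  then have "real ?v * (?v / n) \<le> 1 / 4" using n by (simp add: field_simps)
  then have "3 / 4 \<le> 1 + real ?v * (- (?v / n))" by simp
  also have "\<dots> \<le> (1 + - (?v / n)) ^ ?v"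
    using card_V1_le_n n by (intro Bernoulli_inequality) simp
  finally have "3 / 4 * real n ^ ?v \<le> (1 - ?v / n) ^ ?v * real n ^ ?v"
    by (intro mult_right_mono) auto
  also have "\<dots> = (real (n - ?v)) ^ ?v"
    using n card_V1_le_n by (simp add: power_mult_distrib[symmetric] left_diff_distrib of_nat_diff)
  also have "\<dots> = real ((n - ?v) ^ ?v)" by simp
  also have "\<dots> \<le> card emb"
    unfolding emb_def by (rule of_nat_mono[OF card_injections_ge[OF finite_V1 card_V1_le_n]])
  finally show ?thesis .
qed

lemma copies_nonempty: "M \<noteq> {}"
proof -
  have "0 < real (card emb)" using card_emb_ge n_pos by (intro less_le_trans[OF _ card_emb_ge]) simp
  then obtain \<phi> where "\<phi> \<in> emb" by (auto simp: card_gt_0_iff)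
  then show ?thesis using img_in_copies by blast
qed

lemma D_copies_eq:
  assumes "G \<in> M"
  shows "card {G' \<in> M. G' \<inter> G \<noteq> {}} = D_copies n V0 E0"
proof -
  have "(SOME G. G \<in> M) \<in> M" using copies_nonempty some_in_eq by blast
  then show ?thesis
    unfolding D_copies_def Let_def using card_touching_le assms by (intro antisym) auto
qed

text \<open>An embedding whose image contains \<open>F\<close> is encoded by its inverse on the
  vertices of \<open>F\<close>, an injection into \<open>V1\<close> with at most v! choices, and its
  values on the remaining vertices of \<open>V1\<close>.\<close>

lemma card_emb_containing_le:
  assumes "finite F"
  shows "real (card {\<phi> \<in> emb. F \<subseteq> img \<phi>}) * real n ^ card (\<Union>F) \<le> fact (card V1) * real n ^ card V1"
proof (cases "{\<phi> \<in> emb. F \<subseteq> img \<phi>} = {}")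
  case False
  let ?A = "\<Union>F" and ?J = "{\<phi> \<in> emb. F \<subseteq> img \<phi>}"
  have A: "?A \<subseteq> \<phi> ` V1" if "\<phi> \<in> ?J" for \<phi>
  proof -
    have "F \<subseteq> img \<phi>" using that by simp
    then have "?A \<subseteq> \<Union>(img \<phi>)" by (rule Union_mono)
    then show ?thesis by (simp only: Union_img)
  qed
  obtain \<phi>0 where \<phi>0: "\<phi>0 \<in> ?J" using False by blast
  have finA: "finite ?A" using finite_subset[OF A[OF \<phi>0]] finite_V1 by blast
  let ?G = "{g \<in> ?A \<rightarrow>\<^sub>E V1. inj_on g ?A}"
  let ?g = "\<lambda>\<phi>. restrict (inv_into V1 \<phi>) ?A"
  let ?T = "SIGMA g:?G. (V1 - g ` ?A) \<rightarrow>\<^sub>E {..<n}"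
  let ?m = "\<lambda>\<phi>. (?g \<phi>, restrict \<phi> (V1 - ?g \<phi> ` ?A))"
  have g: "?g \<phi> \<in> ?G" if "\<phi> \<in> ?J" for \<phi>
  proof -
    have "inj_on (inv_into V1 \<phi>) ?A" by (rule inj_on_inv_into[OF A[OF that]])
    moreover have "inv_into V1 \<phi> a \<in> V1" if "a \<in> ?A" for a
      using A[OF \<open>\<phi> \<in> ?J\<close>] that by (intro inv_into_into) blast
    ultimately show ?thesis by (simp only: mem_Collect_eq restrict_PiE_iff inj_on_restrict_eq) blast
  qed
  have g_inverse: "\<phi> (?g \<phi> a) = a" if "\<phi> \<in> ?J" "a \<in> ?A" for \<phi> a
  proof -
    have "a \<in> \<phi> ` V1" using A[OF that(1)] that(2) by blast
    then show ?thesis by (simp only: restrict_apply'[OF that(2)] f_inv_into_f)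
  qed
  have "card ?J \<le> card ?T"
  proof (rule card_inj_on_le[of "?m"])
    show "inj_on (?m) ?J"
    proof (rule inj_onI)
      fix \<phi> \<psi> assume \<phi>: "\<phi> \<in> ?J" and \<psi>: "\<psi> \<in> ?J"
        and eq: "?m \<phi> = ?m \<psi>"
      from eq have eq1: "?g \<phi> = ?g \<psi>" by (rule Pair_inject)
      from eq have "restrict \<phi> (V1 - ?g \<phi> ` ?A) = restrict \<psi> (V1 - ?g \<psi> ` ?A)" by (rule Pair_inject)
      then have eq2: "restrict \<phi> (V1 - ?g \<phi> ` ?A) = restrict \<psi> (V1 - ?g \<phi> ` ?A)" by (simp only: eq1)
      have mem: "\<phi> \<in> V1 \<rightarrow>\<^sub>E {..<n}" "\<psi> \<in> V1 \<rightarrow>\<^sub>E {..<n}" using \<phi> \<psi> by (auto simp: emb_def)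
      show "\<phi> = \<psi>"
      proof (rule PiE_ext[OF mem])
        fix u assume u: "u \<in> V1"
        show "\<phi> u = \<psi> u"
        proof (cases "u \<in> ?g \<phi> ` ?A")
          case True
          then obtain a where a: "a \<in> ?A" "u = ?g \<phi> a" by blast
          have "\<phi> u = a" using g_inverse[OF \<phi> a(1)] a(2) by (simp only:)
          moreover have "\<psi> u = a" using g_inverse[OF \<psi> a(1)] a(2) by (simp only: eq1)
          ultimately show ?thesis by simp
        next
          case False
          then show ?thesis using fun_cong[OF eq2, of u] u by simp
        qed
      qed
    qed
    show "(?m) ` ?J \<subseteq> ?T"
    proof (rule image_subsetI)
      fix \<phi> assume \<phi>: "\<phi> \<in> ?J"
      have "\<phi> u \<in> {..<n}" if "u \<in> V1" for u using \<phi> that by (auto simp: emb_def simp del: Union_iff)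
      then have "restrict \<phi> (V1 - ?g \<phi> ` ?A) \<in> (V1 - ?g \<phi> ` ?A) \<rightarrow>\<^sub>E {..<n}"
        by (simp only: restrict_PiE_iff) blast
      with g[OF \<phi>] show "?m \<phi> \<in> ?T"
        by (intro iffD2[OF mem_Sigma_iff] conjI)
    qed
    show "finite ?T"
      using finA finite_V1 by (intro finite_SigmaI finite_PiE finite_subset[OF _ finite_PiE[of ?A "\<lambda>_. V1"]]) auto
  qed
  also have "\<dots> = (\<Sum>g\<in>?G. card ((V1 - g ` ?A) \<rightarrow>\<^sub>E {..<n}))"
    using finA finite_V1 by (intro card_SigmaI ballI finite_PiE finite_subset[OF _ finite_PiE[of ?A "\<lambda>_. V1"]]) auto
  also have "\<dots> = (\<Sum>g\<in>?G. n ^ (card V1 - card ?A))"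
  proof (intro sum.cong refl)
    fix g assume g: "g \<in> ?G"
    then have "card (V1 - g ` ?A) = card V1 - card ?A"
      using finA by (subst card_Diff_subset) (auto simp: card_image)
    then show "card ((V1 - g ` ?A) \<rightarrow>\<^sub>E {..<n}) = n ^ (card V1 - card ?A)"
      using finite_V1 by (simp add: card_PiE)
  qed
  also have "\<dots> = card ?G * n ^ (card V1 - card ?A)" by simp
  also have "\<dots> \<le> fact (card V1) * n ^ (card V1 - card ?A)"
    by (intro mult_right_mono card_injections_le finA finite_V1) simp
  finally have "card ?J * n ^ card ?A \<le> fact (card V1) * n ^ (card V1 - card ?A) * n ^ card ?A"
    by (rule mult_right_mono) simp
  also have "\<dots> = fact (card V1) * n ^ card V1"
  proof -
    have "card ?A \<le> card (\<phi>0 ` V1)" by (rule card_mono[OF finite_imageI[OF finite_V1] A[OF \<phi>0]])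
    also have "\<dots> \<le> card V1" by (rule card_image_le[OF finite_V1])
    finally have "card ?A \<le> card V1" .
    then show ?thesis by (simp add: power_add[symmetric])
  qed
  finally have "real (card ?J * n ^ card ?A) \<le> real (fact (card V1) * n ^ card V1)" by (rule of_nat_mono)
  then show ?thesis by simp
next
  case True
  then show ?thesis by (simp only: card.empty) simp
qed

text \<open>Because all fibres have equal size, the proportion of copies containing \<open>F\<close>
  equals the proportion of such embeddings; 4/3 is the inverse of the 3/4 in
  \<open>card_emb_ge\<close>.\<close>

lemma card_copies_containing_le:
  assumes "finite F"
  shows "real (card {G \<in> M. F \<subseteq> G}) * real n ^ card (\<Union>F) \<le> 4 / 3 * fact (card V1) * card M"
proof -
  obtain G0 where G0: "G0 \<in> M" using copies_nonempty by blast
  define a where "a = card (fib G0)"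
  have a: "card (fib G) = a" if "G \<in> M" for G
    unfolding a_def using card_fib_le that G0 by (intro antisym) auto
  have count: "card {\<phi> \<in> emb. img \<phi> \<in> N} = a * card N" if N: "N \<subseteq> M" for N
  proof -
    have "{\<phi> \<in> emb. img \<phi> \<in> N} = (\<Union>G\<in>N. fib G)" by (auto simp: fib_def)
    also have "card \<dots> = (\<Sum>G\<in>N. card (fib G))"
      using N finite_subset[OF N] finite_emb by (intro card_UN_disjoint) (auto simp: fib_def)
    also have "\<dots> = (\<Sum>G\<in>N. a)" using N a by (intro sum.cong) auto
    finally show ?thesis by simp
  qed
  have "{\<phi> \<in> emb. img \<phi> \<in> M} = emb" using img_in_copies by auto
  then have all: "real (card emb) = a * card M" using count[of M] by simp
  have some: "real (card {\<phi> \<in> emb. F \<subseteq> img \<phi>}) = a * card {G \<in> M. F \<subseteq> G}"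
  proof -
    have "{\<phi> \<in> emb. F \<subseteq> img \<phi>} = {\<phi> \<in> emb. img \<phi> \<in> {G \<in> M. F \<subseteq> G}}" using img_in_copies by auto
    then show ?thesis using count[of "{G \<in> M. F \<subseteq> G}"] by simp
  qed
  have apos: "0 < real a"
  proof -
    have "0 < real (card emb)" using n_pos by (intro less_le_trans[OF _ card_emb_ge]) simp
    then show ?thesis using all by (cases "a = 0") auto
  qed
  have "real a * (real (card {G \<in> M. F \<subseteq> G}) * real n ^ card (\<Union>F)) \<le> fact (card V1) * real n ^ card V1"
    using card_emb_containing_le[OF assms] by (simp add: some mult.assoc)
  also have "\<dots> \<le> fact (card V1) * (4 / 3 * (real a * card M))"
    using card_emb_ge by (intro mult_left_mono) (simp_all add: all)
  finally have "real a * (real (card {G \<in> M. F \<subseteq> G}) * real n ^ card (\<Union>F)) \<le> real a * (4 / 3 * fact (card V1) * card M)"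
    by (simp add: mult_ac)
  then show ?thesis using apos by simp
qed

lemma aut_le: "aut V0 E0 \<le> fact (card V0)"
proof -
  have "aut V0 E0 \<le> card {f. f permutes V0}"
    unfolding aut_def
  proof (rule card_mono[OF finite_permutations[OF finite_V0]])
    show "{f. bij_betw f V0 V0 \<and> (\<forall>x. x \<notin> V0 \<longrightarrow> f x = x) \<and> (\<forall>x\<in>V0. \<forall>y\<in>V0. ({x, y} \<in> E0) = ({f x, f y} \<in> E0))}
      \<subseteq> {f. f permutes V0}"
      by (auto intro: bij_imp_permutes)
  qed
  then show ?thesis by (simp add: card_permutations[OF refl finite_V0])
qed

lemma aut_pos: "0 < aut V0 E0"
proof -
  let ?A = "{f. bij_betw f V0 V0 \<and> (\<forall>x. x \<notin> V0 \<longrightarrow> f x = x) \<and> (\<forall>x\<in>V0. \<forall>y\<in>V0. ({x, y} \<in> E0) = ({f x, f y} \<in> E0))}"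
  have "?A \<subseteq> {f. f permutes V0}" by (auto intro: bij_imp_permutes)
  then have "finite ?A" using finite_permutations[OF finite_V0] finite_subset by blast
  moreover have "(\<lambda>x. x) \<in> ?A" by (auto simp: bij_betw_def)
  ultimately show ?thesis unfolding aut_def by (metis (no_types, lifting) card_gt_0_iff empty_iff)
qed

end

section \<open>Variance and overlaps of copies\<close>

context bernoulli_subset
begin

lemma expect_centered_square:
  assumes M: "M \<subseteq> Pow E" "\<And>i. i \<in> M \<Longrightarrow> card i = e"
  shows "expect (\<lambda>S. ((\<Sum>i\<in>M. incl i S) - card M * p ^ e)\<^sup>2) = (\<Sum>i\<in>M. \<Sum>j\<in>M. p ^ card (i \<union> j) - p ^ (2 * e))"
proof -
  define m where "m = card M * p ^ e"
  have mean: "expect (\<lambda>S. \<Sum>i\<in>M. incl i S) = m"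
  proof -
    have "(\<Sum>i\<in>M. expect (incl i)) = (\<Sum>i\<in>M. p ^ e)" using M by (intro sum.cong) (auto simp: expect_incl)
    then show ?thesis by (simp add: expect_sum m_def)
  qed
  have "((\<Sum>i\<in>M. incl i S) - m)\<^sup>2 = (\<Sum>i\<in>M. \<Sum>j\<in>M. incl (i \<union> j) S) - 2 * m * (\<Sum>i\<in>M. incl i S) + m\<^sup>2" for S
    unfolding power2_diff by (simp add: power2_eq_square sum_product incl_Un)
  then have "expect (\<lambda>S. ((\<Sum>i\<in>M. incl i S) - m)\<^sup>2)
    = expect (\<lambda>S. \<Sum>i\<in>M. \<Sum>j\<in>M. incl (i \<union> j) S) - 2 * m * m + m\<^sup>2"
    by (simp only: expect_add expect_diff expect_cmult mean expect_const)
  also have "expect (\<lambda>S. \<Sum>i\<in>M. \<Sum>j\<in>M. incl (i \<union> j) S) = (\<Sum>i\<in>M. \<Sum>j\<in>M. p ^ card (i \<union> j))"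
    unfolding expect_sum using M by (intro sum.cong refl expect_incl) auto
  moreover have "(\<Sum>i\<in>M. \<Sum>j\<in>M. p ^ (2 * e)) = m * m"
  proof -
    have "p ^ (2 * e) = p ^ e * p ^ e" unfolding mult_2 power_add ..
    then show ?thesis by (simp add: m_def)
  qed
  ultimately show ?thesis
    unfolding m_def[symmetric] sum_subtractf by (simp add: power2_eq_square)
qed

text \<open>Only the pairs sharing the same subset \<open>F i\<close> are kept; Cauchy-Schwarz bounds their number below.\<close>

lemma variance_lower_bound:
  assumes M: "M \<subseteq> Pow E" "\<And>i. i \<in> M \<Longrightarrow> card i = e"
    and F: "\<And>i. i \<in> M \<Longrightarrow> F i \<subseteq> i \<and> card (F i) = k" and k: "0 < k"
  shows "q * (card M * p ^ e)\<^sup>2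
    \<le> expect (\<lambda>S. ((\<Sum>i\<in>M. incl i S) - card M * p ^ e)\<^sup>2) * (card (F ` M) * p ^ k)"
proof (cases "M = {}")
  case False
  have finM: "finite M" using M finite_E finite_subset by blast
  have fin: "finite i" if "i \<in> M" for i using M that finite_E finite_subset by blast
  have ke: "k \<le> e"
  proof -
    obtain i where "i \<in> M" using False by blast
    then show ?thesis using F[of i] M(2)[of i] card_mono[OF fin, of i "F i"] by auto
  qed
  define N where "N f = card {i \<in> M. F i = f}" for f
  have summand: "of_bool (F j = F i) * (q * p ^ (2 * e - k)) \<le> p ^ card (i \<union> j) - p ^ (2 * e)"
    if i: "i \<in> M" and j: "j \<in> M" for i j
  proof (cases "F j = F i")
    case True
    have "k \<le> card (i \<inter> j)"
      using F[OF i] F[OF j] True fin[OF i] card_mono[of "i \<inter> j" "F i"] by auto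
    moreover have "card (i \<union> j) + card (i \<inter> j) = 2 * e"
      using card_Un_Int[OF fin[OF i] fin[OF j]] M(2) i j by simp
    ultimately have "p ^ (2 * e - k) \<le> p ^ card (i \<union> j)" by (intro p_power_antimono) simp
    \<comment> \<open>Since \<open>k\<close> is positive, at least one factor \<open>p\<close>
      separates the two powers; their difference keeps \<open>1 - p\<close>, the factor
      \<open>q\<close> of the variance bound.\<close>
    moreover have "p ^ (2 * e) \<le> p ^ (2 * e - k) * p"
    proof -
      have "p ^ (2 * e) \<le> p ^ Suc (2 * e - k)" using k ke by (intro p_power_antimono) simp
      then show ?thesis by (simp add: mult.commute)
    qed
    moreover have "p ^ (2 * e - k) * p + q * p ^ (2 * e - k) = p ^ (2 * e - k)"
      using p_plus_q by (metis distrib_right mult.commute mult_1)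
    ultimately show ?thesis using True by simp
  next
    case False
    have "card (i \<union> j) \<le> 2 * e" using card_Un_le[of i j] M(2) i j by simp
    then show ?thesis using False p_power_antimono by simp
  qed
  have "(real (card M))\<^sup>2 = (\<Sum>f\<in>F ` M. 1 * real (N f))\<^sup>2"
  proof -
    have "(\<Sum>i\<in>M. 1 :: real) = (\<Sum>f\<in>F ` M. of_nat (card {i \<in> M. F i = f}) * 1)"
      using finM by (intro sum_fun_comp) auto
    then show ?thesis by (simp add: N_def)
  qed
  also have "\<dots> \<le> (\<Sum>f\<in>F ` M. 1\<^sup>2) * (\<Sum>f\<in>F ` M. (real (N f))\<^sup>2)" by (rule Cauchy_Schwarz_ineq_sum)
  also have "(\<Sum>f\<in>F ` M. (real (N f))\<^sup>2) = (\<Sum>i\<in>M. \<Sum>j\<in>M. of_bool (F j = F i))"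
  proof -
    have "(\<Sum>i\<in>M. real (N (F i))) = (\<Sum>f\<in>F ` M. of_nat (card {i \<in> M. F i = f}) * real (N f))"
      using finM by (intro sum_fun_comp) auto
    moreover have "real (N (F i)) = (\<Sum>j\<in>M. of_bool (F j = F i))" for i
      using finM by (simp add: N_def of_bool_def sum.If_cases Int_def)
    ultimately show ?thesis by (simp add: N_def power2_eq_square)
  qed
  finally have count: "(real (card M))\<^sup>2 \<le> real (card (F ` M)) * (\<Sum>i\<in>M. \<Sum>j\<in>M. of_bool (F j = F i))" by simp
  have "q * (card M * p ^ e)\<^sup>2 = (real (card M))\<^sup>2 * (q * p ^ (2 * e - k) * p ^ k)"
    using ke by (simp add: power_mult_distrib power_mult[symmetric] power_add[symmetric] mult_ac)
  also have "\<dots> \<le> (real (card (F ` M)) * (\<Sum>i\<in>M. \<Sum>j\<in>M. of_bool (F j = F i))) * (q * p ^ (2 * e - k) * p ^ k)"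
    using p_pos q_pos by (intro mult_right_mono count) auto
  also have "\<dots> = (\<Sum>i\<in>M. \<Sum>j\<in>M. of_bool (F j = F i) * (q * p ^ (2 * e - k))) * (card (F ` M) * p ^ k)"
    unfolding sum_distrib_right[symmetric] by (simp only: mult_ac)
  also have "\<dots> \<le> (\<Sum>i\<in>M. \<Sum>j\<in>M. p ^ card (i \<union> j) - p ^ (2 * e)) * (card (F ` M) * p ^ k)"
    using p_pos by (intro mult_right_mono sum_mono summand) auto
  finally show ?thesis by (simp only: expect_centered_square[OF M])
qed simp

end

text \<open>The default \<open>False\<close> of \<open>Pi_pmf\<close> makes every sampled function
  the indicator of a subset of \<open>Kn_edges n\<close>.\<close>

lemma Gnp_expectation:
  assumes "0 < p" "p < 1"
  shows "measure_pmf.expectation (Gnp n p) f = bernoulli_subset.expect (Kn_edges n) p (1 - p) (\<lambda>S. f (\<lambda>x. x \<in> S))"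
proof -
  let ?E = "Kn_edges n"
  interpret bernoulli_subset ?E p "1 - p" using assms by unfold_locales auto
  let ?c = "\<lambda>S x. x \<in> (S :: nat set set)"
  have "measure_pmf.expectation (Gnp n p) f = (\<Sum>a\<in>?c ` Pow ?E. f a * pmf (Gnp n p) a)"
  proof (rule integral_measure_pmf_real)
    fix a assume "a \<in> set_pmf (Gnp n p)"
    then have "a x = False" if "x \<notin> ?E" for x
      using set_Pi_pmf_subset[OF finite_Kn_edges, of n False "\<lambda>_. bernoulli_pmf p"] that unfolding Gnp_def by blast
    then have "a = ?c {x. a x}" "{x. a x} \<in> Pow ?E" by auto
    then show "a \<in> ?c ` Pow ?E" by blast
  qed simp
  also have "\<dots> = (\<Sum>S\<in>Pow ?E. f (?c S) * pmf (Gnp n p) (?c S))"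
    by (rule sum.reindex_cong[of ?c]) (auto simp: inj_on_def fun_eq_iff)
  also have "\<dots> = expect (\<lambda>S. f (?c S))"
    unfolding expect_def
  proof (intro sum.cong refl)
    fix S assume S: "S \<in> Pow ?E"
    have "pmf (Gnp n p) (?c S) = (\<Prod>x\<in>?E. pmf (bernoulli_pmf p) (x \<in> S))"
      unfolding Gnp_def using S by (subst pmf_Pi') auto
    also have "\<dots> = (\<Prod>x\<in>?E. if x \<in> S then p else 1 - p)" using assms by (intro prod.cong) auto
    also have "\<dots> = p ^ card (?E \<inter> S) * (1 - p) ^ card (?E \<inter> - S)" by (simp add: prod.If_cases)
    also have "?E \<inter> S = S" using S by auto
    also have "?E \<inter> - S = ?E - S" by auto
    finally show "f (?c S) * pmf (Gnp n p) (?c S) = p ^ card S * (1 - p) ^ card (?E - S) * f (?c S)" by simp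
  qed
  finally show ?thesis .
qed

locale random_pattern = pattern V0 E0 n for V0 :: "'a set" and E0 n +
  fixes p :: real
  assumes p: "0 < p" "p < 1"
begin

abbreviation q where "q \<equiv> 1 - p"
abbreviation \<Psi> where "\<Psi> \<equiv> Psi_min n p V0 E0"
abbreviation \<sigma> where "\<sigma> \<equiv> sigma_copies n p V0 E0"
abbreviation e where "e \<equiv> card E0"

sublocale B: bernoulli_subset "Kn_edges n" p q
  using p by unfold_locales auto

lemma e_pos: "0 < e"
  using E0_nonempty finite_E0 by (simp add: card_gt_0_iff)

section \<open>The minimal subgraph count and the variance of the number of copies\<close>

definition Psi_set :: "real set" where
  "Psi_set = {real n ^ card VH * p ^ card EH | VH EH.
      VH \<subseteq> V0 \<and> EH \<subseteq> E0 \<and> (\<forall>e\<in>EH. e \<subseteq> VH) \<and> card EH \<ge> 1}"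

lemma finite_Psi_set: "finite Psi_set"
proof -
  have "Psi_set \<subseteq> (\<lambda>(VH, EH). real n ^ card VH * p ^ card EH) ` (Pow V0 \<times> Pow E0)"
    by (auto simp: Psi_set_def)
  then show ?thesis using finite_V0 finite_E0 by (auto intro: finite_subset)
qed

lemma Psi_set_nonempty: "Psi_set \<noteq> {}"
proof -
  have "real n ^ card V0 * p ^ card E0 \<in> Psi_set"
    unfolding Psi_set_def using V1_subset e_pos by (intro CollectI exI[of _ V0] exI[of _ E0]) auto
  then show ?thesis by blast
qed

lemma Psi_le:
  assumes "H \<subseteq> E0" "H \<noteq> {}"
  shows "\<Psi> \<le> real n ^ card (\<Union>H) * p ^ card H"
proof -
  have "0 < card H" using assms finite_E0 finite_subset by (auto simp: card_gt_0_iff)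
  then have "real n ^ card (\<Union>H) * p ^ card H \<in> Psi_set"
    unfolding Psi_set_def using assms V1_subset by (intro CollectI exI[of _ "\<Union>H"] exI[of _ H]) auto
  then show ?thesis unfolding Psi_min_def Psi_set_def[symmetric] using finite_Psi_set by (rule Min_le[rotated])
qed

text \<open>Discarding the isolated vertices of a minimiser can only lower its value, because
  \<open>n\<close> is at least 1.\<close>

lemma Psi_attained: "\<exists>H. H \<subseteq> E0 \<and> H \<noteq> {} \<and> real n ^ card (\<Union>H) * p ^ card H \<le> \<Psi>"
proof -
  have "\<Psi> \<in> Psi_set"
    unfolding Psi_min_def Psi_set_def[symmetric] by (rule Min_in[OF finite_Psi_set Psi_set_nonempty])
  then obtain VH EH where H: "\<Psi> = real n ^ card VH * p ^ card EH" "VH \<subseteq> V0" "EH \<subseteq> E0"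
    "\<forall>e\<in>EH. e \<subseteq> VH" "1 \<le> card EH" unfolding Psi_set_def by auto
  have "card (\<Union>EH) \<le> card VH" using H finite_V0 finite_subset by (intro card_mono) auto
  then have "real n ^ card (\<Union>EH) \<le> real n ^ card VH" using n_pos by (intro power_increasing) auto
  then have "real n ^ card (\<Union>EH) * p ^ card EH \<le> \<Psi>" unfolding H(1) using p by (intro mult_right_mono) auto
  moreover have "EH \<noteq> {}" using H(5) by auto
  ultimately show ?thesis using H(3) by blast
qed

lemma Psi_pos: "0 < \<Psi>"
proof -
  obtain H :: "'a set set" where "real n ^ card (\<Union>H) * p ^ card H \<le> \<Psi>" using Psi_attained by blast
  moreover have "0 < real n ^ card (\<Union>H) * p ^ card H" using n_pos p by simp
  ultimately show ?thesis by linarith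
qed

lemma num_copies_eq: "num_copies n V0 E0 (\<lambda>x. x \<in> S) = (\<Sum>G\<in>M. incl G S)"
  unfolding num_copies_def by (intro sum.cong refl) (auto simp: incl_def)

lemma mean_copies: "measure_pmf.expectation (Gnp n p) (num_copies n V0 E0) = card M * p ^ e"
proof -
  have "measure_pmf.expectation (Gnp n p) (num_copies n V0 E0) = (\<Sum>G\<in>M. B.expect (incl G))"
    by (simp add: Gnp_expectation[OF p] num_copies_eq B.expect_sum)
  also have "\<dots> = (\<Sum>G\<in>M. p ^ e)"
    using copies_subset card_copy by (intro sum.cong refl) (simp add: B.expect_incl)
  finally show ?thesis by simp
qed

definition \<mu> where "\<mu> = card M * p ^ e"

lemma \<mu>_pos: "0 < \<mu>"
  using copies_nonempty p by (simp add: \<mu>_def card_gt_0_iff)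

lemma variance_copies: "measure_pmf.variance (Gnp n p) (num_copies n V0 E0)
    = B.expect (\<lambda>S. ((\<Sum>G\<in>M. incl G S) - card M * p ^ e)\<^sup>2)"
  unfolding mean_copies by (simp only: Gnp_expectation[OF p] num_copies_eq)

lemma variance_copies_ge: "q * \<mu>\<^sup>2 \<le> measure_pmf.variance (Gnp n p) (num_copies n V0 E0) * \<Psi>"
proof -
  obtain H where H: "H \<subseteq> E0" "H \<noteq> {}" "real n ^ card (\<Union>H) * p ^ card H \<le> \<Psi>"
    using Psi_attained by blast
  obtain \<phi> where \<phi>: "\<And>G. G \<in> M \<Longrightarrow> \<phi> G \<in> emb \<and> img (\<phi> G) = G"
    using copies_are_images by metis
  define F where "F G = (`) (\<phi> G) ` H" for G
  have UH: "\<Union>H \<subseteq> V1" using H by blast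
  have finH: "finite (\<Union>H)" "finite H" using UH finite_V1 H finite_E0 finite_subset by blast+
  have F: "F G \<subseteq> G \<and> card (F G) = card H" if "G \<in> M" for G
  proof
    have "F G \<subseteq> img (\<phi> G)" unfolding F_def img_def using H by (intro image_mono)
    then show "F G \<subseteq> G" using \<phi>[OF that] by simp
    have "inj_on (\<phi> G) V1" using \<phi>[OF that] by (simp add: emb_def)
    then have "inj_on (\<phi> G) (\<Union>H)" using UH by (rule inj_on_subset)
    then show "card (F G) = card H" unfolding F_def by (intro card_image inj_on_image_edges)
  qed
  have "F ` M \<subseteq> (\<lambda>g. (`) g ` H) ` (\<Union>H \<rightarrow>\<^sub>E {..<n})"
  proof (rule image_subsetI)
    fix G assume G: "G \<in> M"
    have "F G = (`) (restrict (\<phi> G) (\<Union>H)) ` H"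
      unfolding F_def by (intro image_cong refl) auto
    moreover have "\<phi> G u \<in> {..<n}" if "u \<in> \<Union>H" for u
      using \<phi>[OF G] UH that by (auto simp: emb_def)
    then have "restrict (\<phi> G) (\<Union>H) \<in> \<Union>H \<rightarrow>\<^sub>E {..<n}" by (simp only: restrict_PiE_iff) blast
    ultimately show "F G \<in> (\<lambda>g. (`) g ` H) ` (\<Union>H \<rightarrow>\<^sub>E {..<n})" by blast
  qed
  then have "card (F ` M) \<le> card (\<Union>H \<rightarrow>\<^sub>E {..<n})"
    using finH by (intro surj_card_le finite_PiE) auto
  also have "\<dots> = n ^ card (\<Union>H)" using finH by (simp add: card_PiE)
  finally have "real (card (F ` M)) \<le> real (n ^ card (\<Union>H))" by (rule of_nat_mono)
  then have "card (F ` M) * p ^ card H \<le> real n ^ card (\<Union>H) * p ^ card H"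
    using p by (intro mult_right_mono) auto
  then have FM: "card (F ` M) * p ^ card H \<le> \<Psi>" using H(3) by linarith
  let ?V = "B.expect (\<lambda>S. ((\<Sum>G\<in>M. incl G S) - card M * p ^ e)\<^sup>2)"
  have "q * (card M * p ^ e)\<^sup>2 \<le> ?V * (card (F ` M) * p ^ card H)"
    using copies_subset card_copy F finH H
    by (intro B.variance_lower_bound) (auto simp: card_gt_0_iff)
  also have "\<dots> \<le> ?V * \<Psi>" using FM by (intro mult_left_mono B.expect_nonneg) auto
  finally show ?thesis by (simp add: variance_copies \<mu>_def)
qed

lemma sigma_pos: "0 < \<sigma>" and sigma_square: "\<sigma>\<^sup>2 = measure_pmf.variance (Gnp n p) (num_copies n V0 E0)"
proof -
  have "0 < q * \<mu>\<^sup>2" using p \<mu>_pos by simp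
  then have "0 < measure_pmf.variance (Gnp n p) (num_copies n V0 E0) * \<Psi>" using variance_copies_ge by linarith
  then have *: "0 < measure_pmf.variance (Gnp n p) (num_copies n V0 E0)" using Psi_pos by (simp add: zero_less_mult_iff)
  then show "0 < \<sigma>" by (simp add: sigma_copies_def)
  show "\<sigma>\<^sup>2 = measure_pmf.variance (Gnp n p) (num_copies n V0 E0)" using * by (simp add: sigma_copies_def)
qed

definition \<kappa> :: real where "\<kappa> = 4 / 3 * fact (card V1)"

text \<open>If some copy contains \<open>F\<close>, an embedding pulls \<open>F\<close> back to a
  subgraph of the pattern with as many edges and covered vertices, so its count is at least
  \<open>\<Psi>\<close>.\<close>

lemma copies_of_subgraph_le:
  assumes "F \<noteq> {}" "finite F"
  shows "card {G \<in> M. F \<subseteq> G} * p ^ (e - card F) \<le> \<kappa> * \<mu> / \<Psi>"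
proof (cases "{G \<in> M. F \<subseteq> G} = {}")
  case False
  then obtain G where G: "G \<in> M" "F \<subseteq> G" by blast
  obtain \<phi> where \<phi>: "\<phi> \<in> emb" "img \<phi> = G" using copies_are_images[OF G(1)] by blast
  define H where "H = {x \<in> E0. \<phi> ` x \<in> F}"
  have FH: "F = (`) \<phi> ` H" using G(2) \<phi>(2) by (auto simp: H_def img_def)
  have UH: "\<Union>H \<subseteq> V1" "H \<subseteq> E0" by (auto simp: H_def)
  have inj: "inj_on \<phi> (\<Union>H)" using \<phi> UH by (auto simp: emb_def intro: inj_on_subset)
  have "card F = card H" unfolding FH by (intro card_image inj_on_image_edges inj)
  moreover have "\<Union>F = \<phi> ` \<Union>H" unfolding FH by blast
  then have "card (\<Union>F) = card (\<Union>H)" using inj by (simp add: card_image)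
  ultimately have "\<Psi> \<le> real n ^ card (\<Union>F) * p ^ card F"
    using Psi_le[OF UH(2)] FH assms by auto
  moreover have "card F \<le> e" using card_mono[OF finite_copy[OF G(1)] G(2)] card_copy[OF G(1)] by simp
  ultimately have "card {G \<in> M. F \<subseteq> G} * p ^ (e - card F) * \<Psi>
     \<le> card {G \<in> M. F \<subseteq> G} * p ^ (e - card F) * (real n ^ card (\<Union>F) * p ^ card F)"
    using p by (intro mult_left_mono) auto
  also have "\<dots> = (card {G \<in> M. F \<subseteq> G} * real n ^ card (\<Union>F)) * p ^ e"
    using \<open>card F \<le> e\<close> by (simp add: power_add[symmetric] mult_ac)
  also have "\<dots> \<le> (4 / 3 * fact (card V1) * card M) * p ^ e"
    using p by (intro mult_right_mono card_copies_containing_le assms) auto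
  finally show ?thesis using Psi_pos by (simp add: pos_le_divide_eq \<kappa>_def \<mu>_def mult_ac)
next
  case True
  have "0 \<le> \<kappa> * \<mu> / \<Psi>" using Psi_pos \<mu>_pos by (simp add: \<kappa>_def)
  then show ?thesis unfolding True by simp
qed

definition l :: "nat \<Rightarrow> real" where "l r = 2 ^ (r * e) * (\<kappa> * \<mu> / \<Psi>)"

text \<open>Copies are grouped by their trace on \<open>S\<close>, a nonempty subset; there are at
  most \<open>2 ^ (r * e)\<close> traces. These are the powers of 2 in the final constant.\<close>

lemma chain_bound:
  assumes S: "S \<subseteq> Kn_edges n" "card S \<le> r * e"
  shows "(\<Sum>G\<in>{G \<in> M. G \<inter> S \<noteq> {}}. p ^ card (G - S)) \<le> l r"
proof -
  have finS: "finite S" using S finite_subset by (metis finite_Kn_edges)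
  have nonneg: "0 \<le> \<kappa> * \<mu> / \<Psi>" using Psi_pos \<mu>_pos by (simp add: \<kappa>_def)
  let ?N = "{G \<in> M. G \<inter> S \<noteq> {}}"
  let ?NF = "\<lambda>F. {G. G \<in> ?N \<and> G \<inter> S = F}"
  have "(\<Sum>G\<in>?N. p ^ card (G - S)) = (\<Sum>F\<in>Pow S - {{}}. \<Sum>G\<in>?NF F. p ^ card (G - S))"
    using finS by (intro sum.group[symmetric]) auto
  also have "\<dots> \<le> (\<Sum>F\<in>Pow S - {{}}. \<kappa> * \<mu> / \<Psi>)"
  proof (rule sum_mono)
    fix F assume F: "F \<in> Pow S - {{}}"
    then have finF: "finite F" "F \<noteq> {}" using finS finite_subset by auto
    have "(\<Sum>G\<in>?NF F. p ^ card (G - S)) = (\<Sum>G\<in>?NF F. p ^ (e - card F))"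
    proof (intro sum.cong refl)
      fix G assume "G \<in> ?NF F"
      then have G: "G \<in> M" "G \<inter> S = F" by auto
      have "card (G - S) = card G - card (G \<inter> S)" by (rule card_Diff_subset_Int) (use finS in auto)
      then show "p ^ card (G - S) = p ^ (e - card F)" using G card_copy by simp
    qed
    also have "\<dots> \<le> (\<Sum>G\<in>{G \<in> M. F \<subseteq> G}. p ^ (e - card F))"
      using p by (intro sum_mono2) auto
    also have "\<dots> = card {G \<in> M. F \<subseteq> G} * p ^ (e - card F)" by simp
    also have "\<dots> \<le> \<kappa> * \<mu> / \<Psi>" by (rule copies_of_subgraph_le[OF finF(2,1)])
    finally show "(\<Sum>G\<in>?NF F. p ^ card (G - S)) \<le> \<kappa> * \<mu> / \<Psi>" .
  qed
  also have "\<dots> = card (Pow S - {{}}) * (\<kappa> * \<mu> / \<Psi>)" by simp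
  also have "\<dots> \<le> 2 ^ (r * e) * (\<kappa> * \<mu> / \<Psi>)"
  proof (intro mult_right_mono nonneg)
    have "card (Pow S - {{}}) \<le> card (Pow S)" using finS by (intro card_mono) auto
    also have "\<dots> = 2 ^ card S" using finS by (rule card_Pow)
    also have "\<dots> \<le> 2 ^ (r * e)" using S(2) by (intro power_increasing) auto
    finally have "real (card (Pow S - {{}})) \<le> real (2 ^ (r * e))" by (rule of_nat_mono)
    then show "real (card (Pow S - {{}})) \<le> 2 ^ (r * e)" by simp
  qed
  finally show ?thesis by (simp add: l_def)
qed

sublocale C: chained "Kn_edges n" p q M e \<sigma> "D_copies n V0 E0" l
proof unfold_locales
  show "i \<subseteq> Kn_edges n" if "i \<in> M" for i by (rule copies_subset[OF that])
  show "card i = e" if "i \<in> M" for i by (rule card_copy[OF that])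
  show "0 < e" by (rule e_pos)
  show "0 < \<sigma>" by (rule sigma_pos)
  show "B.expect (\<lambda>S. ((\<Sum>i\<in>M. incl i S) - card M * p ^ e)\<^sup>2) = \<sigma>\<^sup>2" by (simp only: sigma_square variance_copies)
  show "card {j \<in> M. j \<inter> i \<noteq> {}} \<le> D_copies n V0 E0" if "i \<in> M" for i using D_copies_eq[OF that] by simp
  show "(\<Sum>j\<in>{j \<in> M. j \<inter> S \<noteq> {}}. p ^ card (j - S)) \<le> l r" if "S \<subseteq> Kn_edges n" "card S \<le> r * e" for S r
    by (rule chain_bound[OF that])
qed

lemma prob_W: "measure_pmf.prob (Gnp n p) {\<omega>. W_copies n p V0 E0 \<omega> > t} = B.expect (\<lambda>S. of_bool (t < C.W S))"
proof -
  have "measure_pmf.prob (Gnp n p) {\<omega>. W_copies n p V0 E0 \<omega> > t}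
    = measure_pmf.expectation (Gnp n p) (indicator {\<omega>. W_copies n p V0 E0 \<omega> > t})" by simp
  also have "\<dots> = B.expect (\<lambda>S. indicator {\<omega>. W_copies n p V0 E0 \<omega> > t} (\<lambda>x. x \<in> S))"
    by (rule Gnp_expectation[OF p])
  also have "\<dots> = B.expect (\<lambda>S. of_bool (t < C.W S))"
    by (intro B.expect_cong) (simp add: indicator_def W_copies_def C.W_def num_copies_eq mean_copies)
  finally show ?thesis .
qed

end

section \<open>The bound with explicit constants\<close>

text \<open>Here \<open>A\<close> is 2^e, \<open>f\<close> is v! and \<epsilon> is the number of
  edges. Up to constants the left side is q z^2 / \<Psi>^3, and z <= \<Psi> / q reduces it to 1 / (q
  \<Psi>). The overlaps use A^(1+2+3); the right side has \<open>A ^ 12\<close> because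
  \<open>K\<close> is shared with \<open>Q_constant\<close>, and the spare \<open>A ^ 6\<close>
  absorbs the numerical factor.\<close>

lemma energy_constant:
  fixes q :: real
  assumes pos: "0 < q" "0 < \<Psi>" "0 < \<sigma>" "0 < \<mu>" and z: "q * \<mu>\<^sup>2 \<le> \<sigma>\<^sup>2 * \<Psi>"
    and \<kappa>: "0 \<le> \<kappa>" "\<kappa> \<le> 4 / 3 * f" and f: "1 \<le> f" and A: "2 \<le> A"
  shows "6 * q * (1 / \<sigma>\<^sup>2)\<^sup>2 * (2 * \<epsilon> * \<epsilon>)\<^sup>2 *
      (2 * \<mu> * (A ^ 1 * (\<kappa> * \<mu> / \<Psi>)) * (A ^ 2 * (\<kappa> * \<mu> / \<Psi>)) * (A ^ 3 * (\<kappa> * \<mu> / \<Psi>)))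
    \<le> (8 * \<epsilon>\<^sup>2 * f\<^sup>2 * A ^ 6 / sqrt (q * \<Psi>))\<^sup>2"
proof -
  define z where "z = \<mu>\<^sup>2 / \<sigma>\<^sup>2"
  have z0: "0 \<le> z" "z \<le> \<Psi> / q" using pos z by (auto simp: z_def field_simps)
  have "6 * q * (1 / \<sigma>\<^sup>2)\<^sup>2 * (2 * \<epsilon> * \<epsilon>)\<^sup>2 *
      (2 * \<mu> * (A ^ 1 * (\<kappa> * \<mu> / \<Psi>)) * (A ^ 2 * (\<kappa> * \<mu> / \<Psi>)) * (A ^ 3 * (\<kappa> * \<mu> / \<Psi>)))
    = 48 * \<epsilon> ^ 4 * A ^ 6 * \<kappa> ^ 3 * (q * z\<^sup>2 / \<Psi> ^ 3)"
    using pos by (simp add: z_def field_simps eval_nat_numeral)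
  also have "\<dots> \<le> (64 * \<epsilon> ^ 4 * f ^ 4 * A ^ 12) * (1 / (q * \<Psi>))"
  proof (rule mult_mono)
    have "\<kappa> ^ 3 \<le> (4 / 3 * f) ^ 3" using \<kappa> by (intro power_mono)
    also have "\<dots> \<le> 64 / 27 * f ^ 4"
      using f power_increasing[of 3 4 f] by (simp add: power_mult_distrib power_divide)
    finally have "\<kappa> ^ 3 \<le> 64 / 27 * f ^ 4" .
    moreover have "0 \<le> f ^ 4" by simp
    ultimately have k: "48 * \<kappa> ^ 3 \<le> 64 * f ^ 4 * 2" by linarith
    have "(2 :: real) \<le> 2 ^ 6" by simp
    also have "\<dots> \<le> A ^ 6" using A by (intro power_mono) auto
    finally have "64 * f ^ 4 * 2 \<le> 64 * f ^ 4 * A ^ 6" using f by (intro mult_left_mono) auto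
    with k have "\<epsilon> ^ 4 * A ^ 6 * (48 * \<kappa> ^ 3) \<le> \<epsilon> ^ 4 * A ^ 6 * (64 * f ^ 4 * A ^ 6)"
      using A by (intro mult_left_mono) auto
    then show "48 * \<epsilon> ^ 4 * A ^ 6 * \<kappa> ^ 3 \<le> 64 * \<epsilon> ^ 4 * f ^ 4 * A ^ 12"
      by (simp add: mult_ac power_add[symmetric])
    have "z\<^sup>2 \<le> (\<Psi> / q)\<^sup>2" using z0 by (intro power_mono)
    then have "q * z\<^sup>2 / \<Psi> ^ 3 \<le> q * (\<Psi> / q)\<^sup>2 / \<Psi> ^ 3"
      using pos by (intro divide_right_mono mult_left_mono) auto
    also have "\<dots> = 1 / (q * \<Psi>)" using pos by (simp add: field_simps eval_nat_numeral)
    finally show "q * z\<^sup>2 / \<Psi> ^ 3 \<le> 1 / (q * \<Psi>)" .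
  qed (use pos f A in auto)
  also have "\<dots> = (8 * \<epsilon>\<^sup>2 * f\<^sup>2 * A ^ 6 / sqrt (q * \<Psi>))\<^sup>2"
    using pos by (simp add: power_divide power_mult_distrib power_mult[symmetric])
  finally show ?thesis .
qed

text \<open>\<open>small\<close> turns the factor with the sum into at most 2 \<mu>, so the
  remaining overlaps give A^(1+2+4+5). Its root is the \<open>A ^ 6\<close> in
  \<open>K\<close>.\<close>

lemma Q_constant:
  fixes q :: real
  assumes pos: "0 < q" "0 < \<Psi>" "0 < \<sigma>" "0 < \<mu>" and z: "q * \<mu>\<^sup>2 \<le> \<sigma>\<^sup>2 * \<Psi>"
    and \<kappa>: "0 \<le> \<kappa>" "\<kappa> \<le> 4 / 3 * f" and f: "1 \<le> f" and A: "2 \<le> A"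
    and small: "A ^ 3 * (\<kappa> * \<mu> / \<Psi>) \<le> \<mu>"
  shows "(q * (1 / \<sigma>\<^sup>2) * (2 * \<epsilon> * \<epsilon>) / \<sigma>)\<^sup>2 *
      (\<mu> * (A ^ 1 * (\<kappa> * \<mu> / \<Psi>)) * (A ^ 2 * (\<kappa> * \<mu> / \<Psi>)) * (\<mu> + A ^ 3 * (\<kappa> * \<mu> / \<Psi>))
        * (A ^ 4 * (\<kappa> * \<mu> / \<Psi>)) * (A ^ 5 * (\<kappa> * \<mu> / \<Psi>)))
    \<le> (8 * \<epsilon>\<^sup>2 * f\<^sup>2 * A ^ 6 / sqrt (q * \<Psi>))\<^sup>2"
proof -
  define z where "z = \<mu>\<^sup>2 / \<sigma>\<^sup>2"
  have z0: "0 \<le> z" "z \<le> \<Psi> / q" using pos z by (auto simp: z_def field_simps)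
  have y: "0 \<le> \<kappa> * \<mu> / \<Psi>" using pos \<kappa> by simp
  have "(q * (1 / \<sigma>\<^sup>2) * (2 * \<epsilon> * \<epsilon>) / \<sigma>)\<^sup>2 *
      (\<mu> * (A ^ 1 * (\<kappa> * \<mu> / \<Psi>)) * (A ^ 2 * (\<kappa> * \<mu> / \<Psi>)) * (\<mu> + A ^ 3 * (\<kappa> * \<mu> / \<Psi>))
        * (A ^ 4 * (\<kappa> * \<mu> / \<Psi>)) * (A ^ 5 * (\<kappa> * \<mu> / \<Psi>)))
    \<le> (q * (1 / \<sigma>\<^sup>2) * (2 * \<epsilon> * \<epsilon>) / \<sigma>)\<^sup>2 *
      (\<mu> * (A ^ 1 * (\<kappa> * \<mu> / \<Psi>)) * (A ^ 2 * (\<kappa> * \<mu> / \<Psi>)) * (2 * \<mu>)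
        * (A ^ 4 * (\<kappa> * \<mu> / \<Psi>)) * (A ^ 5 * (\<kappa> * \<mu> / \<Psi>)))"
    using small pos y A by (intro mult_left_mono mult_right_mono mult_nonneg_nonneg) auto
  also have "\<dots> = 8 * \<epsilon> ^ 4 * A ^ 12 * \<kappa> ^ 4 * (q\<^sup>2 * z ^ 3 / \<Psi> ^ 4)"
    using pos by (simp add: z_def field_simps eval_nat_numeral)
  also have "\<dots> \<le> (64 * \<epsilon> ^ 4 * f ^ 4 * A ^ 12) * (1 / (q * \<Psi>))"
  proof (rule mult_mono)
    have "\<kappa> ^ 4 \<le> (4 / 3 * f) ^ 4" using \<kappa> by (intro power_mono)
    also have "\<dots> \<le> 8 * f ^ 4" by (simp add: power_mult_distrib power_divide)
    finally have "\<epsilon> ^ 4 * A ^ 12 * (8 * \<kappa> ^ 4) \<le> \<epsilon> ^ 4 * A ^ 12 * (64 * f ^ 4)"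
      using A by (intro mult_left_mono) auto
    then show "8 * \<epsilon> ^ 4 * A ^ 12 * \<kappa> ^ 4 \<le> 64 * \<epsilon> ^ 4 * f ^ 4 * A ^ 12" by (simp add: mult_ac)
    have "z ^ 3 \<le> (\<Psi> / q) ^ 3" using z0 by (intro power_mono)
    then have "q\<^sup>2 * z ^ 3 / \<Psi> ^ 4 \<le> q\<^sup>2 * (\<Psi> / q) ^ 3 / \<Psi> ^ 4"
      using pos by (intro divide_right_mono mult_left_mono) auto
    also have "\<dots> = 1 / (q * \<Psi>)" using pos by (simp add: field_simps eval_nat_numeral)
    finally show "q\<^sup>2 * z ^ 3 / \<Psi> ^ 4 \<le> 1 / (q * \<Psi>)" .
  qed (use pos f A z0 in auto)
  also have "\<dots> = (8 * \<epsilon>\<^sup>2 * f\<^sup>2 * A ^ 6 / sqrt (q * \<Psi>))\<^sup>2"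
    using pos by (simp add: power_divide power_mult_distrib power_mult[symmetric])
  finally show ?thesis .
qed

context random_pattern
begin

section \<open>Comparison with the stated constants\<close>

definition c :: real where
  "c = 2 powr (9/2 + 15/2 * real (card E0)) * real (fact (card V0)) ^ 4 * real (card E0)
       / real (aut V0 E0) powr (3/2)"

definition s :: "real \<Rightarrow> real" where
  "s t = (1 + t / min (sqrt \<Psi>) 1) * (1 / sqrt (q * \<Psi>)) * exp (5 * real (D_copies n V0 E0) * t / \<sigma>)"

text \<open>From aut <= v! the denominator is at most (v!)^2 and cancels two of the four factorials;
  e <= 2^e trades one factor e for a power of 2, and 4 + 7e <= 9/2 + 15e/2.\<close>

lemma c_ge: "16 * (real e)\<^sup>2 * (fact (card V0))\<^sup>2 * (2 ^ e) ^ 6 \<le> c"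
proof -
  let ?f = "fact (card V0) :: real"
  define a where "a = real (aut V0 E0)"
  have "real (aut V0 E0) \<le> real (fact (card V0))" by (rule of_nat_mono[OF aut_le])
  then have a: "0 < a" "a \<le> ?f" using aut_pos by (simp_all add: a_def)
  have f: "1 \<le> ?f" by simp
  have "a powr (3/2) \<le> ?f powr (3/2)" using a by (intro powr_mono2) auto
  also have "\<dots> \<le> ?f powr 2" using f by (intro powr_mono) auto
  also have "\<dots> = ?f\<^sup>2" using f by (simp add: powr_numeral)
  finally have af: "a powr (3/2) \<le> ?f\<^sup>2" .
  have "?f\<^sup>2 * a powr (3/2) \<le> ?f\<^sup>2 * ?f\<^sup>2" using af by (intro mult_left_mono) auto
  also have "\<dots> = ?f ^ 4" by (simp add: power_add[symmetric])
  finally have f2: "?f\<^sup>2 \<le> ?f ^ 4 / a powr (3/2)" using a by (simp add: pos_le_divide_eq)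
  have "16 * real e * (2 ^ e) ^ 6 \<le> 16 * 2 ^ e * (2 ^ e) ^ 6"
    using of_nat_mono[OF less_imp_le[OF less_exp[of e]], where 'a = real] by simp
  also have "\<dots> = 2 powr (4 + 7 * real e)"
  proof -
    have "2 powr (4 + 7 * real e) = 2 powr real (4 + 7 * e)" by simp
    also have "\<dots> = 2 ^ (4 + 7 * e)" by (rule powr_realpow) simp
    also have "\<dots> = 16 * 2 ^ e * (2 ^ e) ^ 6"
      by (simp add: power_add power_mult[symmetric] mult.commute[of e] eval_nat_numeral)
    finally show ?thesis by simp
  qed
  also have "\<dots> \<le> 2 powr (9/2 + 15/2 * real e)" by (intro powr_mono) auto
  finally have 2: "16 * real e * (2 ^ e) ^ 6 \<le> 2 powr (9/2 + 15/2 * real e)" .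
  have "16 * (real e)\<^sup>2 * ?f\<^sup>2 * (2 ^ e) ^ 6 = (16 * real e * (2 ^ e) ^ 6) * ?f\<^sup>2 * real e"
    by (simp add: power2_eq_square)
  also have "\<dots> \<le> 2 powr (9/2 + 15/2 * real e) * (?f ^ 4 / a powr (3/2)) * real e"
    using 2 f2 by (intro mult_right_mono mult_mono) auto
  finally show ?thesis by (simp add: c_def a_def)
qed

lemma c_ge_1: "1 \<le> c"
proof -
  have "1 * 1 * 1 * 1 \<le> 16 * (real e)\<^sup>2 * (fact (card V0))\<^sup>2 * (2 ^ e) ^ 6"
    using e_pos by (intro mult_mono) (auto simp: one_le_power power_mult[symmetric])
  then show ?thesis using c_ge by simp
qed

lemma s_ge:
  assumes "0 \<le> t"
  shows "(1 + t) * exp (5 * real (D_copies n V0 E0) * t / \<sigma>) / sqrt (q * \<Psi>) \<le> s t"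
proof -
  have m: "0 < min (sqrt \<Psi>) 1" "min (sqrt \<Psi>) 1 \<le> 1" using Psi_pos by auto
  have "t / 1 \<le> t / min (sqrt \<Psi>) 1" using m assms by (intro divide_left_mono) auto
  then have "(1 + t) * (exp (5 * real (D_copies n V0 E0) * t / \<sigma>) / sqrt (q * \<Psi>))
    \<le> (1 + t / min (sqrt \<Psi>) 1) * (exp (5 * real (D_copies n V0 E0) * t / \<sigma>) / sqrt (q * \<Psi>))"
    using Psi_pos p by (intro mult_right_mono) auto
  then show ?thesis by (simp add: s_def)
qed

lemma tail_bound_large:
  assumes t: "0 \<le> t" and cs: "1 / 2 \<le> c * s t"
  shows "\<bar>measure_pmf.prob (Gnp n p) {\<omega>. W_copies n p V0 E0 \<omega> > t} / (1 - Phi t) - 1\<bar>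
    \<le> 50 * c * exp (c * t\<^sup>2 * s t) * (1 + t\<^sup>2) * s t"
proof -
  let ?P = "measure_pmf.prob (Gnp n p) {\<omega>. W_copies n p V0 E0 \<omega> > t}"
  have pairs: "0 \<le> ?P" "?P \<le> 1" by auto
  note tail = one_minus_Phi_pos[OF t] inverse_tail_le[OF t]
  have "?P / (1 - Phi t) \<le> 1 / (1 - Phi t)" using pairs tail(1) by (intro divide_right_mono) auto
  moreover have "0 \<le> ?P / (1 - Phi t)" using pairs tail(1) by simp
  moreover have "2.6 * (1 + t) * exp (t\<^sup>2 / 2) \<le> 25 * (1 + t\<^sup>2) * exp (t\<^sup>2 / 2)"
  proof (intro mult_right_mono)
    have "0 \<le> (t - 1)\<^sup>2" by simp
    then have "2 * t \<le> t\<^sup>2 + 1" by (simp add: power2_diff)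
    moreover have "0 \<le> t\<^sup>2" by simp
    ultimately have "26 * t \<le> 224 + 250 * t\<^sup>2" by linarith
    then show "2.6 * (1 + t) \<le> 25 * (1 + t\<^sup>2)" by (simp add: field_simps)
  qed simp
  moreover have "1 * 1 \<le> 25 * (1 + t\<^sup>2) * exp (t\<^sup>2 / 2)"
    by (intro mult_mono) auto
  ultimately have "\<bar>?P / (1 - Phi t) - 1\<bar> \<le> 25 * (1 + t\<^sup>2) * exp (t\<^sup>2 / 2)"
    using tail(2) by linarith
  \<comment> \<open>The assumption on \<open>c * s t\<close> is used twice: for 25 <= 50 c s and for
    the exponent t^2 / 2 <= c t^2 s.\<close>
  also have "\<dots> \<le> 50 * (c * s t) * (1 + t\<^sup>2) * exp (t\<^sup>2 * (c * s t))"
    using cs mult_left_mono[OF cs, of "t\<^sup>2"] by (intro mult_mono) auto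
  also have "\<dots> = 50 * c * exp (c * t\<^sup>2 * s t) * (1 + t\<^sup>2) * s t" by (simp only: mult_ac)
  finally show ?thesis .
qed

text \<open>Here \<open>c \<le> \<Psi>\<close>, which makes the term \<open>l 3\<close> of the six-fold overlap sum negligible against \<open>\<mu>\<close>.\<close>

lemma tail_bound_small:
  assumes t: "0 \<le> t" and cs: "c * s t < 1 / 2"
  shows "\<bar>measure_pmf.prob (Gnp n p) {\<omega>. W_copies n p V0 E0 \<omega> > t} / (1 - Phi t) - 1\<bar>
    \<le> 50 * c * exp (c * t\<^sup>2 * s t) * (1 + t\<^sup>2) * s t"
proof -
  let ?f = "fact (card V0) :: real" and ?A = "2 ^ e :: real" and ?L = "exp (5 * real (D_copies n V0 E0) * t / \<sigma>)"
  define K where "K = 8 * (real e)\<^sup>2 * ?f\<^sup>2 * ?A ^ 6 / sqrt (q * \<Psi>)"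
  define R where "R = 2 * K * (1 + t) * ?L"
  have q: "0 < q" "q \<le> 1" using p by auto
  have f: "1 \<le> ?f" by simp
  have A: "2 \<le> ?A" using e_pos by (cases e) auto
  have \<kappa>: "0 \<le> \<kappa>" "\<kappa> \<le> 4 / 3 * ?f"
  proof -
    have "fact (card V1) \<le> ?f" using V1_subset finite_V0 by (intro fact_mono card_mono) auto
    then show "\<kappa> \<le> 4 / 3 * ?f" by (simp add: \<kappa>_def)
  qed (simp add: \<kappa>_def)
  have var: "q * \<mu>\<^sup>2 \<le> \<sigma>\<^sup>2 * \<Psi>" unfolding sigma_square by (rule variance_copies_ge)
  have l: "l r = ?A ^ r * (\<kappa> * \<mu> / \<Psi>)" for r
    by (simp add: l_def power_mult[symmetric] mult.commute)
  have K: "0 < K" using e_pos q Psi_pos by (simp add: K_def)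
  have L: "1 \<le> ?L" using t sigma_pos by simp
  have R_le: "R \<le> c * s t"
  proof -
    have "R = (16 * (real e)\<^sup>2 * ?f\<^sup>2 * ?A ^ 6) * ((1 + t) * ?L / sqrt (q * \<Psi>))"
      by (simp add: R_def K_def)
    also have "\<dots> \<le> c * s t"
      using c_ge c_ge_1 s_ge[OF t] t q Psi_pos by (intro mult_mono) auto
    finally show ?thesis .
  qed
  have c_Psi: "c \<le> \<Psi>"
  proof -
    have "1 * 1 \<le> (1 + t) * ?L" using t L by (intro mult_mono) auto
    then have "1 / sqrt (q * \<Psi>) \<le> (1 + t) * ?L / sqrt (q * \<Psi>)"
      using q Psi_pos by (intro divide_right_mono) auto
    then have "1 / sqrt (q * \<Psi>) \<le> s t" using s_ge[OF t] by linarith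
    then have "c * (1 / sqrt (q * \<Psi>)) \<le> c * s t" using c_ge_1 by (intro mult_left_mono) auto
    then have "c / sqrt (q * \<Psi>) \<le> 1" using cs by simp
    then have c: "c \<le> sqrt (q * \<Psi>)" using q Psi_pos by (simp add: divide_le_eq)
    have "c * 1 \<le> c * c" using c_ge_1 by (intro mult_left_mono) auto
    also have "\<dots> \<le> sqrt (q * \<Psi>) * sqrt (q * \<Psi>)" using c c_ge_1 q Psi_pos by (intro mult_mono) auto
    also have "\<dots> = q * \<Psi>" using q Psi_pos by simp
    also have "\<dots> \<le> 1 * \<Psi>" using q Psi_pos by (intro mult_right_mono) auto
    finally show ?thesis by simp
  qed
  have small: "?A ^ 3 * (\<kappa> * \<mu> / \<Psi>) \<le> \<mu>"
  proof -
    have "?A ^ 3 * \<kappa> \<le> ?A ^ 6 * (16 * (real e)\<^sup>2 * ?f\<^sup>2)"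
    proof (intro mult_mono)
      show "?A ^ 3 \<le> ?A ^ 6" using A by (intro power_increasing) auto
      have "?f * 1 \<le> ?f * ?f" using f by (intro mult_left_mono) auto
      then have ff: "?f \<le> ?f\<^sup>2" by (simp add: power2_eq_square)
      have "16 * 1 * ?f\<^sup>2 \<le> 16 * (real e)\<^sup>2 * ?f\<^sup>2"
        using e_pos by (intro mult_right_mono mult_left_mono) (auto simp: one_le_power)
      then show "\<kappa> \<le> 16 * (real e)\<^sup>2 * ?f\<^sup>2" using \<kappa>(2) ff f by linarith
    qed (use \<kappa> in auto)
    also have "\<dots> \<le> \<Psi>" using c_ge c_Psi by (simp add: mult_ac)
    finally have "?A ^ 3 * \<kappa> * \<mu> \<le> \<Psi> * \<mu>" using \<mu>_pos by (intro mult_right_mono) auto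
    then show ?thesis using Psi_pos by (simp add: divide_le_eq mult_ac)
  qed
  have \<mu>: "C.\<mu> = \<mu>" by (simp add: C.\<mu>_def \<mu>_def)
  have cond1: "6 * q * (1 / \<sigma>\<^sup>2)\<^sup>2 * (2 * real e * real e)\<^sup>2 * C.C4 \<le> K\<^sup>2"
  proof -
    have "6 * q * (1 / \<sigma>\<^sup>2)\<^sup>2 * (2 * real e * real e)\<^sup>2 * C.C4
      \<le> 6 * q * (1 / \<sigma>\<^sup>2)\<^sup>2 * (2 * real e * real e)\<^sup>2 * (2 * \<mu> * l 1 * l 2 * l 3)"
      using C.C4_le q by (intro mult_left_mono) (auto simp: \<mu>)
    also have "\<dots> \<le> K\<^sup>2"
      unfolding K_def l by (rule energy_constant[OF q(1) Psi_pos sigma_pos \<mu>_pos var \<kappa> f A])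
    finally show ?thesis .
  qed
  have cond2: "(q * (1 / \<sigma>\<^sup>2) * (2 * real e * real e) / \<sigma>)\<^sup>2 * C.C6 \<le> K\<^sup>2"
  proof -
    have "(q * (1 / \<sigma>\<^sup>2) * (2 * real e * real e) / \<sigma>)\<^sup>2 * C.C6
      \<le> (q * (1 / \<sigma>\<^sup>2) * (2 * real e * real e) / \<sigma>)\<^sup>2 * (\<mu> * l 1 * l 2 * (\<mu> + l 3) * l 4 * l 5)"
      using C.C6_le by (intro mult_left_mono) (auto simp: \<mu>)
    also have "\<dots> \<le> K\<^sup>2"
      unfolding K_def l by (rule Q_constant[OF q(1) Psi_pos sigma_pos \<mu>_pos var \<kappa> f A small])
    finally show ?thesis .
  qed
  have R0: "0 \<le> R" using K t by (simp add: R_def)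
  have "\<bar>measure_pmf.prob (Gnp n p) {\<omega>. W_copies n p V0 E0 \<omega> > t} / (1 - Phi t) - 1\<bar>
    \<le> 11 * (1 + t\<^sup>2) * R * exp (t\<^sup>2 * R / 2)"
    unfolding prob_W R_def using C.moderate_deviation[OF t K,
        unfolded of_nat_mult of_nat_power of_nat_numeral, OF cond1 cond2] .
  also have "\<dots> \<le> 50 * (1 + t\<^sup>2) * (c * s t) * exp (t\<^sup>2 * (c * s t))"
  proof (rule mult_mono)
    show "11 * (1 + t\<^sup>2) * R \<le> 50 * (1 + t\<^sup>2) * (c * s t)"
      using R_le R0 by (intro mult_mono) auto
    have "t\<^sup>2 * R / 2 \<le> t\<^sup>2 * R" using R0 by simp
    also have "\<dots> \<le> t\<^sup>2 * (c * s t)" using R_le by (intro mult_left_mono) auto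
    finally show "exp (t\<^sup>2 * R / 2) \<le> exp (t\<^sup>2 * (c * s t))" by simp
  qed (use R0 R_le in auto)
  also have "\<dots> = 50 * c * exp (c * t\<^sup>2 * s t) * (1 + t\<^sup>2) * s t" by (simp only: mult_ac)
  finally show ?thesis .
qed

end

theorem theorem1p4:
  fixes V0 :: "'a set" and E0 :: "'a set set" and n :: nat and p t :: real
  assumes "simple_graph V0 E0" and "E0 \<noteq> {}"
    and "0 < p" and "p < 1"
    and "real n \<ge> 4 * real (card V0) ^ 2"
    and "t \<ge> 0"
  shows "let q = 1 - p; \<Psi> = Psi_min n p V0 E0; D = real (D_copies n V0 E0);
             \<sigma> = sigma_copies n p V0 E0;
             s = (1 + t / min (sqrt \<Psi>) 1) * (1 / sqrt (q * \<Psi>)) * exp (5 * D * t / \<sigma>);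
             c = 2 powr (9/2 + 15/2 * real (card E0)) * real (fact (card V0)) ^ 4 * real (card E0)
                 / real (aut V0 E0) powr (3/2)
         in \<bar>measure_pmf.prob (Gnp n p) {\<omega>. W_copies n p V0 E0 \<omega> > t} / (1 - Phi t) - 1\<bar>
            \<le> 50 * c * exp (c * t^2 * s) * (1 + t^2) * s"
proof -
  have "real (4 * (card V0)\<^sup>2) \<le> real n" using assms(5) by simp
  then have "4 * (card V0)\<^sup>2 \<le> n" by (simp only: of_nat_le_iff)
  then interpret random_pattern V0 E0 n p
    using assms by unfold_locales auto
  show ?thesis
    unfolding Let_def s_def[symmetric] c_def[symmetric]
    using tail_bound_large[OF assms(6)] tail_bound_small[OF assms(6)] by (cases "1 / 2 \<le> c * s t") auto
qed

end
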